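(* Let $\Omega_1\subset\mathbb{R}^{N_1}$ and $\Omega_2\subset\mathbb{R}^{N_2}$ be regions satisfying (B2), and let $\Omega_p:=\Omega_1\times\Omega_2$. Let $\{\lambda_{1j}\}_{j\in\mathbb{N}}$, $\{e_{1j}\}_{j\in\mathbb{N}}$ and $\{\lambda_{2k}\}_{k\in\mathbb{N}}$, $\{e_{2k}\}_{k\in\mathbb{N}}$ be the sequences of Dirichlet Laplacian eigenvalues and eigenfunctions on $\Omega_1$ and $\Omega_2$ respectively, and let $\mathcal{U}:=\{u_{jk}:=e_{1j}\otimes e_{2k}:j,k\in\mathbb{N}\}$ be the resulting family of Dirichlet Laplacian eigenfunctions on $\Omega_p$. Then the only eigenvalues of the Dirichlet Laplacian eigenproblem on $\Omega_p$ are $\lambda_{1j}+\lambda_{2k}$ with $j,k\in\mathbb{N}$, and $H_0^1(\Omega_p)=H_0^1(\Omega_1)\otimes H_0^1(\Omega_2)$, where $\otimes$ denotes the Hilbert tensor product.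
   Context: A region is a nonempty, connected, open subset of $\mathbb{R}^N$. All function spaces are real. Condition (B1) on a region $\Omega\subset\mathbb{R}^N$: $\Omega$ is bounded and its boundary $\partial\Omega:=\overline{\Omega}\setminus\Omega$ is the union of a finite number of disjoint closed Lipschitz surfaces, each having finite surface area. Condition (B2): $\Omega$ satisfies (B1); the imbedding of $H^1(\Omega)$ into $L^p(\Omega)$ is compact for $1\le p<p_s$, where $p_s=2N/(N-2)$ if $N\ge3$ and $p_s=\infty$ if $N=2$ (Rellich theorem); and the trace map $\gamma:H^1(\Omega)\to L^2(\partial\Omega,d\sigma)$ is compact, $\sigma$ being $(N-1)$-dimensional Hausdorff measure ($L^2$-compact trace theorem). The Dirichlet Laplacian eigenproblem on a region $\Omega$ is to find $(\lambda,u)\in\mathbb{R}\times H_0^1(\Omega)$ with $u\neq 0$ such that $\int_\Omega\nabla u\cdot\nabla h\,dx=\lambda\int_\Omega u\,h\,dx$ for all $h\in H_0^1(\Omega)$. $H_0^1(\Omega)$ has the inner product $[u,v]_\nabla:=\int_\Omega\nabla u\cdot\nabla v\,dx$. On each of $\Omega_1,\Omega_2$ the eigenvalues are listed as a sequence of strictly positive numbers tending to $\infty$, repeated according to multiplicity, and the associated eigenfunctions $\{e_{1j}\}$, $\{e_{2k}\}$ are chosen to be orthonormal bases of $L^2(\Omega_1)$, $L^2(\Omega_2)$; then $\{\lambda_{1j}^{-1/2}e_{1j}\}$, $\{\lambda_{2k}^{-1/2}e_{2k}\}$ are orthonormal bases of $H_0^1(\Omega_1)$, $H_0^1(\Omega_2)$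 with respect to $[\cdot,\cdot]_\nabla$. For functions $f$ on $\Omega_1$ and $g$ on $\Omega_2$, $(f\otimes g)(x,y):=f(x)g(y)$. Hilbert tensor product: for real separable Hilbert spaces $H_1\subset L^2(\Omega_1)$, $H_2\subset L^2(\Omega_2)$ with orthonormal bases $\{p_j\}$, $\{q_k\}$, $H_1\otimes H_2$ is the completion of the space of finite linear combinations $g=\sum\hat g_{jk}\,p_j\otimes q_k$ with respect to the inner product $\langle g,h\rangle_\otimes:=\sum_{j,k}\hat g_{jk}\hat h_{jk}$.
   Formalization: H_0^1(Ω_p)=H_0^1(Ω_1)⊗H_0^1(Ω_2) fails as equality of function spaces (norms inequivalent); proved instead: H_0^1(Ω_p) is the H^1-closure of the finite combinations, and is the Hilbert tensor product via the isometry sending p_j⊗q_k to (λ_{1j}+λ_{2k})^{-1/2}u_{jk}. *)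

theory Defs
  imports "HOL-Analysis.Analysis"
begin

section \<open>Lebesgue spaces\<close>

text \<open>
  Functions are total; an element of a function space over a region \<open>\<Omega>\<close> is represented by any
  function whose restriction to \<open>\<Omega>\<close> is Borel, and values outside \<open>\<Omega>\<close> are irrelevant. Every
  almost-everywhere class of Lebesgue measurable functions has a Borel representative, so nothing
  is lost by using \<open>lborel\<close>. Elements are identified when they agree almost everywhere.
\<close>

abbreviation vol :: "'a::euclidean_space set \<Rightarrow> 'a measure" where
  "vol \<Omega> \<equiv> restrict_space lborel \<Omega>"

definition L2 :: "'a measure \<Rightarrow> ('a \<Rightarrow> 'b::euclidean_space) set" where
  "L2 M = {f \<in> borel_measurable M. integrable M (\<lambda>x. (norm (f x))\<^sup>2)}"

definition L2_ip :: "'a measure \<Rightarrow> ('a \<Rightarrow> 'b::euclidean_space) \<Rightarrow> ('a \<Rightarrow> 'b) \<Rightarrow> real" where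
  "L2_ip M f g = (\<integral>x. f x \<bullet> g x \<partial>M)"

definition Lp :: "'a measure \<Rightarrow> real \<Rightarrow> ('a \<Rightarrow> real) set" where
  "Lp M p = {f \<in> borel_measurable M. integrable M (\<lambda>x. \<bar>f x\<bar> powr p)}"

definition Lp_norm :: "'a measure \<Rightarrow> real \<Rightarrow> ('a \<Rightarrow> real) \<Rightarrow> real" where
  "Lp_norm M p f = (\<integral>x. \<bar>f x\<bar> powr p \<partial>M) powr (1 / p)"

definition ip_norm :: "('f \<Rightarrow> 'f \<Rightarrow> real) \<Rightarrow> 'f \<Rightarrow> real" where
  "ip_norm ip u = sqrt (ip u u)"


section \<open>Sobolev spaces\<close>

primrec Ck :: "nat \<Rightarrow> ('a::euclidean_space \<Rightarrow> real) \<Rightarrow> bool" where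
  "Ck 0 f \<longleftrightarrow> continuous_on UNIV f"
| "Ck (Suc k) f \<longleftrightarrow> (\<forall>x. f differentiable (at x)) \<and>
     (\<forall>i\<in>Basis. Ck k (\<lambda>x. frechet_derivative f (at x) i))"

definition test_functions :: "'a::euclidean_space set \<Rightarrow> ('a \<Rightarrow> real) set" where
  "test_functions \<Omega> = {\<phi>. (\<forall>k. Ck k \<phi>) \<and> compact (closure {x. \<phi> x \<noteq> 0}) \<and>
     closure {x. \<phi> x \<noteq> 0} \<subseteq> \<Omega>}"

definition weak_gradient ::
    "'a::euclidean_space set \<Rightarrow> ('a \<Rightarrow> real) \<Rightarrow> ('a \<Rightarrow> 'a) \<Rightarrow> bool" where
  "weak_gradient \<Omega> u G \<longleftrightarrow> G \<in> L2 (vol \<Omega>) \<and>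
     (\<forall>\<phi>\<in>test_functions \<Omega>. \<forall>i\<in>Basis.
        (\<integral>x. u x * frechet_derivative \<phi> (at x) i \<partial>vol \<Omega>) = - (\<integral>x. (G x \<bullet> i) * \<phi> x \<partial>vol \<Omega>))"

definition H1 :: "'a::euclidean_space set \<Rightarrow> ('a \<Rightarrow> real) set" where
  "H1 \<Omega> = {u \<in> L2 (vol \<Omega>). \<exists>G. weak_gradient \<Omega> u G}"

text \<open>On an open set the weak gradient is unique almost everywhere.\<close>

definition grad :: "'a::euclidean_space set \<Rightarrow> ('a \<Rightarrow> real) \<Rightarrow> 'a \<Rightarrow> 'a" where
  "grad \<Omega> u = (SOME G. weak_gradient \<Omega> u G)"

definition grad_ip :: "'a::euclidean_space set \<Rightarrow> ('a \<Rightarrow> real) \<Rightarrow> ('a \<Rightarrow> real) \<Rightarrow> real" where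
  "grad_ip \<Omega> u v = L2_ip (vol \<Omega>) (grad \<Omega> u) (grad \<Omega> v)"

definition H1_ip :: "'a::euclidean_space set \<Rightarrow> ('a \<Rightarrow> real) \<Rightarrow> ('a \<Rightarrow> real) \<Rightarrow> real" where
  "H1_ip \<Omega> u v = L2_ip (vol \<Omega>) u v + grad_ip \<Omega> u v"

definition H1_closure :: "'a::euclidean_space set \<Rightarrow> ('a \<Rightarrow> real) set \<Rightarrow> ('a \<Rightarrow> real) set" where
  "H1_closure \<Omega> V = {u \<in> H1 \<Omega>. \<forall>\<epsilon>>0. \<exists>v\<in>V. ip_norm (H1_ip \<Omega>) (\<lambda>x. u x - v x) < \<epsilon>}"

definition H01 :: "'a::euclidean_space set \<Rightarrow> ('a \<Rightarrow> real) set" where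
  "H01 \<Omega> = H1_closure \<Omega> (test_functions \<Omega>)"


section \<open>Boundary regularity\<close>

definition region :: "'a::euclidean_space set \<Rightarrow> bool" where
  "region \<Omega> \<longleftrightarrow> \<Omega> \<noteq> {} \<and> connected \<Omega> \<and> open \<Omega>"

text \<open>
  Hausdorff measure of dimension \<open>s\<close>, normalised to agree with Lebesgue measure for \<open>s = N\<close>.
  Empty members of a cover contribute nothing, also for \<open>s = 0\<close>.
\<close>

definition hausdorff_pre :: "nat \<Rightarrow> real \<Rightarrow> 'a::euclidean_space set \<Rightarrow> ennreal" where
  "hausdorff_pre s \<delta> A =
     (INF C\<in>{C :: nat \<Rightarrow> 'a set. A \<subseteq> (\<Union>i. C i) \<and> (\<forall>i. bounded (C i) \<and> diameter (C i) \<le> \<delta>)}.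
        \<Sum>i. if C i = {} then 0
             else ennreal (unit_ball_vol (real s) * (diameter (C i) / 2) ^ s))"

definition hausdorff_outer :: "nat \<Rightarrow> 'a::euclidean_space set \<Rightarrow> ennreal" where
  "hausdorff_outer s A = (SUP \<delta>\<in>{0<..}. hausdorff_pre s \<delta> A)"

text \<open>The outer measure is a metric outer measure, hence countably additive on Borel sets.\<close>

definition hausdorff_measure :: "nat \<Rightarrow> 'a::euclidean_space measure" where
  "hausdorff_measure s = measure_of UNIV (sets borel) (hausdorff_outer s)"

definition bdry :: "'a::euclidean_space set \<Rightarrow> 'a set" where
  "bdry \<Omega> = closure \<Omega> - \<Omega>"

definition surf :: "'a::euclidean_space set \<Rightarrow> 'a measure" where
  "surf \<Omega> = restrict_space (hausdorff_measure (DIM('a) - 1)) (bdry \<Omega>)"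

text \<open>
  A closed Lipschitz surface is a compact set that is locally, in suitable orthonormal coordinates,
  the graph of a Lipschitz function over a hyperplane.
\<close>

definition closed_lipschitz_surface :: "'a::euclidean_space set \<Rightarrow> bool" where
  "closed_lipschitz_surface S \<longleftrightarrow> compact S \<and>
     (\<forall>x\<in>S. \<exists>U \<nu> \<phi> C. open U \<and> x \<in> U \<and> norm \<nu> = 1 \<and>
        C-lipschitz_on {y. y \<bullet> \<nu> = 0} (\<phi> :: 'a \<Rightarrow> real) \<and>
        S \<inter> U = {y \<in> U. y \<bullet> \<nu> = \<phi> (y - (y \<bullet> \<nu>) *\<^sub>R \<nu>)})"

definition B1 :: "'a::euclidean_space set \<Rightarrow> bool" where
  "B1 \<Omega> \<longleftrightarrow> region \<Omega> \<and> bounded \<Omega> \<and>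
     (\<exists>\<S>. finite \<S> \<and> disjoint \<S> \<and> bdry \<Omega> = \<Union>\<S> \<and>
        (\<forall>S\<in>\<S>. closed_lipschitz_surface S \<and> hausdorff_outer (DIM('a) - 1) S < \<infinity>))"

text \<open>The critical exponent is taken to be infinite also for \<open>N = 1\<close>.\<close>

definition rellich :: "'a::euclidean_space set \<Rightarrow> bool" where
  "rellich \<Omega> \<longleftrightarrow>
     (\<forall>p::real. 1 \<le> p \<and> (DIM('a) \<ge> 3 \<longrightarrow> p < 2 * real DIM('a) / (real DIM('a) - 2)) \<longrightarrow>
        H1 \<Omega> \<subseteq> Lp (vol \<Omega>) p \<and>
        (\<forall>u. (\<forall>n::nat. u n \<in> H1 \<Omega>) \<and> (\<exists>C. \<forall>n. ip_norm (H1_ip \<Omega>) (u n) \<le> C) \<longrightarrow>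
           (\<exists>r v. strict_mono r \<and> v \<in> Lp (vol \<Omega>) p \<and>
              (\<lambda>n. Lp_norm (vol \<Omega>) p (\<lambda>x. u (r n) x - v x)) \<longlonglongrightarrow> 0)))"

text \<open>
  The trace map is the bounded linear extension of restriction to the boundary, defined on the
  functions in \<open>H1 \<Omega>\<close> that are continuous on the closure of \<open>\<Omega>\<close>.
\<close>

definition trace_map :: "'a::euclidean_space set \<Rightarrow> (('a \<Rightarrow> real) \<Rightarrow> 'a \<Rightarrow> real) \<Rightarrow> bool" where
  "trace_map \<Omega> \<gamma> \<longleftrightarrow>
     (\<forall>u\<in>H1 \<Omega>. \<gamma> u \<in> L2 (surf \<Omega>)) \<and>
     (\<forall>u\<in>H1 \<Omega>. \<forall>v\<in>H1 \<Omega>. \<forall>a b. AE x in surf \<Omega>. \<gamma> (\<lambda>x. a * u x + b * v x) x = a * \<gamma> u x + b * \<gamma> v x) \<and>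
     (\<exists>C. \<forall>u\<in>H1 \<Omega>. ip_norm (L2_ip (surf \<Omega>)) (\<gamma> u) \<le> C * ip_norm (H1_ip \<Omega>) u) \<and>
     (\<forall>u\<in>H1 \<Omega>. continuous_on (closure \<Omega>) u \<longrightarrow> (AE x in surf \<Omega>. \<gamma> u x = u x))"

definition compact_trace :: "'a::euclidean_space set \<Rightarrow> bool" where
  "compact_trace \<Omega> \<longleftrightarrow>
     (\<exists>\<gamma>. trace_map \<Omega> \<gamma> \<and>
        (\<forall>u. (\<forall>n::nat. u n \<in> H1 \<Omega>) \<and> (\<exists>C. \<forall>n. ip_norm (H1_ip \<Omega>) (u n) \<le> C) \<longrightarrow>
           (\<exists>r v. strict_mono r \<and> v \<in> L2 (surf \<Omega>) \<and>
              (\<lambda>n. ip_norm (L2_ip (surf \<Omega>)) (\<lambda>x. \<gamma> (u (r n)) x - v x)) \<longlonglongrightarrow> 0)))"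

definition B2 :: "'a::euclidean_space set \<Rightarrow> bool" where
  "B2 \<Omega> \<longleftrightarrow> B1 \<Omega> \<and> rellich \<Omega> \<and> compact_trace \<Omega>"


section \<open>Hilbert spaces of functions\<close>

text \<open>Definiteness, and hence equality of elements, is modulo \<open>M\<close>-null sets.\<close>

definition hilbert_on ::
    "'a measure \<Rightarrow> ('a \<Rightarrow> real) set \<Rightarrow> (('a \<Rightarrow> real) \<Rightarrow> ('a \<Rightarrow> real) \<Rightarrow> real) \<Rightarrow> bool" where
  "hilbert_on M S ip \<longleftrightarrow>
     (\<lambda>x. 0) \<in> S \<and>
     (\<forall>u\<in>S. \<forall>v\<in>S. \<forall>a b. (\<lambda>x. a * u x + b * v x) \<in> S) \<and>
     (\<forall>u\<in>S. \<forall>v\<in>S. ip u v = ip v u) \<and>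
     (\<forall>u\<in>S. \<forall>v\<in>S. \<forall>w\<in>S. \<forall>a b. ip (\<lambda>x. a * u x + b * v x) w = a * ip u w + b * ip v w) \<and>
     (\<forall>u\<in>S. 0 \<le> ip u u \<and> (ip u u = 0 \<longleftrightarrow> (AE x in M. u x = 0))) \<and>
     (\<forall>u. (\<forall>n::nat. u n \<in> S) \<and>
          (\<forall>\<epsilon>>0. \<exists>K. \<forall>m\<ge>K. \<forall>n\<ge>K. ip_norm ip (\<lambda>x. u m x - u n x) < \<epsilon>) \<longrightarrow>
        (\<exists>v\<in>S. (\<lambda>n. ip_norm ip (\<lambda>x. u n x - v x)) \<longlonglongrightarrow> 0))"

definition dense_in ::
    "(('a \<Rightarrow> real) \<Rightarrow> ('a \<Rightarrow> real) \<Rightarrow> real) \<Rightarrow> ('a \<Rightarrow> real) set \<Rightarrow> ('a \<Rightarrow> real) set \<Rightarrow> bool" where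
  "dense_in ip V S \<longleftrightarrow> V \<subseteq> S \<and> (\<forall>u\<in>S. \<forall>\<epsilon>>0. \<exists>v\<in>V. ip_norm ip (\<lambda>x. u x - v x) < \<epsilon>)"

definition orthonormal_basis ::
    "('a \<Rightarrow> real) set \<Rightarrow> (('a \<Rightarrow> real) \<Rightarrow> ('a \<Rightarrow> real) \<Rightarrow> real) \<Rightarrow> (nat \<Rightarrow> 'a \<Rightarrow> real) \<Rightarrow> bool" where
  "orthonormal_basis S ip b \<longleftrightarrow>
     (\<forall>j k. ip (b j) (b k) = (if j = k then 1 else 0)) \<and>
     dense_in ip {\<lambda>x. \<Sum>j<n. c j * b j x | (n::nat) c. True} S"


section \<open>Hilbert tensor products\<close>

definition tensor :: "('a \<Rightarrow> real) \<Rightarrow> ('b \<Rightarrow> real) \<Rightarrow> 'a \<times> 'b \<Rightarrow> real" where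
  "tensor f g = (\<lambda>(x, y). f x * g y)"

definition fin_coeffs :: "(nat \<times> nat \<Rightarrow> real) set" where
  "fin_coeffs = {c. finite {i. c i \<noteq> 0}}"

definition tensor_comb ::
    "(nat \<Rightarrow> 'a \<Rightarrow> real) \<Rightarrow> (nat \<Rightarrow> 'b \<Rightarrow> real) \<Rightarrow> (nat \<times> nat \<Rightarrow> real) \<Rightarrow> 'a \<times> 'b \<Rightarrow> real" where
  "tensor_comb p q c = (\<lambda>z. \<Sum>(j, k) | c (j, k) \<noteq> 0. c (j, k) * tensor (p j) (q k) z)"

definition tensor_space ::
    "(nat \<Rightarrow> 'a \<Rightarrow> real) \<Rightarrow> (nat \<Rightarrow> 'b \<Rightarrow> real) \<Rightarrow> ('a \<times> 'b \<Rightarrow> real) set" where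
  "tensor_space p q = tensor_comb p q ` fin_coeffs"

text \<open>
  If \<open>p\<close> and \<open>q\<close> are linearly independent, in particular if they are orthonormal, then
  \<open>tensor_comb p q\<close> is injective on \<open>fin_coeffs\<close> and the coefficients are well defined.
\<close>

definition tensor_coeff ::
    "(nat \<Rightarrow> 'a \<Rightarrow> real) \<Rightarrow> (nat \<Rightarrow> 'b \<Rightarrow> real) \<Rightarrow> ('a \<times> 'b \<Rightarrow> real) \<Rightarrow> nat \<times> nat \<Rightarrow> real" where
  "tensor_coeff p q = the_inv_into fin_coeffs (tensor_comb p q)"

definition tensor_ip ::
    "(nat \<Rightarrow> 'a \<Rightarrow> real) \<Rightarrow> (nat \<Rightarrow> 'b \<Rightarrow> real) \<Rightarrow>
     ('a \<times> 'b \<Rightarrow> real) \<Rightarrow> ('a \<times> 'b \<Rightarrow> real) \<Rightarrow> real" where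
  "tensor_ip p q g h =
     (\<Sum>i | tensor_coeff p q g i \<noteq> 0. tensor_coeff p q g i * tensor_coeff p q h i)"

text \<open>
  \<open>(H, ip)\<close>, together with the isometry \<open>J\<close>, is a completion of the inner product
  space \<open>(V, ipV)\<close>. A completion is determined only up to a unique isometric isomorphism
  over \<open>V\<close>; \<open>J\<close> need not be the inclusion map. It cannot be for the tensor product of
  two \<open>H01\<close> spaces inside \<open>H01\<close> of the product region: the tensor product of two basis elements,
  belonging to eigenvalues \<open>s\<close> and \<open>t\<close>, has norm \<open>1\<close> in the former, but squared gradient norm
  \<open>1/s + 1/t\<close>, so the norms are not equivalent.
\<close>

definition completion_via ::
    "('a \<Rightarrow> real) set \<Rightarrow> (('a \<Rightarrow> real) \<Rightarrow> ('a \<Rightarrow> real) \<Rightarrow> real) \<Rightarrow> (('a \<Rightarrow> real) \<Rightarrow> 'a \<Rightarrow> real) \<Rightarrow>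
     'a measure \<Rightarrow> ('a \<Rightarrow> real) set \<Rightarrow> (('a \<Rightarrow> real) \<Rightarrow> ('a \<Rightarrow> real) \<Rightarrow> real) \<Rightarrow> bool" where
  "completion_via V ipV J M H ip \<longleftrightarrow>
     hilbert_on M H ip \<and>
     (\<forall>g\<in>V. \<forall>h\<in>V. \<forall>a b. AE x in M. J (\<lambda>x. a * g x + b * h x) x = a * J g x + b * J h x) \<and>
     (\<forall>g\<in>V. \<forall>h\<in>V. ip (J g) (J h) = ipV g h) \<and>
     dense_in ip (J ` V) H"

text \<open>
  \<open>(H, ip)\<close> is the Hilbert tensor product of \<open>(S\<^sub>1, ip\<^sub>1)\<close> and \<open>(S\<^sub>2, ip\<^sub>2)\<close>, formed with the
  orthonormal bases \<open>p\<close> and \<open>q\<close>; other bases give an isometrically isomorphic space.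
\<close>

definition hilbert_tensor_product_via where
  "hilbert_tensor_product_via M\<^sub>1 S\<^sub>1 ip\<^sub>1 p M\<^sub>2 S\<^sub>2 ip\<^sub>2 q J M H ip \<longleftrightarrow>
     hilbert_on M\<^sub>1 S\<^sub>1 ip\<^sub>1 \<and> orthonormal_basis S\<^sub>1 ip\<^sub>1 p \<and>
     hilbert_on M\<^sub>2 S\<^sub>2 ip\<^sub>2 \<and> orthonormal_basis S\<^sub>2 ip\<^sub>2 q \<and>
     completion_via (tensor_space p q) (tensor_ip p q) J M H ip"


section \<open>The Dirichlet Laplacian eigenproblem\<close>

definition dirichlet_eigenpair :: "'a::euclidean_space set \<Rightarrow> real \<Rightarrow> ('a \<Rightarrow> real) \<Rightarrow> bool" where
  "dirichlet_eigenpair \<Omega> \<mu> u \<longleftrightarrow>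
     u \<in> H01 \<Omega> \<and> \<not> (AE x in vol \<Omega>. u x = 0) \<and>
     (\<forall>h\<in>H01 \<Omega>. grad_ip \<Omega> u h = \<mu> * L2_ip (vol \<Omega>) u h)"

definition dirichlet_eigenvalue :: "'a::euclidean_space set \<Rightarrow> real \<Rightarrow> bool" where
  "dirichlet_eigenvalue \<Omega> \<mu> \<longleftrightarrow> (\<exists>u. dirichlet_eigenpair \<Omega> \<mu> u)"

text \<open>
  That \<open>\<mu>\<close> lists all eigenvalues, each repeated according to its multiplicity, is a consequence
  of \<open>e\<close> being an orthonormal basis of \<open>L2\<close>: eigenfunctions for different eigenvalues are
  \<open>L2\<close>-orthogonal, so the \<open>e j\<close> with \<open>\<mu> j = t\<close> form a basis of the eigenspace of \<open>t\<close>.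
\<close>

definition dirichlet_eigensequence ::
    "'a::euclidean_space set \<Rightarrow> (nat \<Rightarrow> real) \<Rightarrow> (nat \<Rightarrow> 'a \<Rightarrow> real) \<Rightarrow> bool" where
  "dirichlet_eigensequence \<Omega> \<mu> e \<longleftrightarrow>
     (\<forall>j. 0 < \<mu> j) \<and> filterlim \<mu> at_top sequentially \<and>
     (\<forall>j. dirichlet_eigenpair \<Omega> (\<mu> j) (e j)) \<and>
     orthonormal_basis (L2 (vol \<Omega>)) (L2_ip (vol \<Omega>)) e"

definition H01_normalised :: "(nat \<Rightarrow> real) \<Rightarrow> (nat \<Rightarrow> 'a \<Rightarrow> real) \<Rightarrow> nat \<Rightarrow> 'a \<Rightarrow> real" where
  "H01_normalised \<mu> e j = (\<lambda>x. \<mu> j powr (- 1 / 2) * e j x)"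

end

theory Submission
  imports Defs
begin

text \<open>
  The engine is the classical separation of variables. If \<open>- \<Delta> f = s f\<close> on \<open>\<Omega>\<^sub>1\<close> and
  \<open>- \<Delta> g = t g\<close> on \<open>\<Omega>\<^sub>2\<close>, both with Dirichlet conditions, then the product \<open>f \<otimes> g\<close> satisfies
  \<open>- \<Delta> (f \<otimes> g) = (s + t) (f \<otimes> g)\<close> on \<open>\<Omega>\<^sub>1 \<times> \<Omega>\<^sub>2\<close>, and the products of two orthonormal bases of
  \<open>L2\<close> are an orthonormal basis of \<open>L2\<close> of the product. Hence the products, enumerated by
  \<open>prod_decode\<close>, form a complete Dirichlet eigensequence of \<open>\<Omega>\<^sub>1 \<times> \<Omega>\<^sub>2\<close>
  (\<open>product_eigensequence\<close>), and everything else is what a complete eigensequence implies on a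
  single bounded open set, applied to \<open>\<Omega>\<^sub>1\<close>, to \<open>\<Omega>\<^sub>2\<close> and to the product.

  These general consequences are collected in the locale \<open>dirichlet_system\<close>. An eigenfunction for
  a value not in the list would be orthogonal to a basis of \<open>L2\<close>, so the list contains every
  eigenvalue. Bessel's inequality for the gradient inner product, together with Parseval's for
  \<open>L2\<close>, gives the Poincare inequality, the constant being a positive lower bound of the eigenvalues. So the gradient norm is
  equivalent to the \<open>H1\<close> norm on \<open>H01\<close>, which is therefore a Hilbert space, and the functions
  \<open>e j\<close> divided by \<open>sqrt (\<mu> j)\<close> are an orthonormal basis of it.

  For the product, three facts remain. First, \<open>f \<otimes> g\<close> is in \<open>H01\<close>: its weak gradient is
  \<open>(g \<nabla>f, f \<nabla>g)\<close> by Fubini's theorem applied to slices of a test function, its \<open>H1\<close> norm is at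
  most the product of the two \<open>H1\<close> norms, and products of test functions are test functions
  (\<open>H01_tensor\<close>). Secondly, the eigenvalue equation can be tested against slices
  (\<open>tensor_equation\<close>). Thirdly, the products are total in \<open>L2\<close> (\<open>tensor_total\<close>).
  The isometry from the abstract tensor product onto \<open>H01\<close> of the product multiplies the coefficient
  of each basis tensor by the positive weight that normalises that tensor in the gradient norm.

  Two analytic tools support this. Uniqueness of weak gradients is the fundamental lemma of the
  calculus of variations (\<open>fundamental_lemma\<close>), proved with explicit smooth bumps on boxes; and test
  functions have their classical gradient as weak gradient because the integral of a partial
  derivative vanishes (\<open>integral_partial_eq_0\<close>), by translation invariance of Lebesgue measure.
\<close>

section \<open>Spaces of functions with a semi-inner product\<close>

text \<open>
  Functions are not identified when they agree almost everywhere, so the inner products are only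
  semidefinite. The locale allows the elementary Hilbert space arguments to be used for \<open>L2\<close>, for
  \<open>H1\<close> with either the full or the gradient inner product, and for \<open>H01\<close>.
\<close>

locale function_ip_space =
  fixes S :: "('a \<Rightarrow> real) set" and ip :: "('a \<Rightarrow> real) \<Rightarrow> ('a \<Rightarrow> real) \<Rightarrow> real"
  assumes zero: "(\<lambda>x. 0) \<in> S"
    and lincomb: "\<lbrakk>u \<in> S; v \<in> S\<rbrakk> \<Longrightarrow> (\<lambda>x. a * u x + b * v x) \<in> S"
    and sym: "\<lbrakk>u \<in> S; v \<in> S\<rbrakk> \<Longrightarrow> ip u v = ip v u"
    and linear: "\<lbrakk>u \<in> S; v \<in> S; w \<in> S\<rbrakk> \<Longrightarrow> ip (\<lambda>x. a * u x + b * v x) w = a * ip u w + b * ip v w"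
    and nonneg: "u \<in> S \<Longrightarrow> 0 \<le> ip u u"
begin

lemma diff_mem: "\<lbrakk>u \<in> S; v \<in> S\<rbrakk> \<Longrightarrow> (\<lambda>x. u x - v x) \<in> S"
  using lincomb[of u v 1 "-1"] by simp

lemma scale_mem: "u \<in> S \<Longrightarrow> (\<lambda>x. a * u x) \<in> S"
  using lincomb[of u u a 0] by simp

lemma sum_mem: "(\<And>i. i \<in> A \<Longrightarrow> b i \<in> S) \<Longrightarrow> (\<lambda>x. \<Sum>i\<in>A. c i * b i x) \<in> S"
proof (induction A rule: infinite_finite_induct)
  case (insert i A)
  then show ?case using lincomb[of "b i" "\<lambda>x. \<Sum>i\<in>A. c i * b i x" "c i" 1] by simp
qed (auto simp: zero)

lemma ip_diff: "\<lbrakk>u \<in> S; v \<in> S; w \<in> S\<rbrakk> \<Longrightarrow> ip (\<lambda>x. u x - v x) w = ip u w - ip v w"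
  using linear[of u v w 1 "-1"] by simp

lemma ip_scale: "\<lbrakk>u \<in> S; w \<in> S\<rbrakk> \<Longrightarrow> ip (\<lambda>x. a * u x) w = a * ip u w"
  using linear[of u u w a 0] by simp

lemma ip_diff_right: "\<lbrakk>u \<in> S; v \<in> S; w \<in> S\<rbrakk> \<Longrightarrow> ip w (\<lambda>x. u x - v x) = ip w u - ip w v"
  using ip_diff[of u v w] sym diff_mem by metis

lemma ip_zero: "w \<in> S \<Longrightarrow> ip (\<lambda>x. 0) w = 0"
  using linear[of w w w 0 0] by simp

lemma ip_sum: "\<lbrakk>\<And>i. i \<in> A \<Longrightarrow> b i \<in> S; w \<in> S\<rbrakk>
    \<Longrightarrow> ip (\<lambda>x. \<Sum>i\<in>A. c i * b i x) w = (\<Sum>i\<in>A. c i * ip (b i) w)"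
proof (induction A rule: infinite_finite_induct)
  case (insert i A)
  then show ?case
    using linear[of "b i" "\<lambda>x. \<Sum>i\<in>A. c i * b i x" w "c i" 1] sum_mem[of A b c] by simp
qed (auto simp: ip_zero)

lemma norm_sq: "u \<in> S \<Longrightarrow> (ip_norm ip u)\<^sup>2 = ip u u"
  using nonneg by (simp add: ip_norm_def)

lemma norm_nonneg: "u \<in> S \<Longrightarrow> 0 \<le> ip_norm ip u"
  using nonneg by (simp add: ip_norm_def)

lemma ip_diff_self:
  assumes "u \<in> S" "v \<in> S"
  shows "ip (\<lambda>x. u x - v x) (\<lambda>x. u x - v x) = ip u u - 2 * ip u v + ip v v"
  using assms diff_mem[OF assms] by (simp add: ip_diff ip_diff_right sym[of v u])

lemma Cauchy_Schwarz:
  assumes "u \<in> S" "v \<in> S"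
  shows "\<bar>ip u v\<bar> \<le> ip_norm ip u * ip_norm ip v"
proof -
  have q: "0 \<le> ip u u - 2 * t * ip u v + t\<^sup>2 * ip v v" for t
  proof -
    have "0 \<le> ip (\<lambda>x. u x - t * v x) (\<lambda>x. u x - t * v x)"
      using assms by (intro nonneg diff_mem scale_mem)
    also have "\<dots> = ip u u - 2 * ip u (\<lambda>x. t * v x) + ip (\<lambda>x. t * v x) (\<lambda>x. t * v x)"
      using assms by (intro ip_diff_self scale_mem)
    also have "ip u (\<lambda>x. t * v x) = t * ip u v"
      using assms by (metis ip_scale scale_mem sym)
    also have "ip (\<lambda>x. t * v x) (\<lambda>x. t * v x) = t\<^sup>2 * ip v v"
      using assms by (metis (no_types, lifting) ip_scale scale_mem sym power2_eq_square mult.assoc)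
    finally show ?thesis by simp
  qed
  have "(ip u v)\<^sup>2 \<le> ip u u * ip v v"
  proof (cases "ip v v = 0")
    case True
    have "ip u v = 0"
    proof (rule ccontr)
      assume "ip u v \<noteq> 0"
      \<comment> \<open>If the quadratic polynomial \<open>q\<close> degenerates to an affine one, this is a point where it is \<open>-1\<close>.\<close>
      then show False using q[of "(ip u u + 1) / (2 * ip u v)"] True by (simp add: field_simps)
    qed
    then show ?thesis using True by simp
  next
    case False
    then have "ip v v > 0" using nonneg[OF assms(2)] by linarith
    \<comment> \<open>Otherwise \<open>q\<close> is evaluated at its minimum.\<close>
    then show ?thesis using q[of "ip u v / ip v v"]
      by (simp add: field_simps power2_eq_square)
  qed
  then have "\<bar>ip u v\<bar> \<le> sqrt (ip u u * ip v v)" by (metis real_sqrt_abs real_sqrt_le_mono)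
  then show ?thesis by (simp add: ip_norm_def real_sqrt_mult)
qed

lemma norm_triangle_diff:
  assumes "u \<in> S" "v \<in> S" "w \<in> S"
  shows "ip_norm ip (\<lambda>x. u x - w x) \<le> ip_norm ip (\<lambda>x. u x - v x) + ip_norm ip (\<lambda>x. v x - w x)"
proof -
  let ?a = "\<lambda>x. u x - v x" and ?b = "\<lambda>x. w x - v x"
  have m: "?a \<in> S" "?b \<in> S" "(\<lambda>x. v x - w x) \<in> S" "(\<lambda>x. u x - w x) \<in> S"
    using assms by (auto intro: diff_mem)
  have n: "ip_norm ip ?b = ip_norm ip (\<lambda>x. v x - w x)"
    unfolding ip_norm_def using assms by (simp add: ip_diff_self sym[of w v])
  have "ip (\<lambda>x. u x - w x) (\<lambda>x. u x - w x) = ip ?a ?a - 2 * ip ?a ?b + ip ?b ?b"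
    using ip_diff_self[OF m(1,2)] by simp
  also have "\<dots> \<le> (ip_norm ip ?a + ip_norm ip ?b)\<^sup>2"
    using Cauchy_Schwarz[OF m(1,2)] norm_sq[OF m(1)] norm_sq[OF m(2)]
    by (simp add: power2_sum)
  finally have "(ip_norm ip (\<lambda>x. u x - w x))\<^sup>2 \<le> (ip_norm ip ?a + ip_norm ip ?b)\<^sup>2"
    using norm_sq[OF m(4)] by simp
  then show ?thesis
    unfolding n[symmetric] using norm_nonneg m by (meson add_nonneg_nonneg power2_le_imp_le)
qed

lemma norm_diff_commute:
  assumes "u \<in> S" "v \<in> S"
  shows "ip_norm ip (\<lambda>x. u x - v x) = ip_norm ip (\<lambda>x. v x - u x)"
  unfolding ip_norm_def using assms by (simp add: ip_diff_self sym[of v u])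

lemma ip_tendsto:
  assumes "\<And>n. u n \<in> S" "v \<in> S" "w \<in> S" "(\<lambda>n. ip_norm ip (\<lambda>x. u n x - v x)) \<longlonglongrightarrow> 0"
  shows "(\<lambda>n. ip (u n) w) \<longlonglongrightarrow> ip v w"
proof -
  have "(\<lambda>n. ip_norm ip (\<lambda>x. u n x - v x) * ip_norm ip w) \<longlonglongrightarrow> 0"
    using tendsto_mult_left_zero[OF assms(4)] .
  moreover have "norm (ip (u n) w - ip v w) \<le> ip_norm ip (\<lambda>x. u n x - v x) * ip_norm ip w" for n
    using Cauchy_Schwarz[of "\<lambda>x. u n x - v x" w] diff_mem assms by (simp add: ip_diff)
  ultimately have "(\<lambda>n. ip (u n) w - ip v w) \<longlonglongrightarrow> 0"
    by (rule_tac Lim_null_comparison[OF always_eventually]) auto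
  then show ?thesis by (simp add: LIM_zero_iff)
qed

definition orthonormal :: "(nat \<Rightarrow> 'a \<Rightarrow> real) \<Rightarrow> bool" where
  "orthonormal b \<longleftrightarrow> range b \<subseteq> S \<and> (\<forall>j k. ip (b j) (b k) = (if j = k then 1 else 0))"

lemma orthonormal_coeff:
  assumes "orthonormal b"
  shows "ip (\<lambda>x. \<Sum>i<n. c i * b i x) (b j) = (if j < n then c j else 0)"
proof -
  have "ip (\<lambda>x. \<Sum>i<n. c i * b i x) (b j) = (\<Sum>i<n. c i * ip (b i) (b j))"
    using assms by (intro ip_sum) (auto simp: orthonormal_def)
  also have "\<dots> = (\<Sum>i<n. if i = j then c i else 0)"
    using assms by (intro sum.cong) (auto simp: orthonormal_def)
  finally show ?thesis by simp
qed

lemma orthonormal_ip_combination: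
  assumes "orthonormal b" "u \<in> S"
  shows "ip u (\<lambda>x. \<Sum>i<n. c i * b i x) = (\<Sum>i<n. c i * ip u (b i))"
proof -
  have "ip u (\<lambda>x. \<Sum>i<n. c i * b i x) = ip (\<lambda>x. \<Sum>i<n. c i * b i x) u"
    using assms by (intro sym sum_mem) (auto simp: orthonormal_def)
  also have "\<dots> = (\<Sum>i<n. c i * ip (b i) u)"
    using assms by (intro ip_sum) (auto simp: orthonormal_def)
  also have "\<dots> = (\<Sum>i<n. c i * ip u (b i))"
  proof (intro sum.cong refl)
    fix i
    have "b i \<in> S" using assms(1) by (auto simp: orthonormal_def)
    then show "c i * ip (b i) u = c i * ip u (b i)" using sym[of "b i" u] assms(2) by simp
  qed
  finally show ?thesis .
qed

lemma orthonormal_norm_combination: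
  assumes "orthonormal b"
  shows "ip (\<lambda>x. \<Sum>i<n. c i * b i x) (\<lambda>x. \<Sum>i<n. c i * b i x) = (\<Sum>i<n. (c i)\<^sup>2)"
proof -
  have "(\<lambda>x. \<Sum>i<n. c i * b i x) \<in> S"
    using assms by (intro sum_mem) (auto simp: orthonormal_def)
  from orthonormal_ip_combination[OF assms this, of c n]
  show ?thesis unfolding orthonormal_coeff[OF assms] 
    by (rule trans) (intro sum.cong refl, simp add: power2_eq_square)
qed

text \<open>
  Completing the square in each coefficient: the first two terms are the squared distance to the span,
  the last is the deviation from the Fourier coefficients. Best approximation, Bessel's inequality and
  Parseval's inequality are all read off from this identity.
\<close>

lemma distance_to_combination:
  assumes "orthonormal b" "u \<in> S"
  shows "ip (\<lambda>x. u x - (\<Sum>i<n. c i * b i x)) (\<lambda>x. u x - (\<Sum>i<n. c i * b i x))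
       = ip u u - (\<Sum>i<n. (ip u (b i))\<^sup>2) + (\<Sum>i<n. (c i - ip u (b i))\<^sup>2)"
proof -
  have "(\<lambda>x. \<Sum>i<n. c i * b i x) \<in> S"
    using assms by (intro sum_mem) (auto simp: orthonormal_def)
  then have "ip (\<lambda>x. u x - (\<Sum>i<n. c i * b i x)) (\<lambda>x. u x - (\<Sum>i<n. c i * b i x))
     = ip u u - 2 * (\<Sum>i<n. c i * ip u (b i)) + (\<Sum>i<n. (c i)\<^sup>2)"
    using ip_diff_self[OF assms(2), of "\<lambda>x. \<Sum>i<n. c i * b i x"]
      orthonormal_ip_combination[OF assms, where n = n and c = c]
      orthonormal_norm_combination[OF assms(1), where n = n and c = c] by metis
  also have "\<dots> = ip u u - (\<Sum>i<n. (ip u (b i))\<^sup>2) + (\<Sum>i<n. (c i - ip u (b i))\<^sup>2)"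
    by (simp add: power2_diff sum.distrib sum_subtractf sum_distrib_left mult_ac)
  finally show ?thesis .
qed

lemma Bessel:
  assumes "orthonormal b" "u \<in> S"
  shows "(\<Sum>i<n. (ip u (b i))\<^sup>2) \<le> ip u u"
proof -
  have "(\<lambda>x. u x - (\<Sum>i<n. ip u (b i) * b i x)) \<in> S"
    using assms by (intro diff_mem sum_mem) (auto simp: orthonormal_def)
  from nonneg[OF this] show ?thesis
    using distance_to_combination[OF assms, of "\<lambda>i. ip u (b i)" n] by simp
qed

text \<open>
  The nontrivial half of Parseval's identity: the partial Fourier sums are at least as close to \<open>u\<close> as
  the combinations given by density, so their squared norms come arbitrarily close to that of \<open>u\<close>.
\<close>

lemma Parseval_bound:
  assumes "orthonormal b" "orthonormal_basis S ip b" "u \<in> S"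
    and K: "\<And>n. (\<Sum>i<n. (ip u (b i))\<^sup>2) \<le> K"
  shows "ip u u \<le> K"
proof (rule field_le_epsilon)
  fix e :: real assume "e > 0"
  then have "sqrt e > 0" by simp
  then obtain n c where nc: "ip_norm ip (\<lambda>x. u x - (\<Sum>i<n. c i * b i x)) < sqrt e"
    using assms(2,3) unfolding orthonormal_basis_def dense_in_def by blast
  have "ip u u - (\<Sum>i<n. (ip u (b i))\<^sup>2) + (\<Sum>i<n. (c i - ip u (b i))\<^sup>2) < e"
    using nc distance_to_combination[OF assms(1,3)] by (simp add: ip_norm_def)
  moreover have "0 \<le> (\<Sum>i<n. (c i - ip u (b i))\<^sup>2)" by (simp add: sum_nonneg)
  ultimately show "ip u u \<le> K + e" using K[of n] by linarith
qed

text \<open>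
  Completeness yields a limit of the Fourier series, whose partial sums are Cauchy by Bessel's
  inequality. The difference from the given function has vanishing coefficients, so it is null by
  totality. Completeness and totality are premises, as the lemma serves both \<open>L2\<close> and \<open>H01\<close>.
\<close>

lemma complete_orthonormal_imp_basis:
  assumes "orthonormal b"
    and complete: "\<And>u. \<lbrakk>\<And>n::nat. u n \<in> S; \<And>\<epsilon>. \<epsilon> > 0 \<Longrightarrow> \<exists>K. \<forall>m\<ge>K. \<forall>n\<ge>K. ip_norm ip (\<lambda>x. u m x - u n x) < \<epsilon>\<rbrakk>
        \<Longrightarrow> \<exists>v\<in>S. (\<lambda>n. ip_norm ip (\<lambda>x. u n x - v x)) \<longlonglongrightarrow> 0"
    and total: "\<And>u. \<lbrakk>u \<in> S; \<And>j. ip u (b j) = 0\<rbrakk> \<Longrightarrow> ip u u = 0"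
  shows "orthonormal_basis S ip b"
  unfolding orthonormal_basis_def dense_in_def
proof (intro conjI allI ballI impI)
  show "ip (b j) (b k) = (if j = k then 1 else 0)" for j k
    using assms(1) by (simp add: orthonormal_def)
  have bS: "b j \<in> S" for j using assms(1) by (auto simp: orthonormal_def)
  show "{\<lambda>x. \<Sum>j<n. c j * b j x |n c. True} \<subseteq> S" using sum_mem[of _ b] bS by auto
  fix u and \<epsilon> :: real assume u: "u \<in> S" and \<epsilon>: "\<epsilon> > 0"
  define s where "s n = (\<lambda>x. \<Sum>i<n. ip u (b i) * b i x)" for n
  have s: "s n \<in> S" for n unfolding s_def by (intro sum_mem bS)
  have summ: "summable (\<lambda>i. (ip u (b i))\<^sup>2)"
    by (rule bounded_imp_summable[where B = "ip u u"])
      (use Bessel[OF assms(1) u] in \<open>auto simp only: zero_le_power2 lessThan_Suc_atMost[symmetric]\<close>)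
  have dist: "(ip_norm ip (\<lambda>x. s m x - s n x))\<^sup>2 = (\<Sum>i\<in>{n..<m}. (ip u (b i))\<^sup>2)" if "n \<le> m" for m n
  proof -
    have "s m x - s n x = (\<Sum>i<m. (if i < n then 0 else ip u (b i)) * b i x)" for x
    proof -
      have "(\<Sum>i<m. (if i < n then 0 else ip u (b i)) * b i x) = (\<Sum>i\<in>{n..<m}. ip u (b i) * b i x)"
        by (intro sum.mono_neutral_cong_right) auto
      also have "\<dots> = s m x - s n x"
        unfolding s_def lessThan_atLeast0
        using sum.atLeastLessThan_concat[of 0 n m "\<lambda>i. ip u (b i) * b i x"] that by auto
      finally show ?thesis by simp
    qed
    then have "(ip_norm ip (\<lambda>x. s m x - s n x))\<^sup>2 = (\<Sum>i<m. (if i < n then 0 else ip u (b i))\<^sup>2)"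
      using norm_sq[OF diff_mem[OF s s], of m n] orthonormal_norm_combination[OF assms(1), where n = m]
      by (simp only:)
    also have "\<dots> = (\<Sum>i\<in>{n..<m}. (ip u (b i))\<^sup>2)"
      by (intro sum.mono_neutral_cong_right) auto
    finally show ?thesis .
  qed
  have "\<exists>v\<in>S. (\<lambda>n. ip_norm ip (\<lambda>x. s n x - v x)) \<longlonglongrightarrow> 0"
  proof (rule complete[OF s])
    fix e :: real assume "e > 0"
    then have "e\<^sup>2 > 0" by simp
    then obtain K where K: "\<And>m n. m \<ge> K \<Longrightarrow> norm (\<Sum>i\<in>{m..<n}. (ip u (b i))\<^sup>2) < e\<^sup>2"
      using summ unfolding summable_Cauchy by blast
    have le: "ip_norm ip (\<lambda>x. s m x - s n x) < e" if "n \<le> m" "n \<ge> K" for m n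
    proof (rule power2_less_imp_less)
      show "(ip_norm ip (\<lambda>x. s m x - s n x))\<^sup>2 < e\<^sup>2"
        unfolding dist[OF that(1)] using K[OF that(2), of m] by (simp only: real_norm_def abs_less_iff)
    qed (use \<open>e > 0\<close> in simp)
    have "ip_norm ip (\<lambda>x. s m x - s n x) < e" if "m \<ge> K" "n \<ge> K" for m n
    proof (cases "n \<le> m")
      case False
      then show ?thesis using le[of m n] that norm_diff_commute[OF s s, of m n] by linarith
    qed (use le that in blast)
    then show "\<exists>K. \<forall>m\<ge>K. \<forall>n\<ge>K. ip_norm ip (\<lambda>x. s m x - s n x) < e" by blast
  qed
  then obtain v where v: "v \<in> S" and lim: "(\<lambda>n. ip_norm ip (\<lambda>x. s n x - v x)) \<longlonglongrightarrow> 0"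
    by (elim bexE) (rule that)
  have uv: "(\<lambda>x. u x - v x) \<in> S" using u v by (rule diff_mem)
  have "ip (\<lambda>x. u x - v x) (b j) = 0" for j
  proof -
    have "(\<lambda>n. ip (s n) (b j)) \<longlonglongrightarrow> ip v (b j)"
      by (rule ip_tendsto[OF s v bS lim])
    moreover have "(\<lambda>n. ip (s n) (b j)) \<longlonglongrightarrow> ip u (b j)"
    proof (rule tendsto_eventually, unfold eventually_sequentially, intro exI allI impI)
      fix n assume "Suc j \<le> n"
      then show "ip (s n) (b j) = ip u (b j)" by (simp add: s_def orthonormal_coeff[OF assms(1)])
    qed
    ultimately have "ip v (b j) = ip u (b j)" using LIMSEQ_unique by blast
    then show ?thesis using u v bS by (simp add: ip_diff)
  qed
  then have "ip (\<lambda>x. u x - v x) (\<lambda>x. u x - v x) = 0" by (rule total[OF uv])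
  then have z: "ip_norm ip (\<lambda>x. u x - v x) = 0" by (simp add: ip_norm_def)
  obtain n where "ip_norm ip (\<lambda>x. s n x - v x) < \<epsilon>"
    using order_tendstoD(2)[OF lim \<epsilon>] by (meson eventually_sequentially order_refl)
  then have "ip_norm ip (\<lambda>x. u x - s n x) < \<epsilon>"
    using norm_triangle_diff[OF u v s, of n] z norm_diff_commute[OF v s, of n] by linarith
  then show "\<exists>v\<in>{\<lambda>x. \<Sum>j<n. c j * b j x |n c. True}. ip_norm ip (\<lambda>x. u x - v x) < \<epsilon>"
    by (intro bexI[of _ "s n"]) (auto simp: s_def)
qed

lemma orthogonal_to_basis_imp_null:
  assumes "orthonormal b" "orthonormal_basis S ip b" "u \<in> S" "\<And>j. ip u (b j) = 0"
  shows "ip u u = 0"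
proof (rule antisym)
  show "ip u u \<le> 0" by (rule Parseval_bound[OF assms(1-3)]) (simp add: assms(4))
qed (rule nonneg[OF assms(3)])

text \<open>
  The abstract form of \<open>H1_closure\<close>.
\<close>

definition closure_in :: "('a \<Rightarrow> real) set \<Rightarrow> ('a \<Rightarrow> real) set" where
  "closure_in V = {u \<in> S. \<forall>\<epsilon>>0. \<exists>v\<in>V. ip_norm ip (\<lambda>x. u x - v x) < \<epsilon>}"

lemma subspace_function_ip_space:
  assumes "T \<subseteq> S" "(\<lambda>x. 0) \<in> T" "\<And>u v a b. u \<in> T \<Longrightarrow> v \<in> T \<Longrightarrow> (\<lambda>x. a * u x + b * v x) \<in> T"
  shows "function_ip_space T ip"
proof
  fix u v w a b assume uv: "u \<in> T" "v \<in> T"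
  with assms(1) have S: "u \<in> S" "v \<in> S" by auto
  show "(\<lambda>x. a * u x + b * v x) \<in> T" using uv by (rule assms(3))
  show "ip u v = ip v u" using S by (rule sym)
  show "0 \<le> ip u u" using S(1) by (rule nonneg)
  assume "w \<in> T"
  with assms(1) have "w \<in> S" by auto
  with S show "ip (\<lambda>x. a * u x + b * v x) w = a * ip u w + b * ip v w" by (rule linear)
qed (rule assms(2))

lemma norm_scale: "u \<in> S \<Longrightarrow> ip_norm ip (\<lambda>x. a * u x) = \<bar>a\<bar> * ip_norm ip u"
proof -
  assume u: "u \<in> S"
  have "ip (\<lambda>x. a * u x) (\<lambda>x. a * u x) = a * (a * ip u u)"
    using ip_scale[OF u scale_mem[OF u], of a a] ip_scale[OF u u, of a]
      sym[OF u scale_mem[OF u], of a] by simp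
  then show ?thesis by (simp add: ip_norm_def real_sqrt_mult flip: mult.assoc)
qed

lemma subset_closure_in: "V \<subseteq> S \<Longrightarrow> V \<subseteq> closure_in V"
proof
  fix u assume "V \<subseteq> S" "u \<in> V"
  moreover have "ip_norm ip (\<lambda>x. u x - u x) = 0" using ip_zero[OF zero] by (simp add: ip_norm_def)
  ultimately show "u \<in> closure_in V" unfolding closure_in_def by force
qed

lemma closure_in_closed:
  assumes "V \<subseteq> S" "u \<in> S" "\<And>\<epsilon>. \<epsilon> > 0 \<Longrightarrow> \<exists>v\<in>closure_in V. ip_norm ip (\<lambda>x. u x - v x) < \<epsilon>"
  shows "u \<in> closure_in V"
  unfolding closure_in_def
proof (intro CollectI conjI allI impI)
  fix \<epsilon> :: real assume "\<epsilon> > 0"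
  then have half: "\<epsilon> / 2 > 0" by simp
  obtain v where v: "v \<in> closure_in V" "ip_norm ip (\<lambda>x. u x - v x) < \<epsilon> / 2"
    using assms(3)[OF half] by blast
  then obtain w where w: "w \<in> V" "ip_norm ip (\<lambda>x. v x - w x) < \<epsilon> / 2"
    using half unfolding closure_in_def by blast
  have "ip_norm ip (\<lambda>x. u x - w x) < \<epsilon>"
  proof -
    have "v \<in> S" "w \<in> S" using v(1) w(1) assms(1) by (auto simp: closure_in_def)
    from norm_triangle_diff[OF assms(2) this] v(2) w(2) show ?thesis by linarith
  qed
  then show "\<exists>v\<in>V. ip_norm ip (\<lambda>x. u x - v x) < \<epsilon>" using w(1) by blast
qed fact

lemma closure_in_limit:
  assumes "V \<subseteq> S" "v \<in> S" "\<And>n::nat. u n \<in> closure_in V" "(\<lambda>n. ip_norm ip (\<lambda>x. u n x - v x)) \<longlonglongrightarrow> 0"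
  shows "v \<in> closure_in V"
proof (rule closure_in_closed[OF assms(1,2)])
  fix \<epsilon> :: real assume "\<epsilon> > 0"
  then obtain n where "ip_norm ip (\<lambda>x. u n x - v x) < \<epsilon>"
    using order_tendstoD(2)[OF assms(4)] by (meson eventually_sequentially order_refl)
  moreover have "u n \<in> S" using assms(3)[of n] by (simp add: closure_in_def)
  ultimately show "\<exists>w\<in>closure_in V. ip_norm ip (\<lambda>x. v x - w x) < \<epsilon>"
    using assms(3)[of n] norm_diff_commute[OF assms(2), of "u n"] by (intro bexI[of _ "u n"]) simp_all
qed

lemma closure_in_sequence:
  assumes "u \<in> closure_in V" "V \<subseteq> S"
  obtains v where "\<And>n::nat. v n \<in> V" "(\<lambda>n. ip_norm ip (\<lambda>x. v n x - u x)) \<longlonglongrightarrow> 0"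
proof -
  have "\<exists>v\<in>V. ip_norm ip (\<lambda>x. u x - v x) < inverse (real (Suc n))" for n
    using assms(1) by (simp add: closure_in_def)
  then obtain v where v: "\<And>n. v n \<in> V" "\<And>n. ip_norm ip (\<lambda>x. u x - v n x) < inverse (real (Suc n))"
    by metis
  have u: "u \<in> S" using assms(1) by (simp add: closure_in_def)
  have vS: "v n \<in> S" for n using v(1) assms(2) by blast
  have "(\<lambda>n. ip_norm ip (\<lambda>x. v n x - u x)) \<longlonglongrightarrow> 0"
  proof (rule tendsto_sandwich[OF _ _ tendsto_const LIMSEQ_inverse_real_of_nat])
    show "\<forall>\<^sub>F n in sequentially. 0 \<le> ip_norm ip (\<lambda>x. v n x - u x)"
      by (intro always_eventually allI norm_nonneg diff_mem vS u)
    show "\<forall>\<^sub>F n in sequentially. ip_norm ip (\<lambda>x. v n x - u x) \<le> inverse (real (Suc n))"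
      using v(2) norm_diff_commute[OF u vS] by (intro always_eventually allI) (simp add: less_imp_le)
  qed
  with v(1) show ?thesis by (rule that)
qed

lemma closure_in_lincomb:
  assumes V: "V \<subseteq> S" "\<And>u v a b. u \<in> V \<Longrightarrow> v \<in> V \<Longrightarrow> (\<lambda>x. a * u x + b * v x) \<in> V"
    and "u \<in> closure_in V" "v \<in> closure_in V"
  shows "(\<lambda>x. a * u x + b * v x) \<in> closure_in V"
proof -
  obtain s where s: "\<And>n::nat. s n \<in> V" "(\<lambda>n. ip_norm ip (\<lambda>x. s n x - u x)) \<longlonglongrightarrow> 0"
    using closure_in_sequence[OF assms(3) V(1)] by metis
  obtain t where t: "\<And>n::nat. t n \<in> V" "(\<lambda>n. ip_norm ip (\<lambda>x. t n x - v x)) \<longlonglongrightarrow> 0"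
    using closure_in_sequence[OF assms(4) V(1)] by metis
  have uv: "u \<in> S" "v \<in> S" using assms(3,4) by (auto simp: closure_in_def)
  have st: "s n \<in> S" "t n \<in> S" for n using s(1) t(1) V(1) by auto
  show ?thesis
  proof (rule closure_in_limit[OF V(1)])
    show "(\<lambda>x. a * u x + b * v x) \<in> S" using uv by (rule lincomb)
    show "(\<lambda>x. a * s n x + b * t n x) \<in> closure_in V" for n
      using subset_closure_in[OF V(1)] V(2)[OF s(1) t(1)] by blast
    have "ip_norm ip (\<lambda>x. (a * s n x + b * t n x) - (a * u x + b * v x))
        \<le> \<bar>a\<bar> * ip_norm ip (\<lambda>x. s n x - u x) + \<bar>b\<bar> * ip_norm ip (\<lambda>x. t n x - v x)" for n
    proof -
      let ?p = "\<lambda>x. a * (s n x - u x)" and ?q = "\<lambda>x. (- b) * (t n x - v x)"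
      have m: "(\<lambda>x. s n x - u x) \<in> S" "(\<lambda>x. t n x - v x) \<in> S" using st uv by (auto intro: diff_mem)
      have "ip_norm ip (\<lambda>x. ?p x - ?q x) \<le> ip_norm ip (\<lambda>x. ?p x - 0) + ip_norm ip (\<lambda>x. 0 - ?q x)"
        by (intro norm_triangle_diff scale_mem m zero)
      also have "ip_norm ip (\<lambda>x. 0 - ?q x) = ip_norm ip ?q"
        using norm_diff_commute[OF zero scale_mem[OF m(2), of "- b"]] by simp
      finally show ?thesis using norm_scale[OF m(1), of a] norm_scale[OF m(2), of "- b"]
        by (simp add: algebra_simps)
    qed
    moreover have "(\<lambda>n. \<bar>a\<bar> * ip_norm ip (\<lambda>x. s n x - u x) + \<bar>b\<bar> * ip_norm ip (\<lambda>x. t n x - v x)) \<longlonglongrightarrow> 0"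
      using tendsto_add[OF tendsto_mult_right_zero[OF s(2), of "\<bar>a\<bar>"] tendsto_mult_right_zero[OF t(2), of "\<bar>b\<bar>"]] by simp
    moreover have "0 \<le> ip_norm ip (\<lambda>x. (a * s n x + b * t n x) - (a * u x + b * v x))" for n
      using st uv by (intro norm_nonneg diff_mem lincomb)
    ultimately show "(\<lambda>n. ip_norm ip (\<lambda>x. (a * s n x + b * t n x) - (a * u x + b * v x))) \<longlonglongrightarrow> 0"
      by (rule_tac tendsto_sandwich[OF always_eventually always_eventually tendsto_const]) auto
  qed
qed

end

section \<open>Square-integrable functions\<close>

lemma L2_measurable [measurable_dest]: "f \<in> L2 M \<Longrightarrow> f \<in> borel_measurable M"
  by (simp add: L2_def)

lemma L2_integrable_norm: "f \<in> L2 M \<Longrightarrow> integrable M (\<lambda>x. (norm (f x))\<^sup>2)"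
  by (simp add: L2_def)

lemma L2_dominated:
  assumes "f \<in> L2 M" "g \<in> borel_measurable M" "\<And>x. norm (g x) \<le> c * norm (f x)"
  shows "g \<in> L2 M"
proof -
  have "integrable M (\<lambda>x. (norm (g x))\<^sup>2)"
  proof (rule Bochner_Integration.integrable_bound)
    show "integrable M (\<lambda>x. c\<^sup>2 * (norm (f x))\<^sup>2)"
      using L2_integrable_norm[OF assms(1)] by simp
    show "AE x in M. norm ((norm (g x))\<^sup>2) \<le> norm (c\<^sup>2 * (norm (f x))\<^sup>2)"
      using power_mono[OF assms(3) norm_ge_zero, where n = 2] by (simp add: power_mult_distrib)
  qed (use assms(2) in measurable)
  then show ?thesis using assms(2) by (simp add: L2_def)
qed

lemma L2_scaleR: "f \<in> L2 M \<Longrightarrow> (\<lambda>x. a *\<^sub>R f x) \<in> L2 M"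
  by (rule L2_dominated[where f = f and c = "\<bar>a\<bar>"]) auto

lemma L2_add:
  assumes "f \<in> L2 M" "g \<in> L2 M"
  shows "(\<lambda>x. f x + g x) \<in> L2 M"
proof -
  have [measurable]: "f \<in> borel_measurable M" "g \<in> borel_measurable M"
    using assms by (auto dest: L2_measurable)
  have "integrable M (\<lambda>x. (norm (f x + g x))\<^sup>2)"
  proof (rule Bochner_Integration.integrable_bound)
    show "integrable M (\<lambda>x. 2 * (norm (f x))\<^sup>2 + 2 * (norm (g x))\<^sup>2)"
      using assms[THEN L2_integrable_norm] by simp
    have "(norm (f x + g x))\<^sup>2 \<le> 2 * (norm (f x))\<^sup>2 + 2 * (norm (g x))\<^sup>2" for x
    proof -
      have "(norm (f x + g x))\<^sup>2 \<le> (norm (f x) + norm (g x))\<^sup>2"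
        by (intro power_mono norm_triangle_ineq) simp
      also have "\<dots> \<le> 2 * (norm (f x))\<^sup>2 + 2 * (norm (g x))\<^sup>2"
        using sum_squares_bound[of "norm (f x)" "norm (g x)"] by (simp add: power2_sum)
      finally show ?thesis .
    qed
    then show "AE x in M. norm ((norm (f x + g x))\<^sup>2)
        \<le> norm (2 * (norm (f x))\<^sup>2 + 2 * (norm (g x))\<^sup>2)" by simp
  qed measurable
  then show ?thesis by (simp add: L2_def)
qed

lemma L2_diff: "f \<in> L2 M \<Longrightarrow> g \<in> L2 M \<Longrightarrow> (\<lambda>x. f x - g x) \<in> L2 M"
  using L2_add[of f M "\<lambda>x. (-1) *\<^sub>R g x"] L2_scaleR[of g M "-1"] by simp

lemma L2_lincomb: "f \<in> L2 M \<Longrightarrow> g \<in> L2 M \<Longrightarrow> (\<lambda>x. a *\<^sub>R f x + b *\<^sub>R g x) \<in> L2 M"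
  by (intro L2_add L2_scaleR)

lemma L2_zero: "(\<lambda>x. 0) \<in> L2 M"
  by (simp add: L2_def)

lemma L2_sum: "(\<And>i. i \<in> A \<Longrightarrow> f i \<in> L2 M) \<Longrightarrow> (\<lambda>x. \<Sum>i\<in>A. f i x) \<in> L2 M"
  by (induction A rule: infinite_finite_induct) (auto intro: L2_zero L2_add)

lemma L2_scaleR_vector:
  assumes "f \<in> L2 M"
  shows "(\<lambda>x. f x *\<^sub>R v) \<in> L2 M"
proof (rule L2_dominated[OF assms])
  show "(\<lambda>x. f x *\<^sub>R v) \<in> borel_measurable M" using L2_measurable[OF assms] by measurable
  show "norm (f x *\<^sub>R v) \<le> norm v * norm (f x)" for x by simp
qed

lemma L2_component:
  assumes "f \<in> L2 M"
  shows "(\<lambda>x. f x \<bullet> v) \<in> L2 M"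
proof (rule L2_dominated[OF assms])
  show "(\<lambda>x. f x \<bullet> v) \<in> borel_measurable M" using L2_measurable[OF assms] by measurable
  show "norm (f x \<bullet> v) \<le> norm v * norm (f x)" for x
    using Cauchy_Schwarz_ineq2[of "f x" v] by (simp add: mult.commute)
qed

lemma integrable_L2_inner:
  assumes "f \<in> L2 M" "g \<in> L2 M"
  shows "integrable M (\<lambda>x. f x \<bullet> g x)"
proof (rule Bochner_Integration.integrable_bound)
  have [measurable]: "f \<in> borel_measurable M" "g \<in> borel_measurable M"
    using assms by (auto dest: L2_measurable)
  show "integrable M (\<lambda>x. (norm (f x))\<^sup>2 + (norm (g x))\<^sup>2)"
    using assms[THEN L2_integrable_norm] by simp
  show "(\<lambda>x. f x \<bullet> g x) \<in> borel_measurable M" by measurable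
  have "\<bar>f x \<bullet> g x\<bar> \<le> (norm (f x))\<^sup>2 + (norm (g x))\<^sup>2" for x
  proof -
    have "\<bar>f x \<bullet> g x\<bar> \<le> norm (f x) * norm (g x)" by (rule Cauchy_Schwarz_ineq2)
    also have "\<dots> \<le> (norm (f x))\<^sup>2 + (norm (g x))\<^sup>2"
      using sum_squares_bound[of "norm (f x)" "norm (g x)"] 
        mult_nonneg_nonneg[OF norm_ge_zero[of "f x"] norm_ge_zero[of "g x"]]
      by linarith
    finally show ?thesis .
  qed
  then show "AE x in M. norm (f x \<bullet> g x) \<le> norm ((norm (f x))\<^sup>2 + (norm (g x))\<^sup>2)" by simp
qed

lemma L2_ip_linear:
  assumes "f \<in> L2 M" "g \<in> L2 M" "h \<in> L2 M"
  shows "L2_ip M (\<lambda>x. a *\<^sub>R f x + b *\<^sub>R g x) h = a * L2_ip M f h + b * L2_ip M g h"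
  using integrable_L2_inner[OF assms(1,3)] integrable_L2_inner[OF assms(2,3)]
  by (simp add: L2_ip_def inner_add_left)

lemma L2_ip_commute: "L2_ip M f g = L2_ip M g f"
  by (simp add: L2_ip_def inner_commute)

lemma L2_ip_self: "L2_ip M f f = (\<integral>x. (norm (f x))\<^sup>2 \<partial>M)"
  by (simp add: L2_ip_def power2_norm_eq_inner)

lemma L2_ip_nonneg: "0 \<le> L2_ip M f f"
  by (simp add: L2_ip_self)

lemma L2_ip_cong_AE:
  assumes "f \<in> L2 M" "f' \<in> L2 M" "g \<in> L2 M" "g' \<in> L2 M"
    and "AE x in M. f x = f' x" "AE x in M. g x = g' x"
  shows "L2_ip M f g = L2_ip M f' g'"
  unfolding L2_ip_def
  using assms[unfolded L2_def] by (intro integral_cong_AE) auto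

lemma L2_ip_self_eq_0_iff:
  assumes "f \<in> L2 M"
  shows "L2_ip M f f = 0 \<longleftrightarrow> (AE x in M. f x = 0)"
  unfolding L2_ip_self using integral_nonneg_eq_0_iff_AE[OF L2_integrable_norm[OF assms]] by simp

lemma function_ip_space_L2: "function_ip_space (L2 M) (L2_ip M)"
proof
  fix f g h :: "'a \<Rightarrow> real" and a b :: real
  assume fg: "f \<in> L2 M" "g \<in> L2 M"
  then show "(\<lambda>x. a * f x + b * g x) \<in> L2 M"
    using L2_lincomb[of f M g a b] by simp
  show "L2_ip M f g = L2_ip M g f" by (rule L2_ip_commute)
  assume "h \<in> L2 M"
  with fg show "L2_ip M (\<lambda>x. a * f x + b * g x) h = a * L2_ip M f h + b * L2_ip M g h"
    using L2_ip_linear[of f M g h a b] by simp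
qed (auto simp: L2_zero L2_ip_nonneg)

lemma L2_ip_component_le:
  assumes "f \<in> L2 M" "i \<in> Basis"
  shows "L2_ip M (\<lambda>x. f x \<bullet> i) (\<lambda>x. f x \<bullet> i) \<le> L2_ip M f f"
  unfolding L2_ip_self
proof (rule integral_mono)
  show "integrable M (\<lambda>x. (norm (f x \<bullet> i))\<^sup>2)"
    by (rule L2_integrable_norm[OF L2_component[OF assms(1)]])
  show "integrable M (\<lambda>x. (norm (f x))\<^sup>2)" by (rule L2_integrable_norm[OF assms(1)])
  show "(norm (f x \<bullet> i))\<^sup>2 \<le> (norm (f x))\<^sup>2" for x
    using Basis_le_norm[OF assms(2), of "f x"] by (intro power_mono) auto
qed

lemma L2_ip_tendsto:
  fixes u :: "nat \<Rightarrow> 'a \<Rightarrow> real"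
  assumes "\<And>n. u n \<in> L2 M" "v \<in> L2 M" "w \<in> L2 M"
    and "(\<lambda>n. L2_ip M (\<lambda>x. u n x - v x) (\<lambda>x. u n x - v x)) \<longlonglongrightarrow> 0"
  shows "(\<lambda>n. L2_ip M (u n) w) \<longlonglongrightarrow> L2_ip M v w"
proof -
  interpret function_ip_space "L2 M" "L2_ip M" by (rule function_ip_space_L2)
  show ?thesis
    using tendsto_real_sqrt[OF assms(4)] by (intro ip_tendsto assms(1-3)) (simp add: ip_norm_def)
qed

lemma L2_Pair:
  assumes "U \<in> L2 M" "W \<in> L2 M"
  shows "(\<lambda>z. (U z, W z)) \<in> L2 M"
proof -
  have [measurable]: "U \<in> borel_measurable M" "W \<in> borel_measurable M"
    using assms by (auto dest: L2_measurable)
  have "integrable M (\<lambda>z. (norm (U z))\<^sup>2 + (norm (W z))\<^sup>2)"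
    using assms[THEN L2_integrable_norm] by simp
  moreover have "(\<lambda>z. (U z, W z)) \<in> borel_measurable M" by (intro borel_measurable_Pair) measurable
  ultimately show ?thesis by (simp add: L2_def norm_Pair)
qed

lemma L2_fst_snd:
  fixes H :: "'a \<Rightarrow> 'b::euclidean_space \<times> 'c::euclidean_space"
  assumes "H \<in> L2 M"
  shows "(\<lambda>z. fst (H z)) \<in> L2 M" "(\<lambda>z. snd (H z)) \<in> L2 M"
proof -
  have H: "H \<in> borel_measurable M" using assms by (rule L2_measurable)
  have "(\<lambda>z. fst (H z)) \<in> borel_measurable M" "(\<lambda>z. snd (H z)) \<in> borel_measurable M"
    by (rule measurable_compose[OF H borel_measurable_continuous_onI], intro continuous_intros)+
  moreover have "norm (fst (H z)) \<le> 1 * norm (H z)" "norm (snd (H z)) \<le> 1 * norm (H z)" for z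
    using norm_fst_le[of "fst (H z)" "snd (H z)"] norm_snd_le[of "snd (H z)" "fst (H z)"] by simp_all
  ultimately show "(\<lambda>z. fst (H z)) \<in> L2 M" "(\<lambda>z. snd (H z)) \<in> L2 M"
    using L2_dominated[OF assms] by blast+
qed

lemma L2_ip_Pair:
  assumes "U \<in> L2 M" "W \<in> L2 M" "H \<in> L2 M"
  shows "L2_ip M (\<lambda>z. (U z, W z)) H = L2_ip M U (\<lambda>z. fst (H z)) + L2_ip M W (\<lambda>z. snd (H z))"
  using integrable_L2_inner[OF assms(1) L2_fst_snd(1)[OF assms(3)]]
    integrable_L2_inner[OF assms(2) L2_fst_snd(2)[OF assms(3)]]
  by (simp add: L2_ip_def inner_prod_def)

lemma nn_integral_L2_dist:
  assumes "f \<in> L2 M" "g \<in> L2 M"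
  shows "(\<integral>\<^sup>+x. ennreal ((norm (f x - g x))\<^sup>2) \<partial>M)
       = ennreal (L2_ip M (\<lambda>x. f x - g x) (\<lambda>x. f x - g x))"
  unfolding L2_ip_self by (intro nn_integral_eq_integral L2_integrable_norm L2_diff assms) simp

text \<open>
  A sequence of indices along which a Cauchy condition holds at prescribed rates. Summing the moduli
  makes the sequence monotone and at least as large as the identity.
\<close>

lemma Cauchy_subsequence_control:
  fixes P :: "nat \<Rightarrow> nat \<Rightarrow> nat \<Rightarrow> bool"
  assumes "\<And>k. \<exists>K. \<forall>m\<ge>K. \<forall>n\<ge>K. P k m n"
  obtains r where "mono r" "\<And>k. r k \<ge> k" "\<And>k m n. m \<ge> r k \<Longrightarrow> n \<ge> r k \<Longrightarrow> P k m n"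
proof -
  obtain K where K: "\<And>k m n. m \<ge> K k \<Longrightarrow> n \<ge> K k \<Longrightarrow> P k m n"
    using assms by metis
  define r where "r k = (\<Sum>i\<le>k. K i + 1)" for k
  have "mono r" unfolding r_def by (intro monoI sum_mono2) auto
  moreover have "r k \<ge> K k" for k
    unfolding r_def using member_le_sum[of k "{..k}" "\<lambda>i. K i + 1"] by simp
  moreover have "r k \<ge> k" for k
    unfolding r_def using sum_mono[of "{..k}" "\<lambda>i. 1" "\<lambda>i. K i + 1"] by simp
  ultimately show ?thesis using that[of r] K by (meson order_trans)
qed

text \<open>
  The Riesz-Fischer theorem. Along a fast subsequence the series of weighted squared increments has
  finite integral, hence it converges almost everywhere, and then so does the subsequence. Fatou's lemma
  bounds the distance of the full sequence to the pointwise limit. The vector-valued version is needed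
  for gradients.
\<close>

lemma L2_complete:
  fixes f :: "nat \<Rightarrow> 'a \<Rightarrow> 'b::euclidean_space"
  assumes f: "\<And>n. f n \<in> L2 M"
    and Cauchy: "\<And>\<epsilon>. \<epsilon> > 0 \<Longrightarrow>
      \<exists>K. \<forall>m\<ge>K. \<forall>n\<ge>K. L2_ip M (\<lambda>x. f m x - f n x) (\<lambda>x. f m x - f n x) < \<epsilon>"
  obtains g where "g \<in> L2 M" "(\<lambda>n. L2_ip M (\<lambda>x. f n x - g x) (\<lambda>x. f n x - g x)) \<longlonglongrightarrow> 0"
proof -
  have [measurable]: "f n \<in> borel_measurable M" for n using f by (rule L2_measurable)
  define D where "D m n = L2_ip M (\<lambda>x. f m x - f n x) (\<lambda>x. f m x - f n x)" for m n
  \<comment> \<open>The rate is fast enough to leave a summable sequence after multiplication by \<open>2 ^ k\<close>.\<close>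
  have "\<exists>K. \<forall>m\<ge>K. \<forall>n\<ge>K. D m n < (1/4) ^ k" for k
    using Cauchy[of "(1/4) ^ k"] by (simp add: D_def)
  from Cauchy_subsequence_control[of "\<lambda>k m n. D m n < (1/4) ^ k", OF this]
  obtain r where r: "mono r" "\<And>k. r k \<ge> k" "\<And>k m n. m \<ge> r k \<Longrightarrow> n \<ge> r k \<Longrightarrow> D m n < (1/4) ^ k"
    by blast
  define d where "d k x = norm (f (r (Suc k)) x - f (r k) x)" for k x
  have [measurable]: "d k \<in> borel_measurable M" for k unfolding d_def by measurable
  have "(\<integral>\<^sup>+x. (\<Sum>k. ennreal (2 ^ k * (d k x)\<^sup>2)) \<partial>M) = (\<Sum>k. \<integral>\<^sup>+x. ennreal (2 ^ k * (d k x)\<^sup>2) \<partial>M)"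
    by (rule nn_integral_suminf) measurable
  also have "\<dots> \<le> (\<Sum>k. ennreal ((1/2) ^ k))"
  proof (intro suminf_le summableI)
    fix k
    have "(\<integral>\<^sup>+x. ennreal (2 ^ k * (d k x)\<^sup>2) \<partial>M) = ennreal (2 ^ k) * (\<integral>\<^sup>+x. ennreal ((d k x)\<^sup>2) \<partial>M)"
      by (subst nn_integral_cmult[symmetric]) (auto simp: ennreal_mult)
    also have "\<dots> = ennreal (2 ^ k * D (r (Suc k)) (r k))"
      unfolding d_def D_def by (simp add: nn_integral_L2_dist f ennreal_mult L2_ip_nonneg)
    also have "\<dots> \<le> ennreal ((1/2) ^ k)"
    proof (rule ennreal_leI)
      have "r k \<le> r (Suc k)" using r(1) by (simp add: monoD)
      then have "2 ^ k * D (r (Suc k)) (r k) \<le> 2 ^ k * (1/4) ^ k"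
        using r(3)[of k "r (Suc k)" "r k"] by simp
      also have "\<dots> = (1/2) ^ k" by (simp flip: power_mult_distrib)
      finally show "2 ^ k * D (r (Suc k)) (r k) \<le> (1/2) ^ k" .
    qed
    finally show "(\<integral>\<^sup>+x. ennreal (2 ^ k * (d k x)\<^sup>2) \<partial>M) \<le> ennreal ((1/2) ^ k)" .
  qed
  also have "\<dots> = ennreal (\<Sum>k. (1/2) ^ k)"
    by (intro suminf_ennreal2) (auto intro: summable_geometric)
  also have "\<dots> < \<infinity>" by simp
  finally have "(\<integral>\<^sup>+x. (\<Sum>k. ennreal (2 ^ k * (d k x)\<^sup>2)) \<partial>M) \<noteq> \<infinity>" by simp
  then have "AE x in M. (\<Sum>k. ennreal (2 ^ k * (d k x)\<^sup>2)) \<noteq> \<infinity>"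
    by (intro nn_integral_noteq_infinite) measurable
  then have conv: "AE x in M. convergent (\<lambda>k. f (r k) x)"
  proof eventually_elim
    case (elim x)
    then have s: "summable (\<lambda>k. 2 ^ k * (d k x)\<^sup>2)"
      by (intro summable_suminf_not_top) auto
    have "summable (\<lambda>k. (1/2) ^ k + 2 ^ k * (d k x)\<^sup>2)"
      by (intro summable_add s summable_geometric) simp
    \<comment> \<open>The arithmetic-geometric mean inequality trades the weight \<open>2 ^ k\<close> for summability of the increments themselves.\<close>
    moreover have "norm (f (r (Suc k)) x - f (r k) x) \<le> (1/2) ^ k + 2 ^ k * (d k x)\<^sup>2" for k
    proof -
      have "(1/2::real) ^ k * 2 ^ k = 1" by (simp flip: power_mult_distrib)
      then have "2 * ((1/2) ^ k * 2 ^ k) * d k x \<le> ((1/2) ^ k + 2 ^ k * (d k x)\<^sup>2) * 2"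
        using zero_le_power2[of "1 - 2 ^ k * d k x"] zero_le_power2[of "2 ^ k * d k x"]
        by (simp add: power2_eq_square field_simps)
      then show ?thesis using \<open>(1/2::real) ^ k * 2 ^ k = 1\<close> by (simp add: d_def)
    qed
    ultimately have "summable (\<lambda>k. f (r (Suc k)) x - f (r k) x)"
      by (rule summable_comparison_test'[where N = 0]) 
    then have "convergent (\<lambda>n. f (r n) x - f (r 0) x)"
      by (simp only: summable_iff_convergent sum_lessThan_telescope[of "\<lambda>k. f (r k) x"])
    then show ?case by (simp only: convergent_diff_const_right_iff)
  qed
  define g where "g x = lim (\<lambda>k. f (r k) x)" for x
  have [measurable]: "g \<in> borel_measurable M" unfolding g_def by measurable
  have Fatou: "(\<integral>\<^sup>+x. ennreal ((norm (f n x - g x))\<^sup>2) \<partial>M) \<le> ennreal \<epsilon>"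
    if K: "\<And>m. m \<ge> K \<Longrightarrow> D n m \<le> \<epsilon>" for n K \<epsilon>
  proof -
    have "(\<integral>\<^sup>+x. ennreal ((norm (f n x - g x))\<^sup>2) \<partial>M)
        = (\<integral>\<^sup>+x. liminf (\<lambda>k. ennreal ((norm (f n x - f (r k) x))\<^sup>2)) \<partial>M)"
    proof (rule nn_integral_cong_AE, use conv in eventually_elim)
      case (elim x)
      then have "(\<lambda>k. f (r k) x) \<longlonglongrightarrow> g x" by (simp add: g_def convergent_LIMSEQ_iff)
      then have "(\<lambda>k. ennreal ((norm (f n x - f (r k) x))\<^sup>2)) \<longlonglongrightarrow> ennreal ((norm (f n x - g x))\<^sup>2)"
        by (intro tendsto_intros) 
      from lim_imp_Liminf[OF trivial_limit_sequentially this] show ?case by (rule sym)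
    qed
    also have "\<dots> \<le> liminf (\<lambda>k. \<integral>\<^sup>+x. ennreal ((norm (f n x - f (r k) x))\<^sup>2) \<partial>M)"
      by (intro nn_integral_liminf) measurable
    also have "\<dots> \<le> ennreal \<epsilon>"
    proof (rule Liminf_le)
      show "\<forall>\<^sub>F k in sequentially. (\<integral>\<^sup>+x. ennreal ((norm (f n x - f (r k) x))\<^sup>2) \<partial>M) \<le> ennreal \<epsilon>"
        unfolding eventually_sequentially nn_integral_L2_dist[OF f f] D_def[symmetric]
        using K r(2) by (intro exI[of _ K] allI impI ennreal_leI) (meson order_trans)
    qed simp
    finally show ?thesis .
  qed
  have close: "(\<lambda>x. f n x - g x) \<in> L2 M" "L2_ip M (\<lambda>x. f n x - g x) (\<lambda>x. f n x - g x) \<le> \<epsilon>"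
    if K: "\<And>m. m \<ge> K \<Longrightarrow> D n m \<le> \<epsilon>" for n K \<epsilon>
  proof -
    have "D n K \<ge> 0" unfolding D_def by (rule L2_ip_nonneg)
    then have "\<epsilon> \<ge> 0" using K[of K] by simp
    have F: "(\<integral>\<^sup>+x. ennreal ((norm (f n x - g x))\<^sup>2) \<partial>M) \<le> ennreal \<epsilon>"
      by (rule Fatou) (rule K)
    have "integrable M (\<lambda>x. (norm (f n x - g x))\<^sup>2)"
      by (intro integrableI_nonneg) (auto intro: le_less_trans[OF F])
    then show L: "(\<lambda>x. f n x - g x) \<in> L2 M" by (simp add: L2_def)
    have "ennreal (L2_ip M (\<lambda>x. f n x - g x) (\<lambda>x. f n x - g x)) \<le> ennreal \<epsilon>"
      unfolding L2_ip_self using F L2_integrable_norm[OF L]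
      by (subst nn_integral_eq_integral[symmetric]) auto
    then show "L2_ip M (\<lambda>x. f n x - g x) (\<lambda>x. f n x - g x) \<le> \<epsilon>"
      using \<open>\<epsilon> \<ge> 0\<close> by simp
  qed
  obtain K0 where K0: "\<And>m n. m \<ge> K0 \<Longrightarrow> n \<ge> K0 \<Longrightarrow> D m n < 1"
    using Cauchy[of 1] unfolding D_def by fastforce
  have "(\<lambda>x. f K0 x - g x) \<in> L2 M"
    by (rule close(1)[of K0 K0 1]) (use K0 in \<open>simp add: less_imp_le\<close>)
  from L2_diff[OF f[of K0] this] have "g \<in> L2 M" by simp
  moreover have "(\<lambda>n. L2_ip M (\<lambda>x. f n x - g x) (\<lambda>x. f n x - g x)) \<longlonglongrightarrow> 0"
  proof (rule LIMSEQ_I)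
    fix e :: real assume "e > 0"
    then obtain K where K: "\<And>m n. m \<ge> K \<Longrightarrow> n \<ge> K \<Longrightarrow> D m n < e/2"
      using Cauchy[of "e/2"] unfolding D_def by fastforce
    have "norm (L2_ip M (\<lambda>x. f n x - g x) (\<lambda>x. f n x - g x) - 0) < e" if "n \<ge> K" for n
      using close(2)[of K n "e/2"] K[OF that] L2_ip_nonneg[of M "\<lambda>x. f n x - g x"] \<open>e > 0\<close>
      by (force simp: less_imp_le)
    then show "\<exists>no. \<forall>n\<ge>no. norm (L2_ip M (\<lambda>x. f n x - g x) (\<lambda>x. f n x - g x) - 0) < e" by blast
  qed
  ultimately show ?thesis by (rule that)
qed

lemma L2_complete_norm:
  fixes u :: "nat \<Rightarrow> 'a \<Rightarrow> real"
  assumes "\<And>n. u n \<in> L2 M"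
    and "\<And>\<epsilon>. \<epsilon> > 0 \<Longrightarrow> \<exists>K. \<forall>m\<ge>K. \<forall>n\<ge>K. ip_norm (L2_ip M) (\<lambda>x. u m x - u n x) < \<epsilon>"
  shows "\<exists>v\<in>L2 M. (\<lambda>n. ip_norm (L2_ip M) (\<lambda>x. u n x - v x)) \<longlonglongrightarrow> 0"
proof -
  have C: "\<exists>K. \<forall>m\<ge>K. \<forall>n\<ge>K. L2_ip M (\<lambda>x. u m x - u n x) (\<lambda>x. u m x - u n x) < \<epsilon>" if "\<epsilon> > 0" for \<epsilon>
    using assms(2)[of "sqrt \<epsilon>"] that by (simp add: ip_norm_def)
  obtain v where v: "v \<in> L2 M" "(\<lambda>n. L2_ip M (\<lambda>x. u n x - v x) (\<lambda>x. u n x - v x)) \<longlonglongrightarrow> 0"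
    using L2_complete[of u M, OF assms(1) C] by blast
  have "(\<lambda>n. ip_norm (L2_ip M) (\<lambda>x. u n x - v x)) \<longlonglongrightarrow> 0"
    using tendsto_real_sqrt[OF v(2)] by (simp add: ip_norm_def)
  then show ?thesis using v(1) by (rule bexI)
qed

section \<open>Smooth bump functions and the fundamental lemma of the calculus of variations\<close>

lemma Ck_SucD: "Ck (Suc k) f \<Longrightarrow> Ck k f"
proof (induction k arbitrary: f)
  case 0
  then show ?case
    by (auto intro!: differentiable_imp_continuous_on simp: differentiable_on_def
        intro: differentiable_at_withinI)
next
  case (Suc k)
  then show ?case by (meson Ck.simps(2))
qed

lemma Ck_SucI:
  assumes "\<And>x. (f has_derivative f' x) (at x)" "\<And>i. i \<in> Basis \<Longrightarrow> Ck k (\<lambda>x. f' x i)"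
  shows "Ck (Suc k) f"
proof -
  have "frechet_derivative f (at x) = f' x" for x
    using frechet_derivative_at[OF assms(1)] by simp
  then show ?thesis using assms by (auto simp: differentiable_def)
qed

lemma Ck_has_derivative:
  "Ck (Suc k) f \<Longrightarrow> (f has_derivative frechet_derivative f (at x)) (at x)"
  by (simp add: frechet_derivative_works)

lemma Ck_const: "Ck k (\<lambda>x. c)"
proof (induction k arbitrary: c)
  case (Suc k)
  then show ?case by (intro Ck_SucI[where f' = "\<lambda>x y. 0"]) auto
qed simp

lemma Ck_add: "Ck k f \<Longrightarrow> Ck k g \<Longrightarrow> Ck k (\<lambda>x. f x + g x)"
proof (induction k arbitrary: f g)
  case (Suc k)
  show ?case
    by (rule Ck_SucI[where f' = "\<lambda>x i. frechet_derivative f (at x) i + frechet_derivative g (at x) i"])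
      (use Suc in \<open>auto intro!: has_derivative_add simp: frechet_derivative_works\<close>)
qed (auto intro: continuous_on_add)

lemma Ck_mult: "Ck k f \<Longrightarrow> Ck k g \<Longrightarrow> Ck k (\<lambda>x. f x * g x)"
proof (induction k arbitrary: f g)
  case (Suc k)
  note fg = Suc.prems[THEN Ck_SucD]
  show ?case
  proof (rule Ck_SucI[where f' = "\<lambda>x i. f x * frechet_derivative g (at x) i + frechet_derivative f (at x) i * g x"])
    show "((\<lambda>x. f x * g x) has_derivative
        (\<lambda>i. f x * frechet_derivative g (at x) i + frechet_derivative f (at x) i * g x)) (at x)" for x
      by (rule has_derivative_mult[OF Ck_has_derivative[OF Suc.prems(1)] Ck_has_derivative[OF Suc.prems(2)]])
    fix i :: 'a assume "i \<in> Basis"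
    then show "Ck k (\<lambda>x. f x * frechet_derivative g (at x) i + frechet_derivative f (at x) i * g x)"
      using Suc.prems by (intro Ck_add Suc.IH fg) auto
  qed
qed (auto intro: continuous_on_mult)

lemma Ck_prod: "(\<And>i. i \<in> A \<Longrightarrow> Ck k (f i)) \<Longrightarrow> Ck k (\<lambda>x. \<Prod>i\<in>A. f i x)"
  by (induction A rule: infinite_finite_induct) (auto intro: Ck_const Ck_mult)

text \<open>
  The standard smooth function \<open>exp (- 1 / t)\<close>, extended by zero to \<open>t \<le> 0\<close>, is \<open>flat 0\<close>. The
  additional powers of \<open>1 / t\<close> make the family closed under differentiation, so that smoothness is one
  induction.
\<close>

definition flat :: "nat \<Rightarrow> real \<Rightarrow> real" where
  "flat k t = (if t > 0 then (1 / t) ^ k * exp (- (1 / t)) else 0)"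

lemma flat_tendsto_0: "(flat k \<longlongrightarrow> 0) (at 0)"
proof (rule filterlim_split_at)
  show "(flat k \<longlongrightarrow> 0) (at_left 0)"
    by (rule tendsto_eventually) (auto simp: flat_def eventually_at_filter)
  have "((\<lambda>t. inverse t ^ k / exp (inverse t)) \<longlongrightarrow> 0) (at_right (0::real))"
    by (rule filterlim_compose[OF tendsto_power_div_exp_0 filterlim_inverse_at_top_right])
  moreover have "\<forall>\<^sub>F t in at_right (0::real). inverse t ^ k / exp (inverse t) = flat k t"
    by (auto simp: eventually_at_filter flat_def exp_minus field_simps)
  ultimately show "(flat k \<longlongrightarrow> 0) (at_right 0)"
    by (rule Lim_transform_eventually)
qed

lemma flat_has_derivative:
  "(flat k has_real_derivative flat (k + 2) t - real k * flat (k + 1) t) (at t)"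
proof -
  consider "t > 0" | "t = 0" | "t < 0" by linarith
  then show ?thesis
  proof cases
    case 1
    have pow: "n = 0" if "t ^ n \<noteq> t * t ^ (n - Suc 0)" for n
      using that by (cases n) auto
    have "((\<lambda>t. (1 / t) ^ k * exp (- (1 / t))) has_real_derivative
        flat (k + 2) t - real k * flat (k + 1) t) (at t)"
      using 1 by (cases k)
        (auto intro!: derivative_eq_intros simp: flat_def field_simps power2_eq_square dest: pow)
    then show ?thesis
      by (rule has_field_derivative_transform_within_open[of _ _ _ "{0<..}"])
        (use 1 in \<open>auto simp: flat_def\<close>)
  next
    case 2
    \<comment> \<open>The difference quotient of \<open>flat k\<close> at \<open>0\<close> is \<open>flat (Suc k)\<close>.\<close>
    have "((\<lambda>h. (flat k h - flat k 0) / (h - 0)) \<longlongrightarrow> 0) (at 0)"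
      by (rule Lim_transform_eventually[OF flat_tendsto_0[of "Suc k"]])
        (auto simp: flat_def eventually_at_filter)
    then show ?thesis using 2 by (simp add: has_field_derivative_iff flat_def)
  next
    case 3
    have "((\<lambda>t. 0) has_real_derivative flat (k + 2) t - real k * flat (k + 1) t) (at t)"
      using 3 by (simp add: flat_def)
    then show ?thesis
      by (rule has_field_derivative_transform_within_open[of _ _ _ "{..<0}"])
        (use 3 in \<open>auto simp: flat_def\<close>)
  qed
qed

lemma Ck_flat_affine: "Ck n (\<lambda>x. flat k (x \<bullet> v + c))"
proof (induction n arbitrary: k)
  case 0
  have "isCont (flat k) t" for t
    using flat_has_derivative by (rule DERIV_isCont)
  then have "continuous_on UNIV (flat k)" by (simp add: continuous_on_eq_continuous_at)
  then show ?case
    by (auto intro!: continuous_on_compose2[of UNIV "flat k"] continuous_intros)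
next
  case (Suc n)
  show ?case
  proof (rule Ck_SucI)
    show "((\<lambda>x. flat k (x \<bullet> v + c)) has_derivative
        (\<lambda>y. y \<bullet> v * (flat (k + 2) (x \<bullet> v + c) + - real k * flat (k + 1) (x \<bullet> v + c)))) (at x)" for x
    proof -
      have "((\<lambda>x. x \<bullet> v + c) has_derivative (\<lambda>y. y \<bullet> v)) (at x)"
        by (auto intro!: derivative_eq_intros)
      from has_derivative_compose[OF this flat_has_derivative[THEN has_field_derivative_imp_has_derivative]]
      show ?thesis by (simp add: mult.commute)
    qed
    show "Ck n (\<lambda>x. i \<bullet> v * (flat (k + 2) (x \<bullet> v + c) + - real k * flat (k + 1) (x \<bullet> v + c)))" for i
      by (intro Ck_mult Ck_add Ck_const Suc.IH)
  qed
qed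

text \<open>
  Since \<open>flat 0 (n * s)\<close> tends to \<open>1\<close> for \<open>s > 0\<close> and is \<open>0\<close> otherwise, these functions approximate the
  indicator of the open box while keeping their support in its closure.
\<close>

definition box_bump :: "'a::euclidean_space \<Rightarrow> 'a \<Rightarrow> nat \<Rightarrow> 'a \<Rightarrow> real" where
  "box_bump a b n x = (\<Prod>i\<in>Basis. flat 0 (real n * (x \<bullet> i - a \<bullet> i)) * flat 0 (real n * (b \<bullet> i - x \<bullet> i)))"

lemma flat_0_bounds: "0 \<le> flat 0 t" "flat 0 t \<le> 1"
  by (auto simp: flat_def)

lemma box_bump_bounds: "0 \<le> box_bump a b n x" "box_bump a b n x \<le> 1"
  unfolding box_bump_def
  by (auto intro!: prod_nonneg prod_le_1 mult_nonneg_nonneg mult_le_one simp: flat_0_bounds)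

lemma box_bump_eq_0: "x \<notin> box a b \<Longrightarrow> box_bump a b n x = 0"
  by (force simp: box_bump_def mem_box flat_def zero_less_mult_iff not_less)

lemma box_bump_tendsto: "(\<lambda>n. box_bump a b n x) \<longlonglongrightarrow> indicator (box a b) x"
proof (cases "x \<in> box a b")
  case True
  have flat1: "(\<lambda>n. flat 0 (real n * s)) \<longlonglongrightarrow> 1" if "s > 0" for s
  proof -
    have "(\<lambda>n. exp (- (inverse (real n) * inverse s))) \<longlonglongrightarrow> exp (- (0 * inverse s))"
      by (intro tendsto_intros lim_inverse_n)
    moreover have "\<forall>\<^sub>F n in sequentially. exp (- (inverse (real n) * inverse s)) = flat 0 (real n * s)"
      using eventually_gt_at_top[of 0]
      by eventually_elim (use that in \<open>auto simp: flat_def field_simps\<close>)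
    ultimately show ?thesis by (auto intro: Lim_transform_eventually)
  qed
  have "(\<lambda>n. box_bump a b n x) \<longlonglongrightarrow> (\<Prod>i\<in>(Basis::'a set). 1 * 1)"
    unfolding box_bump_def by (intro tendsto_prod tendsto_mult flat1) (use True in \<open>auto simp: mem_box\<close>)
  then show ?thesis using True by simp
qed (simp add: box_bump_eq_0)

lemma box_bump_test_function:
  assumes "cbox a b \<subseteq> \<Omega>"
  shows "box_bump a b n \<in> test_functions \<Omega>"
proof -
  have "Ck k (box_bump a b n)" for k
  proof -
    have "box_bump a b n = (\<lambda>x. \<Prod>i\<in>Basis. flat 0 (x \<bullet> (real n *\<^sub>R i) + - real n * (a \<bullet> i)) *
        flat 0 (x \<bullet> (- real n *\<^sub>R i) + real n * (b \<bullet> i)))"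
      by (auto simp: box_bump_def fun_eq_iff algebra_simps)
    then show ?thesis by (simp only:) (intro Ck_prod Ck_mult Ck_flat_affine)
  qed
  moreover have sub: "closure {x. box_bump a b n x \<noteq> 0} \<subseteq> cbox a b"
    using box_bump_eq_0[of _ a b n] box_subset_cbox[of a b] by (intro closure_minimal) auto
  moreover have "compact (closure {x. box_bump a b n x \<noteq> 0})"
    using bounded_subset[OF bounded_cbox sub] by (simp add: compact_eq_bounded_closed)
  ultimately show ?thesis using assms by (auto simp: test_functions_def)
qed

lemma test_function_continuous: "\<phi> \<in> test_functions \<Omega> \<Longrightarrow> continuous_on UNIV \<phi>"
  using Ck.simps(1)[of \<phi>] unfolding test_functions_def by blast

lemma test_function_measurable [measurable_dest]:
  "\<phi> \<in> test_functions \<Omega> \<Longrightarrow> \<phi> \<in> borel_measurable borel"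
  by (intro borel_measurable_continuous_onI test_function_continuous)

text \<open>
  Boxes are a generator of the Borel sets that is stable under intersection, so vanishing integrals
  over boxes propagate to all Borel subsets of a given box, and a density is determined by its
  integrals over Borel sets.
\<close>

lemma null_of_boxes:
  fixes g :: "'a::euclidean_space \<Rightarrow> real"
  assumes g: "integrable lborel g"
    and boxes: "\<And>a b. box a b \<subseteq> box c d \<Longrightarrow> (LINT x:box a b|lborel. g x) = 0"
  shows "AE x in lborel. x \<in> box c d \<longrightarrow> g x = 0"
proof -
  have si: "set_integrable lborel A g" if "A \<in> sets borel" for A
    using integrable_mult_indicator[OF _ g, of A] that by (simp add: set_integrable_def)
  have zero: "(LINT x:A \<inter> box c d|lborel. g x) = 0" if "A \<in> sets borel" for A :: "'a set"
  proof -
    let ?G = "range (\<lambda>(a, b). box a b :: 'a set)"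
    have stable: "Int_stable ?G" by (auto simp: Int_stable_def box_Int_box)
    have "A \<in> sigma_sets UNIV ?G"
      using that by (simp add: borel_eq_box)
    have "?G \<subseteq> Pow UNIV" by simp
    from stable this \<open>A \<in> sigma_sets UNIV ?G\<close> show ?thesis
    proof (induction rule: sigma_sets_induct_disjoint)
      case (basic A)
      then show ?case by (auto simp: box_Int_box intro!: boxes)
         (auto simp flip: box_Int_box)
    next
      case empty
      then show ?case by (simp add: set_lebesgue_integral_def)
    next
      case (compl A)
      then have A: "A \<in> sets borel" by (simp add: borel_eq_box)
      have "(LINT x:box c d|lborel. g x) = (LINT x:A \<inter> box c d|lborel. g x) + (LINT x:(UNIV - A) \<inter> box c d|lborel. g x)"
        using A by (subst set_integral_Un[symmetric]) (auto intro!: si arg_cong2[where f = "\<lambda>S. set_lebesgue_integral lborel S"] simp flip: Int_Un_distrib2)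
      then show ?case using compl boxes[of c d] by simp
    next
      case (union A)
      then have A: "A i \<in> sets borel" for i
        by (simp add: borel_eq_box) blast
      have "(LINT x:(\<Union>i. A i \<inter> box c d)|lborel. g x) = (\<Sum>i. (LINT x:A i \<inter> box c d|lborel. g x))"
        using A union(1) by (intro lebesgue_integral_countable_add si) (auto simp: disjoint_family_on_def)
      also have "\<dots> = 0" using union by simp
      finally show ?case by simp
    qed
  qed
  have "AE x in lborel. indicator (box c d) x *\<^sub>R g x = (0::real)"
  proof (rule density_unique_real)
    show "integrable lborel (\<lambda>x. indicator (box c d) x *\<^sub>R g x)"
      using si[of "box c d"] by (simp add: set_integrable_def)
    fix A :: "'a set" assume "A \<in> sets lborel"
    then show "(LINT x:A|lborel. indicator (box c d) x *\<^sub>R g x) = (LINT x:A|lborel. 0)"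
      using zero[of A] by (simp add: set_lebesgue_integral_def indicator_inter_arith mult.assoc)
  qed simp
  then show ?thesis by eventually_elim (auto simp: indicator_def)
qed

lemma AE_vol_iff: "open \<Omega> \<Longrightarrow> (AE x in vol \<Omega>. P x) \<longleftrightarrow> (AE x in lborel. x \<in> \<Omega> \<longrightarrow> P x)"
  by (simp add: AE_restrict_space_iff)

text \<open>
  Dominated convergence along \<open>box_bump\<close> turns orthogonality to test functions into vanishing
  integrals over all boxes whose closure is in \<open>\<Omega>\<close>; countably many such boxes cover \<open>\<Omega>\<close>.
\<close>

lemma fundamental_lemma:
  fixes f :: "'a::euclidean_space \<Rightarrow> real"
  assumes \<Omega>: "open \<Omega>" and f: "integrable (vol \<Omega>) f"
    and test: "\<And>\<phi>. \<phi> \<in> test_functions \<Omega> \<Longrightarrow> (\<integral>x. f x * \<phi> x \<partial>vol \<Omega>) = 0"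
  shows "AE x in vol \<Omega>. f x = 0"
proof -
  define g where "g x = indicator \<Omega> x *\<^sub>R f x" for x
  have g: "integrable lborel g"
    using f \<Omega> by (simp add: g_def[abs_def] integrable_restrict_space)
  have [measurable]: "g \<in> borel_measurable borel" using g by simp
  have gtest: "(\<integral>x. g x * \<phi> x \<partial>lborel) = 0" if "\<phi> \<in> test_functions \<Omega>" for \<phi>
    using test[OF that] \<Omega> by (simp add: g_def integral_restrict_space mult.assoc)
  have box0: "(LINT x:box a b|lborel. g x) = 0" if ab: "cbox a b \<subseteq> \<Omega>" for a b
  proof -
    have "(\<lambda>n. \<integral>x. g x * box_bump a b n x \<partial>lborel) \<longlonglongrightarrow> (\<integral>x. g x * indicator (box a b) x \<partial>lborel)"
    proof (rule integral_dominated_convergence[where w = "\<lambda>x. \<bar>g x\<bar>"])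
      show "(\<lambda>x. g x * box_bump a b n x) \<in> borel_measurable lborel" for n
        using test_function_measurable[OF box_bump_test_function[OF ab]] by measurable
      show "AE x in lborel. (\<lambda>n. g x * box_bump a b n x) \<longlonglongrightarrow> g x * indicator (box a b) x"
        by (intro AE_I2 tendsto_intros box_bump_tendsto)
      show "AE x in lborel. norm (g x * box_bump a b n x) \<le> \<bar>g x\<bar>" for n
        by (intro AE_I2) (simp add: abs_mult box_bump_bounds mult_left_le)
    qed (use g in auto)
    then have "(\<integral>x. g x * indicator (box a b) x \<partial>lborel) = 0"
      using gtest[OF box_bump_test_function[OF ab]] by (simp add: LIMSEQ_const_iff)
    then show ?thesis by (simp add: set_lebesgue_integral_def mult.commute)
  qed
  have box_AE: "AE x in lborel. x \<in> box c d \<longrightarrow> g x = 0" if cd: "cbox c d \<subseteq> \<Omega>" for c d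
  proof (rule null_of_boxes[OF g])
    fix a b assume ab: "box a b \<subseteq> box c d"
    show "(LINT x:box a b|lborel. g x) = 0"
    proof (cases "box a b = {}")
      case False
      then have "cbox a b \<subseteq> cbox c d"
        using ab by (metis closure_box closure_mono box_eq_empty(1) empty_subsetI subset_empty)
      then show ?thesis using box0 cd by blast
    qed (simp add: set_lebesgue_integral_def)
  qed
  let ?F = "{box a b | a b. cbox a b \<subseteq> \<Omega>}"
  have "open S" if "S \<in> ?F" for S using that by auto
  from Lindelof[OF this] obtain F where F: "F \<subseteq> ?F" "countable F" "\<Union>F = \<Union>?F" .
  have "\<Omega> \<subseteq> \<Union>?F"
  proof
    fix x assume "x \<in> \<Omega>"
    then obtain a b where "cbox a b \<subseteq> \<Omega>" "x \<in> box a b"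
      by (rule open_contains_cbox[OF \<Omega>])
    then show "x \<in> \<Union>?F" by blast
  qed
  have "AE x in lborel. \<forall>B\<in>F. x \<in> B \<longrightarrow> g x = 0"
    using F(1) box_AE by (intro AE_ball_countable'[OF _ F(2)]) blast
  then have "AE x in lborel. x \<in> \<Omega> \<longrightarrow> f x = 0"
    by eventually_elim (use \<open>\<Omega> \<subseteq> \<Union>?F\<close> F(3) in \<open>auto simp: g_def\<close>)
  then show ?thesis by (simp add: AE_vol_iff[OF \<Omega>])
qed

section \<open>Test functions and integration by parts\<close>

lemma frechet_derivative_outside_support:
  assumes "x \<notin> closure {x. f x \<noteq> (0::real)}"
  shows "frechet_derivative f (at x) = (\<lambda>h. 0)"
proof -
  have "(f has_derivative (\<lambda>h. 0)) (at x)"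
    by (rule has_derivative_transform_within_open[of "\<lambda>x. 0" _ _ _ "- closure {x. f x \<noteq> 0}"])
      (use assms closure_subset[of "{x. f x \<noteq> 0}"] in auto)
  then show ?thesis using frechet_derivative_at by metis
qed

lemma test_functionsD:
  assumes "\<phi> \<in> test_functions \<Omega>"
  shows "Ck k \<phi>" "compact (closure {x. \<phi> x \<noteq> 0})" "closure {x. \<phi> x \<noteq> 0} \<subseteq> \<Omega>"
  using assms by (auto simp: test_functions_def)

lemma test_functionI:
  assumes "\<And>k. Ck k \<phi>" "{x. \<phi> x \<noteq> 0} \<subseteq> K" "compact K" "K \<subseteq> \<Omega>"
  shows "\<phi> \<in> test_functions \<Omega>"
proof -
  have "closure {x. \<phi> x \<noteq> 0} \<subseteq> K" using assms by (intro closure_minimal compact_imp_closed)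
  then show ?thesis using assms
    by (auto simp: test_functions_def compact_eq_bounded_closed intro: bounded_subset[of K])
qed

lemma test_function_lincomb:
  assumes "\<phi> \<in> test_functions \<Omega>" "\<psi> \<in> test_functions \<Omega>"
  shows "(\<lambda>x. a * \<phi> x + b * \<psi> x) \<in> test_functions \<Omega>"
proof (rule test_functionI)
  show "Ck k (\<lambda>x. a * \<phi> x + b * \<psi> x)" for k
    by (intro Ck_add Ck_mult Ck_const test_functionsD(1)[OF assms(1)] test_functionsD(1)[OF assms(2)])
  have "{x. a * \<phi> x + b * \<psi> x \<noteq> 0} \<subseteq> {x. \<phi> x \<noteq> 0} \<union> {x. \<psi> x \<noteq> 0}" by auto
  then show "{x. a * \<phi> x + b * \<psi> x \<noteq> 0} \<subseteq> closure {x. \<phi> x \<noteq> 0} \<union> closure {x. \<psi> x \<noteq> 0}"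
    using Un_mono[OF closure_subset[of "{x. \<phi> x \<noteq> 0}"] closure_subset[of "{x. \<psi> x \<noteq> 0}"]]
    by (rule order_trans)
  show "compact (closure {x. \<phi> x \<noteq> 0} \<union> closure {x. \<psi> x \<noteq> 0})"
    using assms by (intro compact_Un test_functionsD(2))
  show "closure {x. \<phi> x \<noteq> 0} \<union> closure {x. \<psi> x \<noteq> 0} \<subseteq> \<Omega>"
    using assms[THEN test_functionsD(3)] by simp
qed

lemma test_function_mult:
  assumes "\<phi> \<in> test_functions \<Omega>" "\<psi> \<in> test_functions \<Omega>"
  shows "(\<lambda>x. \<phi> x * \<psi> x) \<in> test_functions \<Omega>"
proof (rule test_functionI[OF _ _ test_functionsD(2,3)[OF assms(1)]])
  show "Ck k (\<lambda>x. \<phi> x * \<psi> x)" for k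
    by (intro Ck_mult test_functionsD(1)[OF assms(1)] test_functionsD(1)[OF assms(2)])
  have "{x. \<phi> x * \<psi> x \<noteq> 0} \<subseteq> {x. \<phi> x \<noteq> 0}" by auto
  then show "{x. \<phi> x * \<psi> x \<noteq> 0} \<subseteq> closure {x. \<phi> x \<noteq> 0}"
    using closure_subset by (rule order_trans)
qed

lemma test_function_zero: "(\<lambda>x. 0) \<in> test_functions \<Omega>"
  by (intro test_functionI[where K = "{}"] Ck_const) auto

lemma test_function_has_derivative:
  "\<phi> \<in> test_functions \<Omega> \<Longrightarrow> (\<phi> has_derivative frechet_derivative \<phi> (at x)) (at x)"
  using Ck_has_derivative test_functionsD(1) by blast

abbreviation partial :: "'a::euclidean_space \<Rightarrow> ('a \<Rightarrow> real) \<Rightarrow> 'a \<Rightarrow> real" where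
  "partial i \<phi> \<equiv> \<lambda>x. frechet_derivative \<phi> (at x) i"

lemma test_function_partial:
  assumes "\<phi> \<in> test_functions \<Omega>" "i \<in> Basis"
  shows "partial i \<phi> \<in> test_functions \<Omega>"
proof (rule test_functionI[OF _ _ test_functionsD(2,3)[OF assms(1)]])
  show "Ck k (partial i \<phi>)" for k
    using test_functionsD(1)[OF assms(1), of "Suc k"] assms(2) by simp
  show "{x. partial i \<phi> x \<noteq> 0} \<subseteq> closure {x. \<phi> x \<noteq> 0}"
  proof (intro subsetI, rule ccontr)
    fix x assume "x \<in> {x. partial i \<phi> x \<noteq> 0}" "x \<notin> closure {x. \<phi> x \<noteq> 0}"
    then show False using frechet_derivative_outside_support[of x \<phi>] by simp
  qed
qed

lemma test_function_integrable:
  assumes "\<phi> \<in> test_functions \<Omega>"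
  shows "integrable lborel \<phi>"
proof -
  let ?K = "closure {x. \<phi> x \<noteq> 0}"
  have "integrable lborel (\<lambda>x. indicator ?K x *\<^sub>R \<phi> x)"
    using test_functionsD(2)[OF assms] continuous_on_subset[OF test_function_continuous[OF assms]]
    by (intro borel_integrable_compact) auto
  moreover have "(\<lambda>x. indicator ?K x *\<^sub>R \<phi> x) = \<phi>"
    using closure_subset[of "{x. \<phi> x \<noteq> 0}"] by (auto simp: indicator_def fun_eq_iff)
  ultimately show ?thesis by (simp only:)
qed

lemma integral_vol_eq_lborel:
  fixes f :: "'a::euclidean_space \<Rightarrow> real"
  assumes "open \<Omega>" "\<And>x. x \<notin> \<Omega> \<Longrightarrow> f x = 0"
  shows "(\<integral>x. f x \<partial>vol \<Omega>) = (\<integral>x. f x \<partial>lborel)"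
proof -
  have "(\<integral>x. f x \<partial>vol \<Omega>) = (\<integral>x. indicator \<Omega> x *\<^sub>R f x \<partial>lborel)"
    using assms(1) by (intro integral_restrict_space) simp
  also have "(\<lambda>x. indicator \<Omega> x *\<^sub>R f x) = f" using assms(2) by (auto simp: indicator_def fun_eq_iff)
  finally show ?thesis .
qed

lemma test_function_outside:
  assumes "\<phi> \<in> test_functions \<Omega>" "x \<notin> \<Omega>"
  shows "\<phi> x = 0"
proof -
  have "{x. \<phi> x \<noteq> 0} \<subseteq> \<Omega>"
    using closure_subset test_functionsD(3)[OF assms(1)] by (rule order_trans)
  then show ?thesis using assms(2) by blast
qed

lemma measurable_vol:
  assumes "f \<in> borel_measurable borel"
  shows "f \<in> borel_measurable (vol \<Omega>)"
proof -
  have "f \<in> borel_measurable lborel" using assms by simp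
  then show ?thesis by (rule measurable_restrict_space1)
qed

lemma test_function_L2:
  assumes "open \<Omega>" "\<phi> \<in> test_functions \<Omega>"
  shows "\<phi> \<in> L2 (vol \<Omega>)"
proof -
  have "integrable lborel (\<lambda>x. \<phi> x * \<phi> x)"
    by (intro test_function_integrable[where \<Omega> = \<Omega>] test_function_mult assms)
  then have "integrable lborel (\<lambda>x. indicator \<Omega> x *\<^sub>R (\<phi> x * \<phi> x))"
    using integrable_mult_indicator[of \<Omega> lborel "\<lambda>x. \<phi> x * \<phi> x"] assms(1) by simp
  then have "integrable (vol \<Omega>) (\<lambda>x. \<phi> x * \<phi> x)"
    using assms(1) by (simp add: integrable_restrict_space)
  then show ?thesis
    using measurable_vol[OF test_function_measurable[OF assms(2)]]
    by (simp add: L2_def power2_eq_square)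
qed

text \<open>
  Difference quotients of a compactly supported function have integral zero because Lebesgue measure is
  translation invariant, and they converge boundedly to the partial derivative. This gives integration
  by parts for test functions through the product rule.
\<close>

lemma integral_partial_eq_0:
  fixes F :: "'a::euclidean_space \<Rightarrow> real"
  assumes F: "F \<in> test_functions \<Omega>" and i: "i \<in> Basis"
  shows "(\<integral>x. partial i F x \<partial>lborel) = 0"
proof -
  have [measurable]: "F \<in> borel_measurable borel" using F by (rule test_function_measurable)
  obtain R where R: "\<And>x. x \<in> closure {x. F x \<noteq> 0} \<Longrightarrow> norm x \<le> R"
    using compact_imp_bounded[OF test_functionsD(2)[OF F]] bounded_iff by metis
  then have outside: "F x = 0" if "norm x > R" for x
    using that R[of x] closure_subset[of "{x. F x \<noteq> 0}"] by force
  \<comment> \<open>Difference quotients with step at most \<open>1\<close> are supported in the ball of radius \<open>R + 1\<close>, and the mean value theorem evaluates the derivative at a point that is at most \<open>1\<close> further out.\<close>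
  have "compact (cball (0::'a) (R + 2))" by simp
  moreover have "continuous_on (cball 0 (R + 2)) (partial i F)"
    using test_function_continuous[OF test_function_partial[OF F i]] by (rule continuous_on_subset) simp
  ultimately have "bounded (partial i F ` cball 0 (R + 2))"
    by (intro compact_imp_bounded compact_continuous_image)
  then obtain B where B: "\<And>x. x \<in> cball 0 (R + 2) \<Longrightarrow> norm (partial i F x) \<le> B"
    unfolding bounded_iff by blast
  define h :: "nat \<Rightarrow> real" where "h n = inverse (real (Suc n))" for n
  have h: "0 < h n" "h n \<le> 1" for n by (auto simp: h_def field_simps)
  define q where "q n x = (F (h n *\<^sub>R i + x) - F x) / h n" for n x
  have line: "((\<lambda>t. F (t *\<^sub>R i + x)) has_real_derivative partial i F (t *\<^sub>R i + x)) (at t)" for t x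
  proof -
    have "((\<lambda>t. t *\<^sub>R i + x) has_derivative (\<lambda>s. s *\<^sub>R i)) (at t)"
      by (auto intro!: derivative_eq_intros)
    note d = has_derivative_compose[OF this test_function_has_derivative[OF F]]
    have "linear (frechet_derivative F (at (t *\<^sub>R i + x)))"
      using test_function_has_derivative[OF F] by (rule has_derivative_linear)
    then show ?thesis using d by (simp add: has_field_derivative_def linear_scale mult.commute[of _ "partial i F _"])
  qed
  have "(\<lambda>n. \<integral>x. q n x \<partial>lborel) \<longlonglongrightarrow> (\<integral>x. partial i F x \<partial>lborel)"
  proof (rule integral_dominated_convergence[where w = "\<lambda>x. indicator (cball 0 (R + 1)) x * B"])
    show "partial i F \<in> borel_measurable lborel"
      using test_function_measurable[OF test_function_partial[OF F i]] by simp
    show "q n \<in> borel_measurable lborel" for n unfolding q_def by measurable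
    show "integrable lborel (\<lambda>x. indicator (cball (0::'a) (R + 1)) x * B)"
      using borel_integrable_compact[of "cball (0::'a) (R + 1)" "\<lambda>x. B"] by simp
    show "AE x in lborel. (\<lambda>n. q n x) \<longlonglongrightarrow> partial i F x"
    proof (rule AE_I2)
      fix x
      have "((\<lambda>s. (F ((0 + s) *\<^sub>R i + x) - F (0 *\<^sub>R i + x)) / s) \<longlongrightarrow> partial i F (0 *\<^sub>R i + x)) (at 0)"
        using line[of x 0] unfolding DERIV_def .
      moreover have "filterlim h (at 0) sequentially"
        using LIMSEQ_inverse_real_of_nat h(1) by (auto simp: filterlim_at h_def[abs_def])
      ultimately have "(\<lambda>n. (F ((0 + h n) *\<^sub>R i + x) - F (0 *\<^sub>R i + x)) / h n) \<longlonglongrightarrow> partial i F (0 *\<^sub>R i + x)"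
        by (rule filterlim_compose)
      then show "(\<lambda>n. q n x) \<longlonglongrightarrow> partial i F x" by (simp add: q_def)
    qed
    fix n
    show "AE x in lborel. norm (q n x) \<le> indicator (cball 0 (R + 1)) x * B"
    proof (rule AE_I2)
      fix x :: 'a
      have step: "norm (t *\<^sub>R i + x) \<le> norm x + 1" "norm x - 1 \<le> norm (t *\<^sub>R i + x)"
        if "0 \<le> t" "t \<le> 1" for t :: real
        using norm_triangle_ineq[of "t *\<^sub>R i" x] norm_triangle_ineq2[of x "- (t *\<^sub>R i)"] that i
        by (auto simp: add.commute)
      show "norm (q n x) \<le> indicator (cball 0 (R + 1)) x * B"
      proof (cases "x \<in> cball 0 (R + 1)")
        case True
        obtain z where z: "0 < z" "z < h n"
          "F (h n *\<^sub>R i + x) - F (0 *\<^sub>R i + x) = (h n - 0) * partial i F (z *\<^sub>R i + x)"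
          using MVT2[OF h(1)[of n], of "\<lambda>t. F (t *\<^sub>R i + x)" "\<lambda>t. partial i F (t *\<^sub>R i + x)"] line by blast
        then have "q n x = partial i F (z *\<^sub>R i + x)" using h(1)[of n] by (simp add: q_def field_simps)
        moreover have "z *\<^sub>R i + x \<in> cball 0 (R + 2)"
          using step(1)[of z] z h(2)[of n] True by simp
        ultimately show ?thesis using B[of "z *\<^sub>R i + x"] True by simp
      next
        case False
        then show ?thesis using step(2)[of "h n"] h[of n] outside by (simp add: q_def)
      qed
    qed
  qed
  moreover have "(\<integral>x. q n x \<partial>lborel) = 0" for n
  proof -
    have int: "integrable lborel F" using F by (rule test_function_integrable)
    have int': "integrable lborel (\<lambda>x. F (h n *\<^sub>R i + x))"
      using int lborel_distr_plus[of "h n *\<^sub>R i"] integrable_distr_eq[of "(+) (h n *\<^sub>R i)" lborel borel F]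
      by simp
    have "(\<integral>x. F (h n *\<^sub>R i + x) \<partial>lborel) = (\<integral>x. F x \<partial>distr lborel borel ((+) (h n *\<^sub>R i)))"
      by (subst integral_distr) auto
    then have "(\<integral>x. F (h n *\<^sub>R i + x) \<partial>lborel) = (\<integral>x. F x \<partial>lborel)"
      by (simp add: lborel_distr_plus)
    then show ?thesis unfolding q_def using int int' by simp
  qed
  ultimately show ?thesis by (simp add: LIMSEQ_const_iff)
qed

definition nabla :: "('a::euclidean_space \<Rightarrow> real) \<Rightarrow> 'a \<Rightarrow> 'a" where
  "nabla \<phi> x = (\<Sum>i\<in>Basis. partial i \<phi> x *\<^sub>R i)"

lemma nabla_inner_Basis: "i \<in> Basis \<Longrightarrow> nabla \<phi> x \<bullet> i = partial i \<phi> x"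
  by (simp add: nabla_def)

lemma nabla_L2:
  assumes "open \<Omega>" "\<phi> \<in> test_functions \<Omega>"
  shows "nabla \<phi> \<in> L2 (vol \<Omega>)"
  unfolding nabla_def using assms
  by (intro L2_sum L2_scaleR_vector test_function_L2 test_function_partial)

text \<open>
  The classical gradient is a weak gradient: apply \<open>integral_partial_eq_0\<close> to the product of two test
  functions.
\<close>

lemma weak_gradient_test_function:
  assumes \<Omega>: "open \<Omega>" and \<psi>: "\<psi> \<in> test_functions \<Omega>"
  shows "weak_gradient \<Omega> \<psi> (nabla \<psi>)"
  unfolding weak_gradient_def
proof (intro conjI ballI)
  show "nabla \<psi> \<in> L2 (vol \<Omega>)" by (rule nabla_L2[OF assms])
  fix \<phi> and i :: 'a assume \<phi>: "\<phi> \<in> test_functions \<Omega>" and i: "i \<in> Basis"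
  have "partial i (\<lambda>x. \<psi> x * \<phi> x) x = \<psi> x * partial i \<phi> x + partial i \<psi> x * \<phi> x" for x
    using fun_cong[OF frechet_derivative_at[OF has_derivative_mult[OF test_function_has_derivative[OF \<psi>]
          test_function_has_derivative[OF \<phi>]]], of x i] by simp
  then have "(\<integral>x. \<psi> x * partial i \<phi> x + partial i \<psi> x * \<phi> x \<partial>lborel) = 0"
    using integral_partial_eq_0[OF test_function_mult[OF \<psi> \<phi>] i] by simp
  moreover have "integrable lborel (\<lambda>x. \<psi> x * partial i \<phi> x)" "integrable lborel (\<lambda>x. partial i \<psi> x * \<phi> x)"
    by (intro test_function_integrable[where \<Omega> = \<Omega>] test_function_mult test_function_partial \<phi> \<psi> i)+
  ultimately have "(\<integral>x. \<psi> x * partial i \<phi> x \<partial>lborel) = - (\<integral>x. partial i \<psi> x * \<phi> x \<partial>lborel)"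
    by simp
  then show "(\<integral>x. \<psi> x * frechet_derivative \<phi> (at x) i \<partial>vol \<Omega>) = - (\<integral>x. (nabla \<psi> x \<bullet> i) * \<phi> x \<partial>vol \<Omega>)"
    using test_function_outside[OF \<phi>] test_function_outside[OF \<psi>]
    by (simp add: nabla_inner_Basis[OF i] integral_vol_eq_lborel[OF \<Omega>])
qed

section \<open>Weak gradients and Sobolev spaces on bounded open sets\<close>

lemma weak_gradient_iff:
  "weak_gradient \<Omega> u G \<longleftrightarrow> G \<in> L2 (vol \<Omega>) \<and> (\<forall>\<phi>\<in>test_functions \<Omega>. \<forall>i\<in>Basis.
     L2_ip (vol \<Omega>) u (partial i \<phi>) = - L2_ip (vol \<Omega>) (\<lambda>x. G x \<bullet> i) \<phi>)"
  by (simp add: weak_gradient_def L2_ip_def)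

lemma weak_gradient_L2: "weak_gradient \<Omega> u G \<Longrightarrow> G \<in> L2 (vol \<Omega>)"
  by (simp add: weak_gradient_iff)

text \<open>
  Boundedness gives finite measure, so square-integrable functions are integrable and the fundamental
  lemma applies to them.
\<close>

locale bounded_open =
  fixes \<Omega> :: "'a::euclidean_space set"
  assumes open_\<Omega>: "open \<Omega>" and bounded_\<Omega>: "bounded \<Omega>"
begin

sublocale L2: function_ip_space "L2 (vol \<Omega>) :: ('a \<Rightarrow> real) set" "L2_ip (vol \<Omega>)"
  by (rule function_ip_space_L2)

lemma finite_measure_vol: "finite_measure (vol \<Omega>)"
proof
  have "emeasure lborel \<Omega> < \<infinity>" using bounded_\<Omega> by (rule emeasure_bounded_finite)
  then show "emeasure (vol \<Omega>) (space (vol \<Omega>)) \<noteq> \<infinity>"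
    using open_\<Omega> by (simp add: emeasure_restrict_space space_restrict_space)
qed

lemma L2_imp_integrable: "f \<in> L2 (vol \<Omega>) \<Longrightarrow> integrable (vol \<Omega>) (f :: 'a \<Rightarrow> real)"
  using finite_measure.square_integrable_imp_integrable[OF finite_measure_vol, of f]
    L2_integrable_norm[of f "vol \<Omega>"] L2_measurable[of f "vol \<Omega>"] by simp

lemmas test_function_in_L2 = test_function_L2[OF open_\<Omega>]

lemma weak_gradient_unique:
  assumes u: "u \<in> L2 (vol \<Omega>)" "v \<in> L2 (vol \<Omega>)" and G: "weak_gradient \<Omega> u G" "weak_gradient \<Omega> v H"
    and uv: "AE x in vol \<Omega>. u x = v x"
  shows "AE x in vol \<Omega>. G x = H x"
proof -
  have GH: "G \<in> L2 (vol \<Omega>)" "H \<in> L2 (vol \<Omega>)" using G by (auto dest: weak_gradient_L2)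
  have "AE x in vol \<Omega>. G x \<bullet> i = H x \<bullet> i" if i: "i \<in> Basis" for i
  proof -
    have d: "(\<lambda>x. G x \<bullet> i - H x \<bullet> i) \<in> L2 (vol \<Omega>)" by (intro L2_diff L2_component GH)
    have "AE x in vol \<Omega>. G x \<bullet> i - H x \<bullet> i = 0"
    proof (rule fundamental_lemma[OF open_\<Omega> L2_imp_integrable[OF d]])
      fix \<phi> assume \<phi>: "\<phi> \<in> test_functions \<Omega>"
      have p: "partial i \<phi> \<in> L2 (vol \<Omega>)" by (intro test_function_in_L2 test_function_partial \<phi> i)
      have "L2_ip (vol \<Omega>) u (partial i \<phi>) = L2_ip (vol \<Omega>) v (partial i \<phi>)"
        by (rule L2_ip_cong_AE[OF u p p uv]) simp
      then have "L2_ip (vol \<Omega>) (\<lambda>x. G x \<bullet> i) \<phi> = L2_ip (vol \<Omega>) (\<lambda>x. H x \<bullet> i) \<phi>"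
        using G \<phi> i by (simp add: weak_gradient_iff)
      then have "L2_ip (vol \<Omega>) (\<lambda>x. G x \<bullet> i - H x \<bullet> i) \<phi> = 0"
        by (simp add: L2.ip_diff L2_component GH test_function_in_L2 \<phi>)
      then show "(\<integral>x. (G x \<bullet> i - H x \<bullet> i) * \<phi> x \<partial>vol \<Omega>) = 0" by (simp add: L2_ip_def)
    qed
    then show ?thesis by simp
  qed
  then have "AE x in vol \<Omega>. \<forall>i\<in>Basis. G x \<bullet> i = H x \<bullet> i"
    by (simp add: AE_finite_all)
  then show ?thesis by eventually_elim (simp add: euclidean_eq_iff[where 'a = 'a])
qed

lemma weak_gradient_lincomb:
  assumes uv: "u \<in> L2 (vol \<Omega>)" "v \<in> L2 (vol \<Omega>)" and GH: "weak_gradient \<Omega> u G" "weak_gradient \<Omega> v H"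
  shows "weak_gradient \<Omega> (\<lambda>x. a * u x + b * v x) (\<lambda>x. a *\<^sub>R G x + b *\<^sub>R H x)"
  unfolding weak_gradient_iff
proof (intro conjI ballI)
  have L: "G \<in> L2 (vol \<Omega>)" "H \<in> L2 (vol \<Omega>)" using GH by (auto dest: weak_gradient_L2)
  then show "(\<lambda>x. a *\<^sub>R G x + b *\<^sub>R H x) \<in> L2 (vol \<Omega>)" by (rule L2_lincomb)
  fix \<phi> and i :: 'a assume \<phi>: "\<phi> \<in> test_functions \<Omega>" and i: "i \<in> Basis"
  then show "L2_ip (vol \<Omega>) (\<lambda>x. a * u x + b * v x) (partial i \<phi>)
      = - L2_ip (vol \<Omega>) (\<lambda>x. (a *\<^sub>R G x + b *\<^sub>R H x) \<bullet> i) \<phi>"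
    using GH uv L by (simp add: inner_add_left L2.linear test_function_in_L2 test_function_partial L2_component
        weak_gradient_iff)
qed

text \<open>
  The defining identity of a weak gradient is continuous in the function and in the gradient
  separately, each with respect to the \<open>L2\<close> norm; this closedness makes \<open>H1\<close> complete.
\<close>

lemma weak_gradient_limit:
  assumes u: "\<And>n::nat. u n \<in> L2 (vol \<Omega>)" "v \<in> L2 (vol \<Omega>)" "H \<in> L2 (vol \<Omega>)"
    and wg: "\<And>n. weak_gradient \<Omega> (u n) (G n)"
    and lim: "(\<lambda>n. L2_ip (vol \<Omega>) (\<lambda>x. u n x - v x) (\<lambda>x. u n x - v x)) \<longlonglongrightarrow> 0"
      "(\<lambda>n. L2_ip (vol \<Omega>) (\<lambda>x. G n x - H x) (\<lambda>x. G n x - H x)) \<longlonglongrightarrow> 0"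
  shows "weak_gradient \<Omega> v H"
  unfolding weak_gradient_iff
proof (intro conjI ballI)
  have G: "G n \<in> L2 (vol \<Omega>)" for n using wg by (rule weak_gradient_L2)
  fix \<phi> and i :: 'a assume \<phi>: "\<phi> \<in> test_functions \<Omega>" and i: "i \<in> Basis"
  have "(\<lambda>n. L2_ip (vol \<Omega>) (u n) (partial i \<phi>)) \<longlonglongrightarrow> L2_ip (vol \<Omega>) v (partial i \<phi>)"
    by (intro L2_ip_tendsto u lim test_function_in_L2 test_function_partial \<phi> i)
  moreover have "(\<lambda>n. L2_ip (vol \<Omega>) (\<lambda>x. G n x \<bullet> i) \<phi>) \<longlonglongrightarrow> L2_ip (vol \<Omega>) (\<lambda>x. H x \<bullet> i) \<phi>"
  proof (intro L2_ip_tendsto L2_component G u test_function_in_L2 \<phi>)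
    have "L2_ip (vol \<Omega>) (\<lambda>x. G n x \<bullet> i - H x \<bullet> i) (\<lambda>x. G n x \<bullet> i - H x \<bullet> i)
        \<le> L2_ip (vol \<Omega>) (\<lambda>x. G n x - H x) (\<lambda>x. G n x - H x)" for n
      using L2_ip_component_le[OF L2_diff[OF G u(3)] i, of n] by (simp add: inner_diff_left)
    then show "(\<lambda>n. L2_ip (vol \<Omega>) (\<lambda>x. G n x \<bullet> i - H x \<bullet> i) (\<lambda>x. G n x \<bullet> i - H x \<bullet> i)) \<longlonglongrightarrow> 0"
      by (intro tendsto_sandwich[OF always_eventually always_eventually tendsto_const lim(2)])
        (auto simp: L2_ip_nonneg)
  qed
  then have "(\<lambda>n. L2_ip (vol \<Omega>) (u n) (partial i \<phi>)) \<longlonglongrightarrow> - L2_ip (vol \<Omega>) (\<lambda>x. H x \<bullet> i) \<phi>"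
    using wg \<phi> i by (simp add: weak_gradient_iff tendsto_minus)
  ultimately show "L2_ip (vol \<Omega>) v (partial i \<phi>) = - L2_ip (vol \<Omega>) (\<lambda>x. H x \<bullet> i) \<phi>"
    by (rule LIMSEQ_unique)
qed (rule u)

lemma H1I: "u \<in> L2 (vol \<Omega>) \<Longrightarrow> weak_gradient \<Omega> u G \<Longrightarrow> u \<in> H1 \<Omega>"
  by (auto simp: H1_def)

lemma H1_L2: "u \<in> H1 \<Omega> \<Longrightarrow> u \<in> L2 (vol \<Omega>)"
  by (simp add: H1_def)

lemma grad_weak: "u \<in> H1 \<Omega> \<Longrightarrow> weak_gradient \<Omega> u (grad \<Omega> u)"
  unfolding H1_def grad_def by (auto intro: someI[of "weak_gradient \<Omega> u"])

lemma grad_L2: "u \<in> H1 \<Omega> \<Longrightarrow> grad \<Omega> u \<in> L2 (vol \<Omega>)"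
  by (rule weak_gradient_L2[OF grad_weak])

lemma grad_AE_eq:
  assumes "u \<in> L2 (vol \<Omega>)" "weak_gradient \<Omega> u G"
  shows "AE x in vol \<Omega>. grad \<Omega> u x = G x"
  by (rule weak_gradient_unique[OF assms(1,1) grad_weak[OF H1I[OF assms]] assms(2)]) simp

text \<open>
  \<open>grad\<close> is a choice among almost everywhere equal weak gradients. This lemma allows the gradient inner
  product to be computed with any explicitly known ones.
\<close>

lemma grad_ip_eq:
  assumes "u \<in> L2 (vol \<Omega>)" "v \<in> L2 (vol \<Omega>)" "weak_gradient \<Omega> u G" "weak_gradient \<Omega> v H"
  shows "grad_ip \<Omega> u v = L2_ip (vol \<Omega>) G H"
  unfolding grad_ip_def using assms
  by (intro L2_ip_cong_AE grad_AE_eq grad_L2 weak_gradient_L2[of \<Omega>]) (auto intro: H1I)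

lemma H1_lincomb:
  assumes "u \<in> H1 \<Omega>" "v \<in> H1 \<Omega>"
  shows "(\<lambda>x. a * u x + b * v x) \<in> H1 \<Omega>"
  using assms[THEN H1_L2] assms[THEN grad_weak] by (intro H1I[OF L2.lincomb weak_gradient_lincomb])

lemma H1_zero: "(\<lambda>x. 0) \<in> H1 \<Omega>"
  by (rule H1I[where G = "\<lambda>x. 0"]) (simp_all add: L2_zero weak_gradient_def)

sublocale grad: function_ip_space "H1 \<Omega>" "grad_ip \<Omega>"
proof
  fix u v w :: "'a \<Rightarrow> real" and a b :: real
  assume uv: "u \<in> H1 \<Omega>" "v \<in> H1 \<Omega>"
  then show "(\<lambda>x. a * u x + b * v x) \<in> H1 \<Omega>" by (rule H1_lincomb)
  assume w: "w \<in> H1 \<Omega>"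
  have "grad_ip \<Omega> (\<lambda>x. a * u x + b * v x) w
      = L2_ip (vol \<Omega>) (\<lambda>x. a *\<^sub>R grad \<Omega> u x + b *\<^sub>R grad \<Omega> v x) (grad \<Omega> w)"
    using uv w by (intro grad_ip_eq weak_gradient_lincomb grad_weak H1_L2 H1_lincomb)
  then show "grad_ip \<Omega> (\<lambda>x. a * u x + b * v x) w = a * grad_ip \<Omega> u w + b * grad_ip \<Omega> v w"
    using uv w by (simp add: L2_ip_linear grad_L2 grad_ip_def)
qed (auto simp: H1_zero grad_ip_def L2_ip_commute L2_ip_nonneg)

sublocale H1: function_ip_space "H1 \<Omega>" "H1_ip \<Omega>"
proof
  fix u v w :: "'a \<Rightarrow> real" and a b :: real
  assume uv: "u \<in> H1 \<Omega>" "v \<in> H1 \<Omega>"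
  then show "(\<lambda>x. a * u x + b * v x) \<in> H1 \<Omega>" by (rule H1_lincomb)
  show "H1_ip \<Omega> u v = H1_ip \<Omega> v u" by (simp add: H1_ip_def grad_ip_def L2_ip_commute)
  assume "w \<in> H1 \<Omega>"
  with uv show "H1_ip \<Omega> (\<lambda>x. a * u x + b * v x) w = a * H1_ip \<Omega> u w + b * H1_ip \<Omega> v w"
    by (simp add: H1_ip_def L2.linear grad.linear H1_L2 algebra_simps)
qed (auto simp: H1_zero H1_ip_def L2_ip_nonneg grad_ip_def)

lemma grad_ip_diff_self:
  assumes "u \<in> H1 \<Omega>" "v \<in> H1 \<Omega>"
  shows "grad_ip \<Omega> (\<lambda>x. u x - v x) (\<lambda>x. u x - v x)
       = L2_ip (vol \<Omega>) (\<lambda>x. grad \<Omega> u x - grad \<Omega> v x) (\<lambda>x. grad \<Omega> u x - grad \<Omega> v x)"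
proof -
  have "weak_gradient \<Omega> (\<lambda>x. u x - v x) (\<lambda>x. grad \<Omega> u x - grad \<Omega> v x)"
    using weak_gradient_lincomb[OF H1_L2 H1_L2 grad_weak grad_weak, OF assms assms, of 1 "-1"] by simp
  then show ?thesis using assms by (intro grad_ip_eq L2.diff_mem H1_L2)
qed

lemma L2_le_H1: "L2_ip (vol \<Omega>) u u \<le> H1_ip \<Omega> u u"
  by (simp add: H1_ip_def grad_ip_def L2_ip_nonneg)

lemma grad_ip_nonneg: "0 \<le> grad_ip \<Omega> u u"
  by (simp add: grad_ip_def L2_ip_nonneg)

lemma grad_le_H1: "grad_ip \<Omega> u u \<le> H1_ip \<Omega> u u"
  by (simp add: H1_ip_def L2_ip_nonneg)

lemma H1_norm_tendsto_iff:
  assumes "\<And>n::nat. u n \<in> H1 \<Omega>" "v \<in> H1 \<Omega>"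
  shows "(\<lambda>n. ip_norm (H1_ip \<Omega>) (\<lambda>x. u n x - v x)) \<longlonglongrightarrow> 0 \<longleftrightarrow>
    (\<lambda>n. ip_norm (L2_ip (vol \<Omega>)) (\<lambda>x. u n x - v x)) \<longlonglongrightarrow> 0 \<and>
    (\<lambda>n. ip_norm (grad_ip \<Omega>) (\<lambda>x. u n x - v x)) \<longlonglongrightarrow> 0"
proof (intro iffI conjI; (elim conjE)?)
  assume a: "(\<lambda>n. ip_norm (H1_ip \<Omega>) (\<lambda>x. u n x - v x)) \<longlonglongrightarrow> 0"
  show "(\<lambda>n. ip_norm (L2_ip (vol \<Omega>)) (\<lambda>x. u n x - v x)) \<longlonglongrightarrow> 0"
    by (rule tendsto_sandwich[OF always_eventually always_eventually tendsto_const a])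
      (auto simp: ip_norm_def L2_le_H1 L2_ip_nonneg)
  show "(\<lambda>n. ip_norm (grad_ip \<Omega>) (\<lambda>x. u n x - v x)) \<longlonglongrightarrow> 0"
    by (rule tendsto_sandwich[OF always_eventually always_eventually tendsto_const a])
      (auto simp: ip_norm_def grad_le_H1 grad_ip_nonneg)
next
  assume a: "(\<lambda>n. ip_norm (L2_ip (vol \<Omega>)) (\<lambda>x. u n x - v x)) \<longlonglongrightarrow> 0"
    "(\<lambda>n. ip_norm (grad_ip \<Omega>) (\<lambda>x. u n x - v x)) \<longlonglongrightarrow> 0"
  have "(\<lambda>n. sqrt ((ip_norm (L2_ip (vol \<Omega>)) (\<lambda>x. u n x - v x))\<^sup>2 + (ip_norm (grad_ip \<Omega>) (\<lambda>x. u n x - v x))\<^sup>2))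
      \<longlonglongrightarrow> sqrt (0\<^sup>2 + 0\<^sup>2)"
    by (intro tendsto_intros a)
  moreover have "ip_norm (H1_ip \<Omega>) (\<lambda>x. u n x - v x) =
      sqrt ((ip_norm (L2_ip (vol \<Omega>)) (\<lambda>x. u n x - v x))\<^sup>2 + (ip_norm (grad_ip \<Omega>) (\<lambda>x. u n x - v x))\<^sup>2)" for n
    using L2.norm_sq[OF H1_L2[OF H1.diff_mem[OF assms]]] grad.norm_sq[OF H1.diff_mem[OF assms]]
    by (simp add: ip_norm_def[of "H1_ip \<Omega>"] H1_ip_def)
  ultimately show "(\<lambda>n. ip_norm (H1_ip \<Omega>) (\<lambda>x. u n x - v x)) \<longlonglongrightarrow> 0" by simp
qed

text \<open>
  Functions and gradients converge separately in \<open>L2\<close>, and the limits match by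
  \<open>weak_gradient_limit\<close>.
\<close>

lemma H1_complete:
  assumes u: "\<And>n::nat. u n \<in> H1 \<Omega>"
    and Cauchy: "\<And>\<epsilon>. \<epsilon> > 0 \<Longrightarrow> \<exists>K. \<forall>m\<ge>K. \<forall>n\<ge>K. ip_norm (H1_ip \<Omega>) (\<lambda>x. u m x - u n x) < \<epsilon>"
  obtains v where "v \<in> H1 \<Omega>" "(\<lambda>n. ip_norm (H1_ip \<Omega>) (\<lambda>x. u n x - v x)) \<longlonglongrightarrow> 0"
proof -
  have C: "\<exists>K. \<forall>m\<ge>K. \<forall>n\<ge>K. H1_ip \<Omega> (\<lambda>x. u m x - u n x) (\<lambda>x. u m x - u n x) < \<epsilon>" if "\<epsilon> > 0" for \<epsilon>
    using Cauchy[of "sqrt \<epsilon>"] that by (simp add: ip_norm_def)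
  have "\<exists>K. \<forall>m\<ge>K. \<forall>n\<ge>K. L2_ip (vol \<Omega>) (\<lambda>x. u m x - u n x) (\<lambda>x. u m x - u n x) < \<epsilon>" if "\<epsilon> > 0" for \<epsilon>
    using C[OF that] L2_le_H1 by (meson le_less_trans)
  from L2_complete[OF H1_L2[OF u] this]
  obtain v where v: "v \<in> L2 (vol \<Omega>)"
    "(\<lambda>n. L2_ip (vol \<Omega>) (\<lambda>x. u n x - v x) (\<lambda>x. u n x - v x)) \<longlonglongrightarrow> 0" by blast
  have "\<exists>K. \<forall>m\<ge>K. \<forall>n\<ge>K. L2_ip (vol \<Omega>) (\<lambda>x. grad \<Omega> (u m) x - grad \<Omega> (u n) x)
      (\<lambda>x. grad \<Omega> (u m) x - grad \<Omega> (u n) x) < \<epsilon>" if "\<epsilon> > 0" for \<epsilon>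
    unfolding grad_ip_diff_self[OF u u, symmetric] using C[OF that] grad_le_H1 by (meson le_less_trans)
  from L2_complete[OF grad_L2[OF u] this]
  obtain G where G: "G \<in> L2 (vol \<Omega>)"
    "(\<lambda>n. L2_ip (vol \<Omega>) (\<lambda>x. grad \<Omega> (u n) x - G x) (\<lambda>x. grad \<Omega> (u n) x - G x)) \<longlonglongrightarrow> 0" by blast
  have wg: "weak_gradient \<Omega> v G"
    by (rule weak_gradient_limit[OF H1_L2[OF u] v(1) G(1) grad_weak[OF u] v(2) G(2)])
  then have vH: "v \<in> H1 \<Omega>" using v(1) by (intro H1I)
  have "L2_ip (vol \<Omega>) (\<lambda>x. grad \<Omega> (u n) x - G x) (\<lambda>x. grad \<Omega> (u n) x - G x)
      = grad_ip \<Omega> (\<lambda>x. u n x - v x) (\<lambda>x. u n x - v x)" for n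
  proof -
    have "AE x in vol \<Omega>. grad \<Omega> (u n) x - G x = grad \<Omega> (u n) x - grad \<Omega> v x"
      using grad_AE_eq[OF v(1) wg] by eventually_elim simp
    then show ?thesis unfolding grad_ip_diff_self[OF u vH]
      by (intro L2_ip_cong_AE L2_diff grad_L2 u vH G)
  qed
  then have "(\<lambda>n. ip_norm (grad_ip \<Omega>) (\<lambda>x. u n x - v x)) \<longlonglongrightarrow> 0"
    using tendsto_real_sqrt[OF G(2)] by (simp add: ip_norm_def)
  moreover have "(\<lambda>n. ip_norm (L2_ip (vol \<Omega>)) (\<lambda>x. u n x - v x)) \<longlonglongrightarrow> 0"
    using tendsto_real_sqrt[OF v(2)] by (simp add: ip_norm_def)
  ultimately show ?thesis using that[OF vH] H1_norm_tendsto_iff[of u v, OF u vH] by simp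
qed

lemma H1_closure_eq: "H1_closure \<Omega> V = H1.closure_in V"
  by (simp add: H1_closure_def H1.closure_in_def)

lemma test_functions_subset_H1: "test_functions \<Omega> \<subseteq> H1 \<Omega>"
  using H1I test_function_in_L2 weak_gradient_test_function[OF open_\<Omega>] by blast

lemma H01_subset_H1: "H01 \<Omega> \<subseteq> H1 \<Omega>"
  by (auto simp: H01_def H1_closure_def)

lemma H01_H1: "u \<in> H01 \<Omega> \<Longrightarrow> u \<in> H1 \<Omega>"
  using H01_subset_H1 by blast

lemma H01_L2: "u \<in> H01 \<Omega> \<Longrightarrow> u \<in> L2 (vol \<Omega>)"
  using H01_H1 H1_L2 by blast

lemma H01_test: "\<phi> \<in> test_functions \<Omega> \<Longrightarrow> \<phi> \<in> H01 \<Omega>"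
  using H1.subset_closure_in[OF test_functions_subset_H1] by (auto simp: H01_def H1_closure_eq)

lemma H01_lincomb:
  assumes "u \<in> H01 \<Omega>" "v \<in> H01 \<Omega>"
  shows "(\<lambda>x. a * u x + b * v x) \<in> H01 \<Omega>"
  using assms unfolding H01_def H1_closure_eq
  by (intro H1.closure_in_lincomb test_functions_subset_H1 test_function_lincomb)

lemma H01_limit:
  assumes "v \<in> H1 \<Omega>" "\<And>n::nat. u n \<in> H01 \<Omega>" "(\<lambda>n. ip_norm (H1_ip \<Omega>) (\<lambda>x. u n x - v x)) \<longlonglongrightarrow> 0"
  shows "v \<in> H01 \<Omega>"
  using H1.closure_in_limit[OF test_functions_subset_H1 assms(1) _ assms(3)] assms(2)
  by (simp add: H01_def H1_closure_eq)

lemma H01_sequence: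
  assumes "u \<in> H01 \<Omega>"
  obtains \<phi> where "\<And>n::nat. \<phi> n \<in> test_functions \<Omega>" "(\<lambda>n. ip_norm (H1_ip \<Omega>) (\<lambda>x. \<phi> n x - u x)) \<longlonglongrightarrow> 0"
  using H1.closure_in_sequence[OF assms[unfolded H01_def H1_closure_eq] test_functions_subset_H1] by metis

sublocale H01: function_ip_space "H01 \<Omega>" "grad_ip \<Omega>"
  by (rule grad.subspace_function_ip_space[OF H01_subset_H1 H01_test[OF test_function_zero] H01_lincomb])

end

section \<open>Consequences of a complete sequence of Dirichlet eigenfunctions\<close>

locale dirichlet_system = bounded_open +
  fixes \<mu> :: "nat \<Rightarrow> real" and e :: "nat \<Rightarrow> 'a \<Rightarrow> real"
  assumes eigensequence: "dirichlet_eigensequence \<Omega> \<mu> e"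
begin

lemma eigenvalue_pos: "0 < \<mu> j"
  and e_basis: "orthonormal_basis (L2 (vol \<Omega>)) (L2_ip (vol \<Omega>)) e"
  and e_eigenpair: "dirichlet_eigenpair \<Omega> (\<mu> j) (e j)"
  and \<mu>_at_top: "filterlim \<mu> at_top sequentially"
  using eigensequence by (auto simp: dirichlet_eigensequence_def)

lemma e_H01: "e j \<in> H01 \<Omega>"
  using e_eigenpair by (auto simp: dirichlet_eigenpair_def)

lemma e_L2: "e j \<in> L2 (vol \<Omega>)"
  by (rule H01_L2[OF e_H01])

lemma e_equation: "h \<in> H01 \<Omega> \<Longrightarrow> grad_ip \<Omega> (e j) h = \<mu> j * L2_ip (vol \<Omega>) (e j) h"
  using e_eigenpair[of j] by (auto simp: dirichlet_eigenpair_def)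

lemma e_orthonormal: "L2.orthonormal e"
  using e_basis e_L2 by (auto simp: L2.orthonormal_def orthonormal_basis_def)

lemma eigenvalue_lower_bound: obtains m where "m > 0" "\<And>j. m \<le> \<mu> j"
proof -
  have "\<forall>\<^sub>F j in sequentially. 1 \<le> \<mu> j"
    using \<mu>_at_top by (simp add: filterlim_at_top)
  then obtain N where N: "\<And>j. j \<ge> N \<Longrightarrow> 1 \<le> \<mu> j" by (auto simp: eventually_sequentially)
  show ?thesis
  proof
    show "Min (insert 1 (\<mu> ` {..<N})) > 0" using eigenvalue_pos by simp
    show "Min (insert 1 (\<mu> ` {..<N})) \<le> \<mu> j" for j
    proof (cases "j < N")
      case False
      have "Min (insert 1 (\<mu> ` {..<N})) \<le> 1" by (intro Min_le) auto
      then show ?thesis using N[of j] False by linarith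
    qed (auto intro: Min_le)
  qed
qed

abbreviation p where "p \<equiv> H01_normalised \<mu> e"

lemma p_H01: "p j \<in> H01 \<Omega>"
  unfolding H01_normalised_def by (rule H01.scale_mem[OF e_H01])

lemma normalising_factor: "\<mu> j * (\<mu> j powr (- 1 / 2))\<^sup>2 = 1"
proof -
  have "(\<mu> j powr (- 1 / 2))\<^sup>2 = \<mu> j powr (- 1)"
    unfolding power2_eq_square by (subst powr_add[symmetric]) simp
  then show ?thesis using eigenvalue_pos[of j] by (simp add: powr_minus)
qed

lemma grad_ip_p:
  assumes "u \<in> H01 \<Omega>"
  shows "grad_ip \<Omega> u (p j) = \<mu> j powr (- 1 / 2) * (\<mu> j * L2_ip (vol \<Omega>) u (e j))"
proof -
  have "grad_ip \<Omega> u (p j) = grad_ip \<Omega> (p j) u" by (intro H01.sym assms p_H01)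
  also have "\<dots> = \<mu> j powr (- 1 / 2) * grad_ip \<Omega> (e j) u"
    unfolding H01_normalised_def by (rule H01.ip_scale[OF e_H01 assms])
  finally show ?thesis by (simp add: e_equation[OF assms] L2_ip_commute)
qed

text \<open>
  The Fourier coefficients in \<open>H01\<close> and in \<open>L2\<close> determine each other, which is how totality and
  inequalities are transferred between the two spaces.
\<close>

lemma grad_ip_p_squared:
  assumes "u \<in> H01 \<Omega>"
  shows "(grad_ip \<Omega> u (p j))\<^sup>2 = \<mu> j * (L2_ip (vol \<Omega>) u (e j))\<^sup>2"
proof -
  have "(grad_ip \<Omega> u (p j))\<^sup>2
      = (\<mu> j * (\<mu> j powr (- 1 / 2))\<^sup>2) * (\<mu> j * (L2_ip (vol \<Omega>) u (e j))\<^sup>2)"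
    unfolding grad_ip_p[OF assms] by (simp only: power2_eq_square mult_ac)
  then show ?thesis by (simp only: normalising_factor mult_1)
qed

lemma p_orthonormal: "H01.orthonormal p"
  unfolding H01.orthonormal_def
proof (intro conjI allI)
  show "range p \<subseteq> H01 \<Omega>" using p_H01 by auto
  fix j k
  have "L2_ip (vol \<Omega>) (p j) (e k) = \<mu> j powr (- 1 / 2) * L2_ip (vol \<Omega>) (e j) (e k)"
    unfolding H01_normalised_def by (rule L2.ip_scale[OF e_L2 e_L2])
  then have "L2_ip (vol \<Omega>) (p j) (e k) = \<mu> j powr (- 1 / 2) * (if j = k then 1 else 0)"
    using e_orthonormal by (simp add: L2.orthonormal_def)
  then show "grad_ip \<Omega> (p j) (p k) = (if j = k then 1 else 0)"
    unfolding grad_ip_p[OF p_H01] using normalising_factor[of k]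
    by (auto simp: power2_eq_square mult_ac)
qed

text \<open>
  With \<open>c j\<close> the \<open>L2\<close> coefficients of \<open>u\<close>, Bessel's inequality in the gradient inner product bounds the
  sum of all \<open>\<mu> j * (c j)\<^sup>2\<close> by the squared gradient norm, while the sum of all \<open>(c j)\<^sup>2\<close> is the
  squared \<open>L2\<close> norm.
\<close>

lemma Poincare:
  assumes m: "m > 0" "\<And>j. m \<le> \<mu> j" and u: "u \<in> H01 \<Omega>"
  shows "L2_ip (vol \<Omega>) u u \<le> grad_ip \<Omega> u u / m"
proof (rule L2.Parseval_bound[OF e_orthonormal e_basis H01_L2[OF u]])
  fix n
  have "m * (\<Sum>i<n. (L2_ip (vol \<Omega>) u (e i))\<^sup>2) \<le> (\<Sum>i<n. (grad_ip \<Omega> u (p i))\<^sup>2)"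
    unfolding sum_distrib_left grad_ip_p_squared[OF u] using m(2) by (intro sum_mono mult_right_mono) auto
  also have "\<dots> \<le> grad_ip \<Omega> u u" by (rule H01.Bessel[OF p_orthonormal u])
  finally show "(\<Sum>i<n. (L2_ip (vol \<Omega>) u (e i))\<^sup>2) \<le> grad_ip \<Omega> u u / m"
    using m(1) by (simp add: field_simps)
qed

lemma H1_norm_le_grad_norm:
  obtains C where "C > 0" "\<And>u. u \<in> H01 \<Omega> \<Longrightarrow> ip_norm (H1_ip \<Omega>) u \<le> C * ip_norm (grad_ip \<Omega>) u"
proof -
  obtain m where m: "m > 0" "\<And>j. m \<le> \<mu> j" using eigenvalue_lower_bound by blast
  show ?thesis
  proof
    show "sqrt (1 + 1 / m) > 0" using m(1) by (simp add: add_pos_pos)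
    fix u assume u: "u \<in> H01 \<Omega>"
    have "H1_ip \<Omega> u u \<le> (1 + 1 / m) * grad_ip \<Omega> u u"
      using Poincare[OF m u] by (simp add: H1_ip_def field_simps)
    then show "ip_norm (H1_ip \<Omega>) u \<le> sqrt (1 + 1 / m) * ip_norm (grad_ip \<Omega>) u"
      unfolding ip_norm_def real_sqrt_mult[symmetric] by (rule real_sqrt_le_mono)
  qed
qed

lemma grad_ip_zero_iff:
  assumes "u \<in> H01 \<Omega>"
  shows "grad_ip \<Omega> u u = 0 \<longleftrightarrow> (AE x in vol \<Omega>. u x = 0)"
proof
  obtain m where m: "m > 0" "\<And>j. m \<le> \<mu> j" using eigenvalue_lower_bound by blast
  assume "grad_ip \<Omega> u u = 0"
  then have "L2_ip (vol \<Omega>) u u = 0"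
    using Poincare[OF m assms] L2_ip_nonneg[of "vol \<Omega>" u] by simp
  then show "AE x in vol \<Omega>. u x = 0" using L2_ip_self_eq_0_iff[OF H01_L2[OF assms]] by simp
next
  assume "AE x in vol \<Omega>. u x = 0"
  moreover have "weak_gradient \<Omega> (\<lambda>x. 0) (\<lambda>x. 0)" by (simp add: weak_gradient_def L2_zero)
  ultimately have "AE x in vol \<Omega>. grad \<Omega> u x = 0"
    by (intro weak_gradient_unique[of u "\<lambda>x. 0"] grad_weak H01_H1 H01_L2 assms L2_zero)
  then show "grad_ip \<Omega> u u = 0"
    unfolding grad_ip_def using L2_ip_self_eq_0_iff[OF grad_L2[OF H01_H1[OF assms]]] by simp
qed

lemma H01_complete:
  assumes u: "\<And>n::nat. u n \<in> H01 \<Omega>"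
    and Cauchy: "\<And>\<epsilon>. \<epsilon> > 0 \<Longrightarrow> \<exists>K. \<forall>m\<ge>K. \<forall>n\<ge>K. ip_norm (grad_ip \<Omega>) (\<lambda>x. u m x - u n x) < \<epsilon>"
  shows "\<exists>v\<in>H01 \<Omega>. (\<lambda>n. ip_norm (grad_ip \<Omega>) (\<lambda>x. u n x - v x)) \<longlonglongrightarrow> 0"
proof -
  obtain C where C: "C > 0" "\<And>u. u \<in> H01 \<Omega> \<Longrightarrow> ip_norm (H1_ip \<Omega>) u \<le> C * ip_norm (grad_ip \<Omega>) u"
    using H1_norm_le_grad_norm by blast
  have H1: "u n \<in> H1 \<Omega>" for n by (rule H01_H1[OF u])
  have CH1: "\<exists>K. \<forall>m\<ge>K. \<forall>n\<ge>K. ip_norm (H1_ip \<Omega>) (\<lambda>x. u m x - u n x) < \<epsilon>" if \<epsilon>: "\<epsilon> > 0" for \<epsilon>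
  proof -
    obtain K where K: "\<And>m n. m \<ge> K \<Longrightarrow> n \<ge> K \<Longrightarrow> ip_norm (grad_ip \<Omega>) (\<lambda>x. u m x - u n x) < \<epsilon> / C"
      using Cauchy[of "\<epsilon> / C"] C(1) \<epsilon> by auto
    have "ip_norm (H1_ip \<Omega>) (\<lambda>x. u m x - u n x) < \<epsilon>" if "m \<ge> K" "n \<ge> K" for m n
    proof -
      have "ip_norm (H1_ip \<Omega>) (\<lambda>x. u m x - u n x) \<le> C * ip_norm (grad_ip \<Omega>) (\<lambda>x. u m x - u n x)"
        by (rule C(2)[OF H01.diff_mem[OF u u]])
      also have "\<dots> < C * (\<epsilon> / C)" using K[OF that] C(1) by (rule mult_strict_left_mono)
      finally show ?thesis using C(1) by simp
    qed
    then show ?thesis by blast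
  qed
  obtain v where v: "v \<in> H1 \<Omega>" "(\<lambda>n. ip_norm (H1_ip \<Omega>) (\<lambda>x. u n x - v x)) \<longlonglongrightarrow> 0"
    using H1_complete[OF H1 CH1] by metis
  have "v \<in> H01 \<Omega>" by (rule H01_limit[OF v(1) u v(2)])
  moreover have "(\<lambda>n. ip_norm (grad_ip \<Omega>) (\<lambda>x. u n x - v x)) \<longlonglongrightarrow> 0"
    using v(2) H1_norm_tendsto_iff[of u v, OF H1 v(1)] by simp
  ultimately show ?thesis by (intro bexI[of _ v])
qed

lemma hilbert_on_H01: "hilbert_on (vol \<Omega>) (H01 \<Omega>) (grad_ip \<Omega>)"
  unfolding hilbert_on_def
proof (intro conjI ballI allI impI)
  show "(\<lambda>x. 0) \<in> H01 \<Omega>" by (rule H01.zero)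
next
  fix u v a b assume "u \<in> H01 \<Omega>" "v \<in> H01 \<Omega>"
  then show "(\<lambda>x. a * u x + b * v x) \<in> H01 \<Omega>" by (rule H01.lincomb)
next
  fix u v assume "u \<in> H01 \<Omega>" "v \<in> H01 \<Omega>"
  then show "grad_ip \<Omega> u v = grad_ip \<Omega> v u" by (rule H01.sym)
next
  fix u v w a b assume "u \<in> H01 \<Omega>" "v \<in> H01 \<Omega>" "w \<in> H01 \<Omega>"
  then show "grad_ip \<Omega> (\<lambda>x. a * u x + b * v x) w = a * grad_ip \<Omega> u w + b * grad_ip \<Omega> v w"
    by (rule H01.linear)
next
  fix u assume u: "u \<in> H01 \<Omega>"
  show "0 \<le> grad_ip \<Omega> u u" by (rule grad_ip_nonneg)
  show "(grad_ip \<Omega> u u = 0) = (AE x in vol \<Omega>. u x = 0)" by (rule grad_ip_zero_iff[OF u])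
next
  fix u :: "nat \<Rightarrow> 'a \<Rightarrow> real"
  assume "(\<forall>n. u n \<in> H01 \<Omega>) \<and>
    (\<forall>\<epsilon>>0. \<exists>K. \<forall>m\<ge>K. \<forall>n\<ge>K. ip_norm (grad_ip \<Omega>) (\<lambda>x. u m x - u n x) < \<epsilon>)"
  then show "\<exists>v\<in>H01 \<Omega>. (\<lambda>n. ip_norm (grad_ip \<Omega>) (\<lambda>x. u n x - v x)) \<longlonglongrightarrow> 0"
    by (intro H01_complete) auto
qed

lemma p_basis: "orthonormal_basis (H01 \<Omega>) (grad_ip \<Omega>) p"
proof (rule H01.complete_orthonormal_imp_basis[OF p_orthonormal H01_complete])
  fix u assume u: "u \<in> H01 \<Omega>" and orth: "\<And>j. grad_ip \<Omega> u (p j) = 0"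
  have "L2_ip (vol \<Omega>) u (e j) = 0" for j
    using grad_ip_p_squared[OF u, of j] orth[of j] eigenvalue_pos[of j] by simp
  then have "L2_ip (vol \<Omega>) u u = 0"
    by (rule L2.orthogonal_to_basis_imp_null[OF e_orthonormal e_basis H01_L2[OF u]])
  then show "grad_ip \<Omega> u u = 0"
    using L2_ip_self_eq_0_iff[OF H01_L2[OF u]] grad_ip_zero_iff[OF u] by simp
qed

text \<open>
  By symmetry of the gradient inner product, eigenfunctions for different eigenvalues are orthogonal in
  \<open>L2\<close>; an eigenvalue outside the list would have an eigenfunction orthogonal to a basis.
\<close>

lemma dirichlet_eigenvalue_iff: "dirichlet_eigenvalue \<Omega> t \<longleftrightarrow> t \<in> range \<mu>"
proof
  assume "dirichlet_eigenvalue \<Omega> t"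
  then obtain u where u: "u \<in> H01 \<Omega>" "\<not> (AE x in vol \<Omega>. u x = 0)"
    and eq: "\<And>h. h \<in> H01 \<Omega> \<Longrightarrow> grad_ip \<Omega> u h = t * L2_ip (vol \<Omega>) u h"
    by (auto simp: dirichlet_eigenvalue_def dirichlet_eigenpair_def)
  show "t \<in> range \<mu>"
  proof (rule ccontr)
    assume t: "t \<notin> range \<mu>"
    have "L2_ip (vol \<Omega>) u (e j) = 0" for j
    proof -
      have "t * L2_ip (vol \<Omega>) u (e j) = grad_ip \<Omega> u (e j)" using eq[OF e_H01] by simp
      also have "\<dots> = grad_ip \<Omega> (e j) u" by (rule H01.sym[OF u(1) e_H01])
      also have "\<dots> = \<mu> j * L2_ip (vol \<Omega>) (e j) u" by (rule e_equation[OF u(1)])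
      also have "\<dots> = \<mu> j * L2_ip (vol \<Omega>) u (e j)" by (subst L2_ip_commute) (rule refl)
      finally have "t * L2_ip (vol \<Omega>) u (e j) = \<mu> j * L2_ip (vol \<Omega>) u (e j)" .
      then show ?thesis using t by auto
    qed
    then have "L2_ip (vol \<Omega>) u u = 0"
      by (rule L2.orthogonal_to_basis_imp_null[OF e_orthonormal e_basis H01_L2[OF u(1)]])
    then show False using L2_ip_self_eq_0_iff[OF H01_L2[OF u(1)]] u(2) by simp
  qed
qed (use e_eigenpair in \<open>auto simp: dirichlet_eigenvalue_def\<close>)

text \<open>
  Stated for any \<open>V\<close> between the finite combinations of the basis and \<open>H01\<close>, so that it applies to
  a differently normalised and indexed span.
\<close>

lemma H01_eq_H1_closure:
  assumes V: "V \<subseteq> H01 \<Omega>" "\<And>n c. (\<lambda>x. \<Sum>j<n. c j * p j x) \<in> V"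
  shows "H01 \<Omega> = H1_closure \<Omega> V"
proof
  have VH1: "V \<subseteq> H1 \<Omega>" using V(1) H01_subset_H1 by (rule order_trans)
  show "H1_closure \<Omega> V \<subseteq> H01 \<Omega>"
  proof
    fix u assume u: "u \<in> H1_closure \<Omega> V"
    obtain v where v: "\<And>n::nat. v n \<in> V" "(\<lambda>n. ip_norm (H1_ip \<Omega>) (\<lambda>x. v n x - u x)) \<longlonglongrightarrow> 0"
      using H1.closure_in_sequence[OF u[unfolded H1_closure_eq] VH1] by metis
    show "u \<in> H01 \<Omega>"
      by (rule H01_limit[OF _ _ v(2)]) (use u v(1) V(1) in \<open>auto simp: H1_closure_def\<close>)
  qed
  obtain C where C: "C > 0" "\<And>u. u \<in> H01 \<Omega> \<Longrightarrow> ip_norm (H1_ip \<Omega>) u \<le> C * ip_norm (grad_ip \<Omega>) u"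
    using H1_norm_le_grad_norm by blast
  show "H01 \<Omega> \<subseteq> H1_closure \<Omega> V"
    unfolding H1_closure_def
  proof (intro subsetI CollectI conjI allI impI)
    fix u and \<epsilon> :: real assume u: "u \<in> H01 \<Omega>" and \<epsilon>: "\<epsilon> > 0"
    then have "\<epsilon> / C > 0" using C(1) by simp
    then obtain n c where nc: "ip_norm (grad_ip \<Omega>) (\<lambda>x. u x - (\<Sum>j<n. c j * p j x)) < \<epsilon> / C"
      using p_basis u unfolding orthonormal_basis_def dense_in_def by blast
    have "(\<lambda>x. u x - (\<Sum>j<n. c j * p j x)) \<in> H01 \<Omega>"
      by (intro H01.diff_mem u H01.sum_mem p_H01)
    then have "ip_norm (H1_ip \<Omega>) (\<lambda>x. u x - (\<Sum>j<n. c j * p j x))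
        \<le> C * ip_norm (grad_ip \<Omega>) (\<lambda>x. u x - (\<Sum>j<n. c j * p j x))" by (rule C(2))
    also have "\<dots> < C * (\<epsilon> / C)" using nc C(1) by (rule mult_strict_left_mono)
    finally have "ip_norm (H1_ip \<Omega>) (\<lambda>x. u x - (\<Sum>j<n. c j * p j x)) < \<epsilon>" using C(1) by simp
    then show "\<exists>v\<in>V. ip_norm (H1_ip \<Omega>) (\<lambda>x. u x - v x) < \<epsilon>"
      by (intro bexI[OF _ V(2)])
  qed (rule H01_H1)
qed

end

section \<open>Fubini's theorem for products of square-integrable functions\<close>

context pair_sigma_finite
begin

lemma integrable_tensor:
  fixes f :: "'a \<Rightarrow> real" and g :: "'b \<Rightarrow> real"
  assumes f: "integrable M1 f" and g: "integrable M2 g"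
  shows "integrable (M1 \<Otimes>\<^sub>M M2) (\<lambda>z. f (fst z) * g (snd z))"
proof (rule Fubini_integrable)
  have [measurable]: "f \<in> borel_measurable M1" "g \<in> borel_measurable M2" using f g by auto
  show "(\<lambda>z. f (fst z) * g (snd z)) \<in> borel_measurable (M1 \<Otimes>\<^sub>M M2)" by measurable
  show "integrable M1 (\<lambda>x. \<integral>y. norm (f (fst (x, y)) * g (snd (x, y))) \<partial>M2)"
    using f by (simp add: abs_mult)
  show "AE x in M1. integrable M2 (\<lambda>y. f (fst (x, y)) * g (snd (x, y)))"
    using g by simp
qed

lemma L2_tensor_scaleR_fst:
  fixes V :: "'a \<Rightarrow> 'c::euclidean_space" and g :: "'b \<Rightarrow> real"
  assumes "V \<in> L2 M1" "g \<in> L2 M2"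
  shows "(\<lambda>z. g (snd z) *\<^sub>R V (fst z)) \<in> L2 (M1 \<Otimes>\<^sub>M M2)"
proof -
  have [measurable]: "V \<in> borel_measurable M1" "g \<in> borel_measurable M2"
    using assms by (auto dest: L2_measurable)
  have "integrable (M1 \<Otimes>\<^sub>M M2) (\<lambda>z. (norm (V (fst z)))\<^sup>2 * (norm (g (snd z)))\<^sup>2)"
    by (intro integrable_tensor L2_integrable_norm assms)
  then show ?thesis by (simp add: L2_def power_mult_distrib mult.commute)
qed

lemma L2_tensor_scaleR_snd:
  fixes f :: "'a \<Rightarrow> real" and W :: "'b \<Rightarrow> 'c::euclidean_space"
  assumes "f \<in> L2 M1" "W \<in> L2 M2"
  shows "(\<lambda>z. f (fst z) *\<^sub>R W (snd z)) \<in> L2 (M1 \<Otimes>\<^sub>M M2)"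
proof -
  have [measurable]: "f \<in> borel_measurable M1" "W \<in> borel_measurable M2"
    using assms by (auto dest: L2_measurable)
  have "integrable (M1 \<Otimes>\<^sub>M M2) (\<lambda>z. (norm (f (fst z)))\<^sup>2 * (norm (W (snd z)))\<^sup>2)"
    by (intro integrable_tensor L2_integrable_norm assms)
  then show ?thesis by (simp add: L2_def power_mult_distrib)
qed

text \<open>
  Pairing \<open>g \<otimes> V\<close> with \<open>W\<close> reduces to pairing \<open>V\<close> with each slice of \<open>W\<close>. All weak identities on the
  product are obtained from those on a factor through this formula and its mirror image; \<open>V\<close> may be
  a gradient field.
\<close>

lemma L2_ip_slices_fst:
  fixes V :: "'a \<Rightarrow> 'c::euclidean_space" and g :: "'b \<Rightarrow> real"
  assumes "V \<in> L2 M1" "g \<in> L2 M2" "W \<in> L2 (M1 \<Otimes>\<^sub>M M2)"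
  shows "L2_ip (M1 \<Otimes>\<^sub>M M2) (\<lambda>z. g (snd z) *\<^sub>R V (fst z)) W
       = (\<integral>y. g y * L2_ip M1 V (\<lambda>x. W (x, y)) \<partial>M2)"
proof -
  have int: "integrable (M1 \<Otimes>\<^sub>M M2) (\<lambda>(x, y). (g y *\<^sub>R V x) \<bullet> W (x, y))"
    using integrable_L2_inner[OF L2_tensor_scaleR_fst[OF assms(1,2)] assms(3)]
    by (simp add: case_prod_beta')
  have "L2_ip (M1 \<Otimes>\<^sub>M M2) (\<lambda>z. g (snd z) *\<^sub>R V (fst z)) W
      = (\<integral>y. (\<integral>x. (g y *\<^sub>R V x) \<bullet> W (x, y) \<partial>M1) \<partial>M2)"
    using integral_snd[OF int] by (simp add: L2_ip_def case_prod_beta')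
  then show ?thesis by (simp add: L2_ip_def)
qed

lemma L2_ip_slices_snd:
  fixes f :: "'a \<Rightarrow> real" and V :: "'b \<Rightarrow> 'c::euclidean_space"
  assumes "f \<in> L2 M1" "V \<in> L2 M2" "W \<in> L2 (M1 \<Otimes>\<^sub>M M2)"
  shows "L2_ip (M1 \<Otimes>\<^sub>M M2) (\<lambda>z. f (fst z) *\<^sub>R V (snd z)) W
       = (\<integral>x. f x * L2_ip M2 V (\<lambda>y. W (x, y)) \<partial>M1)"
proof -
  have int: "integrable (M1 \<Otimes>\<^sub>M M2) (\<lambda>(x, y). (f x *\<^sub>R V y) \<bullet> W (x, y))"
    using integrable_L2_inner[OF L2_tensor_scaleR_snd[OF assms(1,2)] assms(3)]
    by (simp add: case_prod_beta')
  have "L2_ip (M1 \<Otimes>\<^sub>M M2) (\<lambda>z. f (fst z) *\<^sub>R V (snd z)) W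
      = (\<integral>x. (\<integral>y. (f x *\<^sub>R V y) \<bullet> W (x, y) \<partial>M2) \<partial>M1)"
    using integral_fst[OF int] by (simp add: L2_ip_def case_prod_beta')
  then show ?thesis by (simp add: L2_ip_def)
qed

lemma L2_ip_tensor_fst:
  fixes V V' :: "'a \<Rightarrow> 'c::euclidean_space" and g g' :: "'b \<Rightarrow> real"
  assumes "V \<in> L2 M1" "g \<in> L2 M2" "V' \<in> L2 M1" "g' \<in> L2 M2"
  shows "L2_ip (M1 \<Otimes>\<^sub>M M2) (\<lambda>z. g (snd z) *\<^sub>R V (fst z)) (\<lambda>z. g' (snd z) *\<^sub>R V' (fst z))
       = L2_ip M1 V V' * L2_ip M2 g g'"
proof -
  have "L2_ip M1 V (\<lambda>x. g' y *\<^sub>R V' x) = g' y * L2_ip M1 V V'" for y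
    by (simp add: L2_ip_def)
  then show ?thesis
    unfolding L2_ip_slices_fst[OF assms(1,2) L2_tensor_scaleR_fst[OF assms(3,4)]]
    by (simp add: L2_ip_def[of M2] flip: mult.assoc)
qed

lemma L2_ip_tensor_snd:
  fixes f f' :: "'a \<Rightarrow> real" and V V' :: "'b \<Rightarrow> 'c::euclidean_space"
  assumes "f \<in> L2 M1" "V \<in> L2 M2" "f' \<in> L2 M1" "V' \<in> L2 M2"
  shows "L2_ip (M1 \<Otimes>\<^sub>M M2) (\<lambda>z. f (fst z) *\<^sub>R V (snd z)) (\<lambda>z. f' (fst z) *\<^sub>R V' (snd z))
       = L2_ip M1 f f' * L2_ip M2 V V'"
proof -
  have "L2_ip M2 V (\<lambda>y. f' x *\<^sub>R V' y) = f' x * L2_ip M2 V V'" for x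
    by (simp add: L2_ip_def)
  then show ?thesis
    unfolding L2_ip_slices_snd[OF assms(1,2) L2_tensor_scaleR_snd[OF assms(3,4)]]
    by (simp add: L2_ip_def[of M1] flip: mult.assoc)
qed

lemma tensor_alt:
  "tensor f g = (\<lambda>z. f (fst z) *\<^sub>R g (snd z))" "tensor f g = (\<lambda>z. g (snd z) *\<^sub>R f (fst z))"
  by (auto simp: tensor_def fun_eq_iff)

lemma L2_tensor: "f \<in> L2 M1 \<Longrightarrow> g \<in> L2 M2 \<Longrightarrow> tensor f g \<in> L2 (M1 \<Otimes>\<^sub>M M2)"
  unfolding tensor_alt(2) by (rule L2_tensor_scaleR_fst)

lemma L2_ip_tensor:
  "\<lbrakk>f \<in> L2 M1; g \<in> L2 M2; f' \<in> L2 M1; g' \<in> L2 M2\<rbrakk>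
    \<Longrightarrow> L2_ip (M1 \<Otimes>\<^sub>M M2) (tensor f g) (tensor f' g') = L2_ip M1 f f' * L2_ip M2 g g'"
  unfolding tensor_alt(2) by (rule L2_ip_tensor_fst)

text \<open>
  Let \<open>w\<close> be orthogonal to all products. The coefficient of the slice \<open>w (-, y)\<close> at \<open>b j\<close> is, as a
  function of \<open>y\<close>, square integrable and orthogonal to every \<open>c k\<close>, hence it vanishes for almost all
  \<open>y\<close>. There are countably many \<open>j\<close>, so almost every slice has no coefficients at all and is null.
\<close>

lemma tensor_total:
  assumes b: "function_ip_space.orthonormal (L2 M1) (L2_ip M1) b" "orthonormal_basis (L2 M1) (L2_ip M1) b"
    and c: "function_ip_space.orthonormal (L2 M2) (L2_ip M2) c" "orthonormal_basis (L2 M2) (L2_ip M2) c"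
    and w: "w \<in> L2 (M1 \<Otimes>\<^sub>M M2)" and orth: "\<And>j k. L2_ip (M1 \<Otimes>\<^sub>M M2) w (tensor (b j) (c k)) = 0"
  shows "L2_ip (M1 \<Otimes>\<^sub>M M2) w w = 0"
proof -
  interpret A: function_ip_space "L2 M1" "L2_ip M1" by (rule function_ip_space_L2)
  interpret B: function_ip_space "L2 M2" "L2_ip M2" by (rule function_ip_space_L2)
  have bL: "b j \<in> L2 M1" for j using b(1) by (auto simp: A.orthonormal_def)
  have cL: "c k \<in> L2 M2" for k using c(1) by (auto simp: B.orthonormal_def)
  have [measurable]: "w \<in> borel_measurable (M1 \<Otimes>\<^sub>M M2)" "b j \<in> borel_measurable M1" for j
    using w bL by (auto dest: L2_measurable)
  have int_w2: "integrable (M1 \<Otimes>\<^sub>M M2) (\<lambda>(x, y). (norm (w (x, y)))\<^sup>2)"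
    using L2_integrable_norm[OF w] by (simp add: case_prod_beta')
  have "AE y in M2. integrable M1 (\<lambda>x. (norm (w (x, y)))\<^sup>2)"
    by (rule AE_integrable_snd[OF int_w2])
  then have slice: "AE y in M2. (\<lambda>x. w (x, y)) \<in> L2 M1"
    using AE_space by eventually_elim (auto simp: L2_def)
  define W where "W j y = L2_ip M1 (\<lambda>x. w (x, y)) (b j)" for j y
  have [measurable]: "W j \<in> borel_measurable M2" for j
    unfolding W_def L2_ip_def by measurable
  have W_L2: "W j \<in> L2 M2" for j
  proof -
    have "integrable M2 (\<lambda>y. (norm (W j y))\<^sup>2)"
    proof (rule Bochner_Integration.integrable_bound[OF integrable_snd[OF int_w2]])
      show "AE y in M2. norm ((norm (W j y))\<^sup>2) \<le> norm (\<integral>x. (norm (w (x, y)))\<^sup>2 \<partial>M1)"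
        using slice
      proof eventually_elim
        case (elim y)
        have "(W j y)\<^sup>2 \<le> L2_ip M1 (\<lambda>x. w (x, y)) (\<lambda>x. w (x, y))"
          unfolding W_def using A.Bessel[OF b(1) elim, of "Suc j"]
            member_le_sum[of j "{..<Suc j}" "\<lambda>i. (L2_ip M1 (\<lambda>x. w (x, y)) (b i))\<^sup>2"] by simp
        then show ?case by (simp add: L2_ip_self)
      qed
    qed measurable
    then show ?thesis by (simp add: L2_def)
  qed
  have "L2_ip M2 (W j) (c k) = 0" for j k
  proof -
    have "L2_ip M2 (W j) (c k) = (\<integral>y. c k y * L2_ip M1 (b j) (\<lambda>x. w (x, y)) \<partial>M2)"
      unfolding W_def L2_ip_commute[of M1 "b j"] by (simp add: L2_ip_def mult.commute)
    also have "\<dots> = L2_ip (M1 \<Otimes>\<^sub>M M2) (tensor (b j) (c k)) w"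
      using L2_ip_slices_fst[OF bL cL w] by (simp add: tensor_alt(2))
    finally show ?thesis using orth[of j k] by (simp add: L2_ip_commute)
  qed
  then have "L2_ip M2 (W j) (W j) = 0" for j
    by (intro B.orthogonal_to_basis_imp_null[OF c W_L2])
  then have "AE y in M2. W j y = 0" for j using L2_ip_self_eq_0_iff[OF W_L2] by blast
  then have "AE y in M2. \<forall>j. W j y = 0" by (simp add: AE_all_countable)
  then have "AE y in M2. (\<integral>x. (norm (w (x, y)))\<^sup>2 \<partial>M1) = 0"
    using slice
  proof eventually_elim
    case (elim y)
    then have "L2_ip M1 (\<lambda>x. w (x, y)) (\<lambda>x. w (x, y)) = 0"
      by (intro A.orthogonal_to_basis_imp_null[OF b]) (auto simp: W_def)
    then show ?case by (simp add: L2_ip_self)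
  qed
  then have "(\<integral>y. (\<integral>x. (norm (w (x, y)))\<^sup>2 \<partial>M1) \<partial>M2) = 0"
    by (simp cong: integral_cong_AE add: integral_eq_zero_AE)
  then show ?thesis
    using integral_snd[OF int_w2] by (simp add: L2_ip_self case_prod_beta')
qed

end

section \<open>Test functions on products\<close>

lemma Ck_fst:
  fixes f :: "'a::euclidean_space \<Rightarrow> real"
  shows "Ck k f \<Longrightarrow> Ck k (\<lambda>z :: 'a \<times> 'b::euclidean_space. f (fst z))"
proof (induction k arbitrary: f)
  case 0
  then show ?case by (auto intro!: continuous_on_compose2[of UNIV f] continuous_intros)
next
  case (Suc k)
  show ?case
  proof (rule Ck_SucI)
    show "((\<lambda>z. f (fst z)) has_derivative (\<lambda>h. frechet_derivative f (at (fst z)) (fst h))) (at z)" for z :: "'a \<times> 'b"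
      by (rule has_derivative_compose[OF has_derivative_fst[OF has_derivative_ident]])
        (rule Ck_has_derivative[OF Suc.prems])
    fix i :: "'a \<times> 'b" assume "i \<in> Basis"
    then consider "fst i \<in> Basis" | "fst i = 0" by (auto simp: Basis_prod_def)
    then show "Ck k (\<lambda>z :: 'a \<times> 'b. frechet_derivative f (at (fst z)) (fst i))"
    proof cases
      case 1
      then show ?thesis using Suc.IH[of "partial (fst i) f"] Suc.prems by simp
    next
      case 2
      have "frechet_derivative f (at x) 0 = 0" for x
        using Ck_has_derivative[OF Suc.prems, of x] by (intro linear_0 has_derivative_linear)
      then show ?thesis using 2 by (simp add: Ck_const)
    qed
  qed
qed

lemma Ck_snd:
  fixes f :: "'b::euclidean_space \<Rightarrow> real"
  shows "Ck k f \<Longrightarrow> Ck k (\<lambda>z :: 'a::euclidean_space \<times> 'b. f (snd z))"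
proof (induction k arbitrary: f)
  case 0
  then show ?case by (auto intro!: continuous_on_compose2[of UNIV f] continuous_intros)
next
  case (Suc k)
  show ?case
  proof (rule Ck_SucI)
    show "((\<lambda>z. f (snd z)) has_derivative (\<lambda>h. frechet_derivative f (at (snd z)) (snd h))) (at z)" for z :: "'a \<times> 'b"
      by (rule has_derivative_compose[OF has_derivative_snd[OF has_derivative_ident]])
        (rule Ck_has_derivative[OF Suc.prems])
    fix i :: "'a \<times> 'b" assume "i \<in> Basis"
    then consider "snd i \<in> Basis" | "snd i = 0" by (auto simp: Basis_prod_def)
    then show "Ck k (\<lambda>z :: 'a \<times> 'b. frechet_derivative f (at (snd z)) (snd i))"
    proof cases
      case 1
      then show ?thesis using Suc.IH[of "partial (snd i) f"] Suc.prems by simp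
    next
      case 2
      have "frechet_derivative f (at x) 0 = 0" for x
        using Ck_has_derivative[OF Suc.prems, of x] by (intro linear_0 has_derivative_linear)
      then show ?thesis using 2 by (simp add: Ck_const)
    qed
  qed
qed

lemma slice_has_derivative:
  assumes "(\<Phi> has_derivative D) (at (x, y))"
  shows "((\<lambda>x. \<Phi> (x, y)) has_derivative (\<lambda>h. D (h, 0))) (at x)"
    "((\<lambda>y. \<Phi> (x, y)) has_derivative (\<lambda>h. D (0, h))) (at y)"
proof -
  have "((\<lambda>x. (x, y)) has_derivative (\<lambda>h. (h, 0))) (at x)"
    by (auto intro!: derivative_eq_intros)
  then show "((\<lambda>x. \<Phi> (x, y)) has_derivative (\<lambda>h. D (h, 0))) (at x)"
    using assms by (rule has_derivative_compose)
  have "((\<lambda>y. (x, y)) has_derivative (\<lambda>h. (0, h))) (at y)"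
    by (auto intro!: derivative_eq_intros)
  then show "((\<lambda>y. \<Phi> (x, y)) has_derivative (\<lambda>h. D (0, h))) (at y)"
    using assms by (rule has_derivative_compose)
qed

text \<open>
  Both slices are treated in one induction, as the partial derivatives of a slice are slices of the
  partial derivatives.
\<close>

lemma Ck_slices:
  fixes \<Phi> :: "'a::euclidean_space \<times> 'b::euclidean_space \<Rightarrow> real"
  shows "Ck k \<Phi> \<Longrightarrow> Ck k (\<lambda>x. \<Phi> (x, y)) \<and> Ck k (\<lambda>y. \<Phi> (x, y))"
proof (induction k arbitrary: \<Phi>)
  case 0
  then show ?case by (auto intro!: continuous_on_compose2[of UNIV \<Phi>] continuous_intros)
next
  case (Suc k)
  note d = slice_has_derivative[OF Ck_has_derivative[OF Suc.prems]]
  have 1: "Ck k (partial i \<Phi>)" if "i \<in> Basis" for i using Suc.prems that by simp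
  show ?case
  proof (intro conjI)
    show "Ck (Suc k) (\<lambda>x. \<Phi> (x, y))"
      by (rule Ck_SucI[OF d(1)]) (use Suc.IH[OF 1] in \<open>auto simp: Basis_prod_def\<close>)
    show "Ck (Suc k) (\<lambda>y. \<Phi> (x, y))"
      by (rule Ck_SucI[OF d(2)]) (use Suc.IH[OF 1] in \<open>auto simp: Basis_prod_def\<close>)
  qed
qed

lemma test_function_slices:
  fixes \<Phi> :: "'a::euclidean_space \<times> 'b::euclidean_space \<Rightarrow> real"
  assumes \<Phi>: "\<Phi> \<in> test_functions (A \<times> B)"
  shows "(\<lambda>x. \<Phi> (x, y)) \<in> test_functions A" "(\<lambda>y. \<Phi> (x, y)) \<in> test_functions B"
proof -
  let ?K = "closure {z. \<Phi> z \<noteq> 0}"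
  have K: "compact ?K" "?K \<subseteq> A \<times> B" by (rule test_functionsD[OF \<Phi>])+
  have sub: "{z. \<Phi> z \<noteq> 0} \<subseteq> ?K" by (rule closure_subset)
  show "(\<lambda>x. \<Phi> (x, y)) \<in> test_functions A"
  proof (rule test_functionI)
    show "Ck k (\<lambda>x. \<Phi> (x, y))" for k using Ck_slices[OF test_functionsD(1)[OF \<Phi>]] by blast
    show "compact (fst ` ?K)" using K(1) by (intro compact_continuous_image continuous_intros)
    show "{x. \<Phi> (x, y) \<noteq> 0} \<subseteq> fst ` ?K" using sub by force
    show "fst ` ?K \<subseteq> A" using K(2) by auto
  qed
  show "(\<lambda>y. \<Phi> (x, y)) \<in> test_functions B"
  proof (rule test_functionI)
    show "Ck k (\<lambda>y. \<Phi> (x, y))" for k using Ck_slices[OF test_functionsD(1)[OF \<Phi>]] by blast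
    show "compact (snd ` ?K)" using K(1) by (intro compact_continuous_image continuous_intros)
    show "{y. \<Phi> (x, y) \<noteq> 0} \<subseteq> snd ` ?K" using sub by force
    show "snd ` ?K \<subseteq> B" using K(2) by auto
  qed
qed

lemma partial_slices:
  assumes "\<Phi> \<in> test_functions \<Omega>"
  shows "partial u (\<lambda>x. \<Phi> (x, y)) x = partial (u, 0) \<Phi> (x, y)"
    "partial v (\<lambda>y. \<Phi> (x, y)) y = partial (0, v) \<Phi> (x, y)"
  by (simp_all only: frechet_derivative_at[OF slice_has_derivative(1)[OF test_function_has_derivative[OF assms]], symmetric]
      frechet_derivative_at[OF slice_has_derivative(2)[OF test_function_has_derivative[OF assms]], symmetric])

lemma nabla_slices:
  fixes \<Phi> :: "'a::euclidean_space \<times> 'b::euclidean_space \<Rightarrow> real"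
  assumes "\<Phi> \<in> test_functions \<Omega>"
  shows "nabla \<Phi> (x, y) = (nabla (\<lambda>x. \<Phi> (x, y)) x, nabla (\<lambda>y. \<Phi> (x, y)) y)"
  unfolding nabla_def partial_slices[OF assms]
  by (simp add: sum_Basis_prod_eq sum_prod fst_sum snd_sum prod_eq_iff)

lemma test_function_tensor:
  assumes \<phi>: "\<phi> \<in> test_functions A" and \<psi>: "\<psi> \<in> test_functions B"
  shows "tensor \<phi> \<psi> \<in> test_functions (A \<times> B)"
proof (rule test_functionI)
  show "Ck k (tensor \<phi> \<psi>)" for k
    using Ck_mult[OF Ck_fst[OF test_functionsD(1)[OF \<phi>]] Ck_snd[OF test_functionsD(1)[OF \<psi>]]]
    by (simp add: tensor_def case_prod_beta')
  show "compact (closure {x. \<phi> x \<noteq> 0} \<times> closure {x. \<psi> x \<noteq> 0})"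
    by (intro compact_Times test_functionsD[OF \<phi>] test_functionsD[OF \<psi>])
  show "closure {x. \<phi> x \<noteq> 0} \<times> closure {x. \<psi> x \<noteq> 0} \<subseteq> A \<times> B"
    by (intro Sigma_mono test_functionsD[OF \<phi>] test_functionsD[OF \<psi>])
  have "{z. tensor \<phi> \<psi> z \<noteq> 0} \<subseteq> {x. \<phi> x \<noteq> 0} \<times> {x. \<psi> x \<noteq> 0}"
    by (auto simp: tensor_def)
  also have "\<dots> \<subseteq> closure {x. \<phi> x \<noteq> 0} \<times> closure {x. \<psi> x \<noteq> 0}"
    by (intro Sigma_mono closure_subset)
  finally show "{z. tensor \<phi> \<psi> z \<noteq> 0} \<subseteq> closure {x. \<phi> x \<noteq> 0} \<times> closure {x. \<psi> x \<noteq> 0}" .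
qed

section \<open>Sobolev spaces on products\<close>

lemma sets_subset_if_identity_measurable:
  assumes "(\<lambda>z. z) \<in> measurable N M" "space M = space N"
  shows "sets M \<subseteq> sets N"
proof
  fix X assume X: "X \<in> sets M"
  then have "X \<inter> space N \<in> sets N" using measurable_sets[OF assms(1) X] by simp
  then show "X \<in> sets N" using sets.sets_into_space[OF X] assms(2) by (simp add: Int_absorb2)
qed

locale bounded_open_pair = A: bounded_open \<Omega>\<^sub>1 + B: bounded_open \<Omega>\<^sub>2
  for \<Omega>\<^sub>1 :: "'a::euclidean_space set" and \<Omega>\<^sub>2 :: "'b::euclidean_space set"
begin

sublocale P: bounded_open "\<Omega>\<^sub>1 \<times> \<Omega>\<^sub>2"
  by unfold_locales (intro open_Times bounded_Times A.open_\<Omega> A.bounded_\<Omega> B.open_\<Omega> B.bounded_\<Omega>)+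

sublocale vols: pair_sigma_finite "vol \<Omega>\<^sub>1" "vol \<Omega>\<^sub>2"
  using A.finite_measure_vol B.finite_measure_vol
  by (intro pair_sigma_finite.intro finite_measure.axioms(1))

lemma vol_Times: "vol \<Omega>\<^sub>1 \<Otimes>\<^sub>M vol \<Omega>\<^sub>2 = vol (\<Omega>\<^sub>1 \<times> \<Omega>\<^sub>2)"
proof (rule pair_measure_eqI)
  show "sigma_finite_measure (vol \<Omega>\<^sub>1)" "sigma_finite_measure (vol \<Omega>\<^sub>2)"
    by unfold_locales
  let ?P = "vol \<Omega>\<^sub>1 \<Otimes>\<^sub>M vol \<Omega>\<^sub>2" and ?Q = "vol (\<Omega>\<^sub>1 \<times> \<Omega>\<^sub>2)"
  have space: "space ?P = space ?Q"
    by (simp add: space_pair_measure space_restrict_space)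
  have "(\<lambda>z. z) \<in> measurable ?P ?Q"
  proof (rule measurable_restrict_space2)
    show "(\<lambda>z. z) \<in> space ?P \<rightarrow> \<Omega>\<^sub>1 \<times> \<Omega>\<^sub>2"
      by (auto simp: space_pair_measure space_restrict_space)
    have "(\<lambda>z. (fst z, snd z)) \<in> borel_measurable ?P"
      by (intro borel_measurable_Pair measurable_compose[OF measurable_fst measurable_vol]
          measurable_compose[OF measurable_snd measurable_vol]) auto
    then show "(\<lambda>z. z) \<in> measurable ?P lborel" by simp
  qed
  then have QP: "sets ?Q \<subseteq> sets ?P"
    using space[symmetric] by (rule sets_subset_if_identity_measurable)
  have "(\<lambda>z. z) \<in> measurable ?Q ?P"
  proof -
    have "fst \<in> measurable ?Q (vol \<Omega>\<^sub>1)" "snd \<in> measurable ?Q (vol \<Omega>\<^sub>2)"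
      by (rule measurable_restrict_space2; force simp: space_restrict_space
          intro!: measurable_vol borel_measurable_continuous_onI continuous_intros)+
    then have "(\<lambda>z. (fst z, snd z)) \<in> measurable ?Q ?P" by (rule measurable_Pair)
    then show ?thesis by simp
  qed
  then have "sets ?P \<subseteq> sets ?Q"
    using space by (rule sets_subset_if_identity_measurable)
  with QP show "sets ?P = sets ?Q" by simp
  fix S T assume S: "S \<in> sets (vol \<Omega>\<^sub>1)" and T: "T \<in> sets (vol \<Omega>\<^sub>2)"
  then have "S \<subseteq> \<Omega>\<^sub>1" "T \<subseteq> \<Omega>\<^sub>2" and m: "S \<in> sets lborel" "T \<in> sets lborel"
    using A.open_\<Omega> B.open_\<Omega> by (auto simp: sets_restrict_space_iff)
  then have "emeasure (vol \<Omega>\<^sub>1) S * emeasure (vol \<Omega>\<^sub>2) T = emeasure lborel S * emeasure lborel T"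
    using A.open_\<Omega> B.open_\<Omega> by (simp add: emeasure_restrict_space)
  also have "\<dots> = emeasure (lborel \<Otimes>\<^sub>M lborel) (S \<times> T)"
    using m by (rule lborel.emeasure_pair_measure_Times[symmetric])
  also have "\<dots> = emeasure ?Q (S \<times> T)"
    unfolding lborel_prod using P.open_\<Omega> \<open>S \<subseteq> \<Omega>\<^sub>1\<close> \<open>T \<subseteq> \<Omega>\<^sub>2\<close>
    by (subst emeasure_restrict_space) auto
  finally show "emeasure (vol \<Omega>\<^sub>1) S * emeasure (vol \<Omega>\<^sub>2) T = emeasure ?Q (S \<times> T)" .
qed

definition tensor_gradient ::
    "('a \<Rightarrow> real) \<Rightarrow> ('a \<Rightarrow> 'a) \<Rightarrow> ('b \<Rightarrow> real) \<Rightarrow> ('b \<Rightarrow> 'b) \<Rightarrow> 'a \<times> 'b \<Rightarrow> 'a \<times> 'b" where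
  "tensor_gradient f F g G = (\<lambda>z. (g (snd z) *\<^sub>R F (fst z), f (fst z) *\<^sub>R G (snd z)))"

lemma tensor_gradient_L2:
  assumes "f \<in> L2 (vol \<Omega>\<^sub>1)" "F \<in> L2 (vol \<Omega>\<^sub>1)" "g \<in> L2 (vol \<Omega>\<^sub>2)" "G \<in> L2 (vol \<Omega>\<^sub>2)"
  shows "tensor_gradient f F g G \<in> L2 (vol (\<Omega>\<^sub>1 \<times> \<Omega>\<^sub>2))"
  unfolding tensor_gradient_def vol_Times[symmetric]
  by (intro L2_Pair vols.L2_tensor_scaleR_fst vols.L2_tensor_scaleR_snd assms)

text \<open>
  A partial derivative of a test function in a direction of the first factor is, on each slice, a
  partial derivative of a test function on \<open>\<Omega>\<^sub>1\<close>, so it can be moved to \<open>f\<close> slice by slice;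
  likewise for the second factor and \<open>g\<close>.
\<close>

lemma weak_gradient_tensor:
  assumes f: "f \<in> L2 (vol \<Omega>\<^sub>1)" "weak_gradient \<Omega>\<^sub>1 f F" and g: "g \<in> L2 (vol \<Omega>\<^sub>2)" "weak_gradient \<Omega>\<^sub>2 g G"
  shows "weak_gradient (\<Omega>\<^sub>1 \<times> \<Omega>\<^sub>2) (tensor f g) (tensor_gradient f F g G)"
  unfolding weak_gradient_iff
proof (intro conjI ballI)
  have FG: "F \<in> L2 (vol \<Omega>\<^sub>1)" "G \<in> L2 (vol \<Omega>\<^sub>2)" using f g by (auto dest: weak_gradient_L2)
  then show "tensor_gradient f F g G \<in> L2 (vol (\<Omega>\<^sub>1 \<times> \<Omega>\<^sub>2))" by (intro tensor_gradient_L2 f g)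
  fix \<Phi> and i :: "'a \<times> 'b" assume \<Phi>: "\<Phi> \<in> test_functions (\<Omega>\<^sub>1 \<times> \<Omega>\<^sub>2)" and i: "i \<in> Basis"
  have L: "\<Phi> \<in> L2 (vol \<Omega>\<^sub>1 \<Otimes>\<^sub>M vol \<Omega>\<^sub>2)" "partial i \<Phi> \<in> L2 (vol \<Omega>\<^sub>1 \<Otimes>\<^sub>M vol \<Omega>\<^sub>2)"
    unfolding vol_Times by (intro P.test_function_in_L2 test_function_partial \<Phi> i)+
  consider u where "u \<in> Basis" "i = (u, 0)" | v where "v \<in> Basis" "i = (0, v)"
    using i by (auto simp: Basis_prod_def)
  then show "L2_ip (vol (\<Omega>\<^sub>1 \<times> \<Omega>\<^sub>2)) (tensor f g) (partial i \<Phi>)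
      = - L2_ip (vol (\<Omega>\<^sub>1 \<times> \<Omega>\<^sub>2)) (\<lambda>z. tensor_gradient f F g G z \<bullet> i) \<Phi>"
  proof cases
    case 1
    have "L2_ip (vol \<Omega>\<^sub>1 \<Otimes>\<^sub>M vol \<Omega>\<^sub>2) (tensor f g) (partial i \<Phi>)
        = (\<integral>y. g y * L2_ip (vol \<Omega>\<^sub>1) f (partial u (\<lambda>x. \<Phi> (x, y))) \<partial>vol \<Omega>\<^sub>2)"
      unfolding vols.tensor_alt(2) partial_slices(1)[OF \<Phi>] 1(2)[symmetric]
      by (rule vols.L2_ip_slices_fst[OF f(1) g(1) L(2)])
    also have "\<dots> = - (\<integral>y. g y * L2_ip (vol \<Omega>\<^sub>1) (\<lambda>x. F x \<bullet> u) (\<lambda>x. \<Phi> (x, y)) \<partial>vol \<Omega>\<^sub>2)"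
      using f(2) test_function_slices(1)[OF \<Phi>] 1(1) by (simp add: weak_gradient_iff)
    also have "\<dots> = - L2_ip (vol \<Omega>\<^sub>1 \<Otimes>\<^sub>M vol \<Omega>\<^sub>2) (\<lambda>z. g (snd z) *\<^sub>R (F (fst z) \<bullet> u)) \<Phi>"
      using vols.L2_ip_slices_fst[OF L2_component[OF FG(1)] g(1) L(1)] by simp
    finally show ?thesis by (simp add: vol_Times 1(2) tensor_gradient_def)
  next
    case 2
    have "L2_ip (vol \<Omega>\<^sub>1 \<Otimes>\<^sub>M vol \<Omega>\<^sub>2) (tensor f g) (partial i \<Phi>)
        = (\<integral>x. f x * L2_ip (vol \<Omega>\<^sub>2) g (partial v (\<lambda>y. \<Phi> (x, y))) \<partial>vol \<Omega>\<^sub>1)"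
      unfolding vols.tensor_alt(1) partial_slices(2)[OF \<Phi>] 2(2)[symmetric]
      by (rule vols.L2_ip_slices_snd[OF f(1) g(1) L(2)])
    also have "\<dots> = - (\<integral>x. f x * L2_ip (vol \<Omega>\<^sub>2) (\<lambda>y. G y \<bullet> v) (\<lambda>y. \<Phi> (x, y)) \<partial>vol \<Omega>\<^sub>1)"
      using g(2) test_function_slices(2)[OF \<Phi>] 2(1) by (simp add: weak_gradient_iff)
    also have "\<dots> = - L2_ip (vol \<Omega>\<^sub>1 \<Otimes>\<^sub>M vol \<Omega>\<^sub>2) (\<lambda>z. f (fst z) *\<^sub>R (G (snd z) \<bullet> v)) \<Phi>"
      using vols.L2_ip_slices_snd[OF f(1) L2_component[OF FG(2)] L(1)] by simp
    finally show ?thesis by (simp add: vol_Times 2(2) tensor_gradient_def)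
  qed
qed

lemma L2_tensor:
  "f \<in> L2 (vol \<Omega>\<^sub>1) \<Longrightarrow> g \<in> L2 (vol \<Omega>\<^sub>2) \<Longrightarrow> tensor f g \<in> L2 (vol (\<Omega>\<^sub>1 \<times> \<Omega>\<^sub>2))"
  unfolding vol_Times[symmetric] by (rule vols.L2_tensor)

lemma H1_tensor:
  assumes "f \<in> H1 \<Omega>\<^sub>1" "g \<in> H1 \<Omega>\<^sub>2"
  shows "tensor f g \<in> H1 (\<Omega>\<^sub>1 \<times> \<Omega>\<^sub>2)"
  by (rule P.H1I[OF L2_tensor[OF A.H1_L2[OF assms(1)] B.H1_L2[OF assms(2)]]
      weak_gradient_tensor[OF A.H1_L2[OF assms(1)] A.grad_weak[OF assms(1)]
        B.H1_L2[OF assms(2)] B.grad_weak[OF assms(2)]]])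

text \<open>
  The squared norm of the product is the product of the two squared norms without the term
  \<open>norm (\<nabla>f)\<^sup>2 * norm (\<nabla>g)\<^sup>2\<close>.
\<close>

lemma H1_norm_tensor_le:
  assumes f: "f \<in> H1 \<Omega>\<^sub>1" and g: "g \<in> H1 \<Omega>\<^sub>2"
  shows "ip_norm (H1_ip (\<Omega>\<^sub>1 \<times> \<Omega>\<^sub>2)) (tensor f g) \<le> ip_norm (H1_ip \<Omega>\<^sub>1) f * ip_norm (H1_ip \<Omega>\<^sub>2) g"
proof -
  let ?F = "grad \<Omega>\<^sub>1 f" and ?G = "grad \<Omega>\<^sub>2 g"
  note L = A.H1_L2[OF f] A.grad_L2[OF f] B.H1_L2[OF g] B.grad_L2[OF g]
  have T: "tensor f g \<in> L2 (vol (\<Omega>\<^sub>1 \<times> \<Omega>\<^sub>2))" "weak_gradient (\<Omega>\<^sub>1 \<times> \<Omega>\<^sub>2) (tensor f g) (tensor_gradient f ?F g ?G)"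
    by (intro L2_tensor weak_gradient_tensor L A.grad_weak B.grad_weak f g)+
  have "grad_ip (\<Omega>\<^sub>1 \<times> \<Omega>\<^sub>2) (tensor f g) (tensor f g)
      = L2_ip (vol \<Omega>\<^sub>1 \<Otimes>\<^sub>M vol \<Omega>\<^sub>2) (tensor_gradient f ?F g ?G) (tensor_gradient f ?F g ?G)"
    unfolding vol_Times by (rule P.grad_ip_eq[OF T(1,1) T(2,2)])
  also have "\<dots> = L2_ip (vol \<Omega>\<^sub>1 \<Otimes>\<^sub>M vol \<Omega>\<^sub>2) (\<lambda>z. g (snd z) *\<^sub>R ?F (fst z)) (\<lambda>z. g (snd z) *\<^sub>R ?F (fst z))
      + L2_ip (vol \<Omega>\<^sub>1 \<Otimes>\<^sub>M vol \<Omega>\<^sub>2) (\<lambda>z. f (fst z) *\<^sub>R ?G (snd z)) (\<lambda>z. f (fst z) *\<^sub>R ?G (snd z))"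
    using L2_ip_Pair[OF vols.L2_tensor_scaleR_fst[OF L(2,3)] vols.L2_tensor_scaleR_snd[OF L(1,4)]
        tensor_gradient_L2[OF L, folded vol_Times]]
    by (simp add: tensor_gradient_def)
  also have "\<dots> = grad_ip \<Omega>\<^sub>1 f f * L2_ip (vol \<Omega>\<^sub>2) g g + L2_ip (vol \<Omega>\<^sub>1) f f * grad_ip \<Omega>\<^sub>2 g g"
    by (simp add: vols.L2_ip_tensor_fst vols.L2_ip_tensor_snd L grad_ip_def)
  finally have "H1_ip (\<Omega>\<^sub>1 \<times> \<Omega>\<^sub>2) (tensor f g) (tensor f g)
      = L2_ip (vol \<Omega>\<^sub>1) f f * L2_ip (vol \<Omega>\<^sub>2) g g
        + (grad_ip \<Omega>\<^sub>1 f f * L2_ip (vol \<Omega>\<^sub>2) g g + L2_ip (vol \<Omega>\<^sub>1) f f * grad_ip \<Omega>\<^sub>2 g g)"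
    by (simp add: H1_ip_def vols.L2_ip_tensor L flip: vol_Times)
  also have "\<dots> \<le> H1_ip \<Omega>\<^sub>1 f f * H1_ip \<Omega>\<^sub>2 g g"
    using mult_nonneg_nonneg[OF A.grad_ip_nonneg[of f] B.grad_ip_nonneg[of g]]
    by (simp add: H1_ip_def algebra_simps)
  finally show ?thesis
    unfolding ip_norm_def real_sqrt_mult[symmetric] by (rule real_sqrt_le_mono)
qed

lemma tensor_diff:
  "(\<lambda>z. tensor f g z - tensor f' g z) = tensor (\<lambda>x. f x - f' x) g"
  "(\<lambda>z. tensor f g z - tensor f g' z) = tensor f (\<lambda>y. g y - g' y)"
  by (auto simp: tensor_def fun_eq_iff algebra_simps)

text \<open>
  The factors are approximated by test functions one at a time. With the other factor fixed, the map
  to the product is linear and bounded by \<open>H1_norm_tensor_le\<close>.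
\<close>

lemma H01_tensor:
  assumes f: "f \<in> H01 \<Omega>\<^sub>1" and g: "g \<in> H01 \<Omega>\<^sub>2"
  shows "tensor f g \<in> H01 (\<Omega>\<^sub>1 \<times> \<Omega>\<^sub>2)"
proof -
  note H1 = A.H01_H1[OF f] B.H01_H1[OF g]
  have test: "tensor \<phi> g \<in> H01 (\<Omega>\<^sub>1 \<times> \<Omega>\<^sub>2)" if \<phi>: "\<phi> \<in> test_functions \<Omega>\<^sub>1" for \<phi>
  proof -
    have \<phi>H1: "\<phi> \<in> H1 \<Omega>\<^sub>1" using \<phi> A.test_functions_subset_H1 by blast
    obtain \<psi> where \<psi>: "\<And>n::nat. \<psi> n \<in> test_functions \<Omega>\<^sub>2"
      "(\<lambda>n. ip_norm (H1_ip \<Omega>\<^sub>2) (\<lambda>x. \<psi> n x - g x)) \<longlonglongrightarrow> 0"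
      using B.H01_sequence[OF g] by metis
    have \<psi>H1: "\<psi> n \<in> H1 \<Omega>\<^sub>2" for n using \<psi>(1) B.test_functions_subset_H1 by blast
    show ?thesis
    proof (rule P.H01_limit)
      show "tensor \<phi> g \<in> H1 (\<Omega>\<^sub>1 \<times> \<Omega>\<^sub>2)" by (rule H1_tensor[OF \<phi>H1 H1(2)])
      show "tensor \<phi> (\<psi> n) \<in> H01 (\<Omega>\<^sub>1 \<times> \<Omega>\<^sub>2)" for n
        by (intro P.H01_test test_function_tensor \<phi> \<psi>)
      show "(\<lambda>n. ip_norm (H1_ip (\<Omega>\<^sub>1 \<times> \<Omega>\<^sub>2)) (\<lambda>z. tensor \<phi> (\<psi> n) z - tensor \<phi> g z)) \<longlonglongrightarrow> 0"
      proof (rule tendsto_sandwich[OF always_eventually always_eventually tendsto_const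
            tendsto_mult_right_zero[OF \<psi>(2), of "ip_norm (H1_ip \<Omega>\<^sub>1) \<phi>"]]; intro allI)
        fix n
        show "0 \<le> ip_norm (H1_ip (\<Omega>\<^sub>1 \<times> \<Omega>\<^sub>2)) (\<lambda>z. tensor \<phi> (\<psi> n) z - tensor \<phi> g z)"
          by (intro P.H1.norm_nonneg P.H1.diff_mem H1_tensor \<phi>H1 \<psi>H1 H1)
        show "ip_norm (H1_ip (\<Omega>\<^sub>1 \<times> \<Omega>\<^sub>2)) (\<lambda>z. tensor \<phi> (\<psi> n) z - tensor \<phi> g z)
            \<le> ip_norm (H1_ip \<Omega>\<^sub>1) \<phi> * ip_norm (H1_ip \<Omega>\<^sub>2) (\<lambda>x. \<psi> n x - g x)"
          unfolding tensor_diff by (intro H1_norm_tensor_le B.H1.diff_mem \<phi>H1 \<psi>H1 H1)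
      qed
    qed
  qed
  obtain \<phi> where \<phi>: "\<And>n::nat. \<phi> n \<in> test_functions \<Omega>\<^sub>1"
    "(\<lambda>n. ip_norm (H1_ip \<Omega>\<^sub>1) (\<lambda>x. \<phi> n x - f x)) \<longlonglongrightarrow> 0"
    using A.H01_sequence[OF f] by metis
  have \<phi>H1: "\<phi> n \<in> H1 \<Omega>\<^sub>1" for n using \<phi>(1) A.test_functions_subset_H1 by blast
  show ?thesis
  proof (rule P.H01_limit)
    show "tensor f g \<in> H1 (\<Omega>\<^sub>1 \<times> \<Omega>\<^sub>2)" by (rule H1_tensor[OF H1])
    show "tensor (\<phi> n) g \<in> H01 (\<Omega>\<^sub>1 \<times> \<Omega>\<^sub>2)" for n by (rule test[OF \<phi>(1)])
    show "(\<lambda>n. ip_norm (H1_ip (\<Omega>\<^sub>1 \<times> \<Omega>\<^sub>2)) (\<lambda>z. tensor (\<phi> n) g z - tensor f g z)) \<longlonglongrightarrow> 0"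
    proof (rule tendsto_sandwich[OF always_eventually always_eventually tendsto_const
          tendsto_mult_left_zero[OF \<phi>(2), of "ip_norm (H1_ip \<Omega>\<^sub>2) g"]]; intro allI)
      fix n
      show "0 \<le> ip_norm (H1_ip (\<Omega>\<^sub>1 \<times> \<Omega>\<^sub>2)) (\<lambda>z. tensor (\<phi> n) g z - tensor f g z)"
        by (intro P.H1.norm_nonneg P.H1.diff_mem H1_tensor \<phi>H1 H1)
      show "ip_norm (H1_ip (\<Omega>\<^sub>1 \<times> \<Omega>\<^sub>2)) (\<lambda>z. tensor (\<phi> n) g z - tensor f g z)
          \<le> ip_norm (H1_ip \<Omega>\<^sub>1) (\<lambda>x. \<phi> n x - f x) * ip_norm (H1_ip \<Omega>\<^sub>2) g"
        unfolding tensor_diff by (intro H1_norm_tensor_le A.H1.diff_mem \<phi>H1 H1)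
    qed
  qed
qed

text \<open>
  The gradient pairing splits into a part for each factor. On slices, each part is the eigenvalue
  equation of that factor tested against a slice of \<open>\<Phi>\<close>, and contributes its eigenvalue to the sum.
\<close>

lemma tensor_equation_test:
  assumes f: "f \<in> H01 \<Omega>\<^sub>1" "\<And>h. h \<in> H01 \<Omega>\<^sub>1 \<Longrightarrow> grad_ip \<Omega>\<^sub>1 f h = s * L2_ip (vol \<Omega>\<^sub>1) f h"
    and g: "g \<in> H01 \<Omega>\<^sub>2" "\<And>h. h \<in> H01 \<Omega>\<^sub>2 \<Longrightarrow> grad_ip \<Omega>\<^sub>2 g h = t * L2_ip (vol \<Omega>\<^sub>2) g h"
    and \<Phi>: "\<Phi> \<in> test_functions (\<Omega>\<^sub>1 \<times> \<Omega>\<^sub>2)"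
  shows "grad_ip (\<Omega>\<^sub>1 \<times> \<Omega>\<^sub>2) (tensor f g) \<Phi> = (s + t) * L2_ip (vol (\<Omega>\<^sub>1 \<times> \<Omega>\<^sub>2)) (tensor f g) \<Phi>"
proof -
  let ?F = "grad \<Omega>\<^sub>1 f" and ?G = "grad \<Omega>\<^sub>2 g" and ?P = "vol \<Omega>\<^sub>1 \<Otimes>\<^sub>M vol \<Omega>\<^sub>2"
  note fH = A.H01_H1[OF f(1)] and gH = B.H01_H1[OF g(1)]
  note L = A.H1_L2[OF fH] A.grad_L2[OF fH] B.H1_L2[OF gH] B.grad_L2[OF gH]
  have \<Phi>L: "\<Phi> \<in> L2 ?P" unfolding vol_Times by (rule P.test_function_in_L2[OF \<Phi>])
  have N: "nabla \<Phi> \<in> L2 ?P" unfolding vol_Times by (rule nabla_L2[OF P.open_\<Omega> \<Phi>])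
  have fst: "grad_ip \<Omega>\<^sub>1 f h = L2_ip (vol \<Omega>\<^sub>1) ?F (nabla h)" if "h \<in> test_functions \<Omega>\<^sub>1" for h
    by (intro A.grad_ip_eq L A.test_function_in_L2 A.grad_weak fH weak_gradient_test_function A.open_\<Omega> that)
  have snd: "grad_ip \<Omega>\<^sub>2 g h = L2_ip (vol \<Omega>\<^sub>2) ?G (nabla h)" if "h \<in> test_functions \<Omega>\<^sub>2" for h
    by (intro B.grad_ip_eq L B.test_function_in_L2 B.grad_weak gH weak_gradient_test_function B.open_\<Omega> that)
  have "grad_ip (\<Omega>\<^sub>1 \<times> \<Omega>\<^sub>2) (tensor f g) \<Phi> = L2_ip ?P (tensor_gradient f ?F g ?G) (nabla \<Phi>)"
    unfolding vol_Times
    by (intro P.grad_ip_eq L2_tensor L P.test_function_in_L2 \<Phi> weak_gradient_tensor A.grad_weak B.grad_weak fH gH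
        weak_gradient_test_function P.open_\<Omega>)
  also have "\<dots> = L2_ip ?P (\<lambda>z. g (snd z) *\<^sub>R ?F (fst z)) (\<lambda>z. fst (nabla \<Phi> z))
      + L2_ip ?P (\<lambda>z. f (fst z) *\<^sub>R ?G (snd z)) (\<lambda>z. snd (nabla \<Phi> z))"
    unfolding tensor_gradient_def
    by (intro L2_ip_Pair vols.L2_tensor_scaleR_fst vols.L2_tensor_scaleR_snd L N)
  also have "L2_ip ?P (\<lambda>z. g (snd z) *\<^sub>R ?F (fst z)) (\<lambda>z. fst (nabla \<Phi> z))
      = (\<integral>y. g y * L2_ip (vol \<Omega>\<^sub>1) ?F (nabla (\<lambda>x. \<Phi> (x, y))) \<partial>vol \<Omega>\<^sub>2)"
    using vols.L2_ip_slices_fst[OF L(2,3) L2_fst_snd(1)[OF N]] by (simp add: nabla_slices[OF \<Phi>])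
  also have "\<dots> = (\<integral>y. s * (g y * L2_ip (vol \<Omega>\<^sub>1) f (\<lambda>x. \<Phi> (x, y))) \<partial>vol \<Omega>\<^sub>2)"
    using test_function_slices(1)[OF \<Phi>] f(2)[OF A.H01_test] by (simp add: fst[symmetric] mult_ac)
  also have "\<dots> = s * L2_ip ?P (tensor f g) \<Phi>"
    using vols.L2_ip_slices_fst[OF L(1,3) \<Phi>L] by (simp add: vols.tensor_alt(2))
  also have "L2_ip ?P (\<lambda>z. f (fst z) *\<^sub>R ?G (snd z)) (\<lambda>z. snd (nabla \<Phi> z))
      = (\<integral>x. f x * L2_ip (vol \<Omega>\<^sub>2) ?G (nabla (\<lambda>y. \<Phi> (x, y))) \<partial>vol \<Omega>\<^sub>1)"
    using vols.L2_ip_slices_snd[OF L(1,4) L2_fst_snd(2)[OF N]] by (simp add: nabla_slices[OF \<Phi>])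
  also have "\<dots> = (\<integral>x. t * (f x * L2_ip (vol \<Omega>\<^sub>2) g (\<lambda>y. \<Phi> (x, y))) \<partial>vol \<Omega>\<^sub>1)"
    using test_function_slices(2)[OF \<Phi>] g(2)[OF B.H01_test] by (simp add: snd[symmetric] mult_ac)
  also have "\<dots> = t * L2_ip ?P (tensor f g) \<Phi>"
    using vols.L2_ip_slices_snd[OF L(1,3) \<Phi>L] by (simp add: vols.tensor_alt(1))
  finally show ?thesis by (simp add: vol_Times distrib_right)
qed

lemma tensor_equation:
  assumes f: "f \<in> H01 \<Omega>\<^sub>1" "\<And>h. h \<in> H01 \<Omega>\<^sub>1 \<Longrightarrow> grad_ip \<Omega>\<^sub>1 f h = s * L2_ip (vol \<Omega>\<^sub>1) f h"
    and g: "g \<in> H01 \<Omega>\<^sub>2" "\<And>h. h \<in> H01 \<Omega>\<^sub>2 \<Longrightarrow> grad_ip \<Omega>\<^sub>2 g h = t * L2_ip (vol \<Omega>\<^sub>2) g h"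
    and h: "h \<in> H01 (\<Omega>\<^sub>1 \<times> \<Omega>\<^sub>2)"
  shows "grad_ip (\<Omega>\<^sub>1 \<times> \<Omega>\<^sub>2) (tensor f g) h = (s + t) * L2_ip (vol (\<Omega>\<^sub>1 \<times> \<Omega>\<^sub>2)) (tensor f g) h"
proof -
  let ?\<Omega> = "\<Omega>\<^sub>1 \<times> \<Omega>\<^sub>2"
  obtain \<Phi> where \<Phi>: "\<And>n::nat. \<Phi> n \<in> test_functions ?\<Omega>"
    "(\<lambda>n. ip_norm (H1_ip ?\<Omega>) (\<lambda>x. \<Phi> n x - h x)) \<longlonglongrightarrow> 0"
    by (rule P.H01_sequence[OF h]) (rule that)
  have \<Phi>H1: "\<Phi> n \<in> H1 ?\<Omega>" for n using \<Phi>(1) P.test_functions_subset_H1 by blast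
  have hH1: "h \<in> H1 ?\<Omega>" using h by (rule P.H01_H1)
  have T: "tensor f g \<in> H1 ?\<Omega>" by (rule P.H01_H1[OF H01_tensor[OF f(1) g(1)]])
  have lim: "(\<lambda>n. ip_norm (L2_ip (vol ?\<Omega>)) (\<lambda>x. \<Phi> n x - h x)) \<longlonglongrightarrow> 0"
    "(\<lambda>n. ip_norm (grad_ip ?\<Omega>) (\<lambda>x. \<Phi> n x - h x)) \<longlonglongrightarrow> 0"
    using \<Phi>(2) P.H1_norm_tendsto_iff[of \<Phi> h, OF \<Phi>H1 hH1] by auto
  have "(\<lambda>n. grad_ip ?\<Omega> (\<Phi> n) (tensor f g)) \<longlonglongrightarrow> grad_ip ?\<Omega> h (tensor f g)"
    by (rule P.grad.ip_tendsto[OF \<Phi>H1 hH1 T lim(2)])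
  moreover have "(\<lambda>n. (s + t) * L2_ip (vol ?\<Omega>) (\<Phi> n) (tensor f g)) \<longlonglongrightarrow> (s + t) * L2_ip (vol ?\<Omega>) h (tensor f g)"
    by (rule tendsto_mult_left[OF P.L2.ip_tendsto[OF P.H1_L2[OF \<Phi>H1] P.H1_L2[OF hH1] P.H1_L2[OF T] lim(1)]])
  moreover have "grad_ip ?\<Omega> (\<Phi> n) (tensor f g) = (s + t) * L2_ip (vol ?\<Omega>) (\<Phi> n) (tensor f g)" for n
    using tensor_equation_test[OF f g \<Phi>(1), of n] P.grad.sym[OF T \<Phi>H1, of n]
      L2_ip_commute[of "vol ?\<Omega>" "tensor f g" "\<Phi> n"] by simp
  ultimately have "grad_ip ?\<Omega> h (tensor f g) = (s + t) * L2_ip (vol ?\<Omega>) h (tensor f g)"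
    using LIMSEQ_unique by simp
  then show ?thesis
    using P.grad.sym[OF T hH1] L2_ip_commute[of "vol ?\<Omega>" "tensor f g" h] by simp
qed

end

section \<open>Eigenfunctions of the product\<close>

lemma finite_sublevel:
  fixes \<mu> :: "nat \<Rightarrow> real"
  assumes "filterlim \<mu> at_top sequentially"
  shows "finite {j. \<mu> j < c}"
proof -
  have "\<forall>\<^sub>F j in cofinite. c \<le> \<mu> j"
    using assms by (simp add: filterlim_at_top cofinite_eq_sequentially)
  then show ?thesis by (simp add: eventually_cofinite not_le)
qed

text \<open>
  The product family is re-indexed by \<open>nat\<close> with \<open>prod_decode\<close>, so that it is again a
  \<open>dirichlet_system\<close> and all results of that locale are available for the product.
\<close>

locale dirichlet_system_pair =
  A: dirichlet_system \<Omega>\<^sub>1 \<mu>\<^sub>1 e\<^sub>1 + B: dirichlet_system \<Omega>\<^sub>2 \<mu>\<^sub>2 e\<^sub>2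
  for \<Omega>\<^sub>1 :: "'a::euclidean_space set" and \<mu>\<^sub>1 e\<^sub>1
    and \<Omega>\<^sub>2 :: "'b::euclidean_space set" and \<mu>\<^sub>2 e\<^sub>2
begin

sublocale Q: bounded_open_pair \<Omega>\<^sub>1 \<Omega>\<^sub>2 ..

definition product_eigenvalue :: "nat \<Rightarrow> real" where
  "product_eigenvalue n = (case prod_decode n of (j, k) \<Rightarrow> \<mu>\<^sub>1 j + \<mu>\<^sub>2 k)"

definition product_eigenfunction :: "nat \<Rightarrow> 'a \<times> 'b \<Rightarrow> real" where
  "product_eigenfunction n = (case prod_decode n of (j, k) \<Rightarrow> tensor (e\<^sub>1 j) (e\<^sub>2 k))"

text \<open>
  Both summands are positive, so a sum below \<open>c\<close> has both summands below \<open>c\<close>, which leaves finitely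
  many pairs.
\<close>

lemma product_eigenvalue_at_top: "filterlim product_eigenvalue at_top sequentially"
  unfolding filterlim_at_top
proof
  fix c
  have "{n. product_eigenvalue n < c} \<subseteq> prod_encode ` ({j. \<mu>\<^sub>1 j < c} \<times> {k. \<mu>\<^sub>2 k < c})"
  proof
    fix n assume n: "n \<in> {n. product_eigenvalue n < c}"
    obtain j k where jk: "prod_decode n = (j, k)" by fastforce
    have "\<mu>\<^sub>1 j < c" "\<mu>\<^sub>2 k < c"
      using n jk A.eigenvalue_pos[of j] B.eigenvalue_pos[of k] by (simp_all add: product_eigenvalue_def)
    moreover have "n = prod_encode (j, k)" using jk by (metis prod_decode_inverse)
    ultimately show "n \<in> prod_encode ` ({j. \<mu>\<^sub>1 j < c} \<times> {k. \<mu>\<^sub>2 k < c})" by blast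
  qed
  moreover have "finite ({j. \<mu>\<^sub>1 j < c} \<times> {k. \<mu>\<^sub>2 k < c})"
    by (intro finite_cartesian_product finite_sublevel A.\<mu>_at_top B.\<mu>_at_top)
  ultimately have "finite {n. \<not> c \<le> product_eigenvalue n}"
    by (auto simp: not_le intro: finite_subset)
  then show "\<forall>\<^sub>F n in sequentially. c \<le> product_eigenvalue n"
    by (simp add: eventually_cofinite flip: cofinite_eq_sequentially)
qed

lemma product_eigenfunction_L2: "product_eigenfunction n \<in> L2 (vol (\<Omega>\<^sub>1 \<times> \<Omega>\<^sub>2))"
  by (simp add: product_eigenfunction_def Q.L2_tensor A.e_L2 B.e_L2 split: prod.split)

lemma product_eigenfunction_orthonormal: "Q.P.L2.orthonormal product_eigenfunction"
  unfolding Q.P.L2.orthonormal_def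
proof (intro conjI allI)
  show "range product_eigenfunction \<subseteq> L2 (vol (\<Omega>\<^sub>1 \<times> \<Omega>\<^sub>2))" using product_eigenfunction_L2 by auto
  fix m n
  obtain i j k l where ij: "prod_decode m = (i, j)" and kl: "prod_decode n = (k, l)" by fastforce
  have "m = n \<longleftrightarrow> i = k \<and> j = l" using ij kl inj_prod_decode[of UNIV] by (metis inj_eq prod.inject)
  moreover have "L2_ip (vol (\<Omega>\<^sub>1 \<times> \<Omega>\<^sub>2)) (product_eigenfunction m) (product_eigenfunction n)
      = L2_ip (vol \<Omega>\<^sub>1) (e\<^sub>1 i) (e\<^sub>1 k) * L2_ip (vol \<Omega>\<^sub>2) (e\<^sub>2 j) (e\<^sub>2 l)"
    by (simp add: product_eigenfunction_def ij kl Q.vols.L2_ip_tensor A.e_L2 B.e_L2 flip: Q.vol_Times)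
  ultimately show "L2_ip (vol (\<Omega>\<^sub>1 \<times> \<Omega>\<^sub>2)) (product_eigenfunction m) (product_eigenfunction n) = (if m = n then 1 else 0)"
    using A.e_orthonormal B.e_orthonormal by (simp add: A.L2.orthonormal_def B.L2.orthonormal_def)
qed

lemma product_eigenfunction_basis:
  "orthonormal_basis (L2 (vol (\<Omega>\<^sub>1 \<times> \<Omega>\<^sub>2))) (L2_ip (vol (\<Omega>\<^sub>1 \<times> \<Omega>\<^sub>2))) product_eigenfunction"
proof (rule Q.P.L2.complete_orthonormal_imp_basis[OF product_eigenfunction_orthonormal L2_complete_norm])
  fix w :: "'a \<times> 'b \<Rightarrow> real"
  assume w: "w \<in> L2 (vol (\<Omega>\<^sub>1 \<times> \<Omega>\<^sub>2))" and orth: "\<And>n. L2_ip (vol (\<Omega>\<^sub>1 \<times> \<Omega>\<^sub>2)) w (product_eigenfunction n) = 0"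
  show "L2_ip (vol (\<Omega>\<^sub>1 \<times> \<Omega>\<^sub>2)) w w = 0"
    unfolding Q.vol_Times[symmetric]
  proof (rule Q.vols.tensor_total[OF A.e_orthonormal A.e_basis B.e_orthonormal B.e_basis])
    show "w \<in> L2 (vol \<Omega>\<^sub>1 \<Otimes>\<^sub>M vol \<Omega>\<^sub>2)" using w by (simp add: Q.vol_Times)
    show "L2_ip (vol \<Omega>\<^sub>1 \<Otimes>\<^sub>M vol \<Omega>\<^sub>2) w (tensor (e\<^sub>1 j) (e\<^sub>2 k)) = 0" for j k
      using orth[of "prod_encode (j, k)"] by (simp add: product_eigenfunction_def Q.vol_Times)
  qed
qed

theorem product_eigensequence:
  "dirichlet_eigensequence (\<Omega>\<^sub>1 \<times> \<Omega>\<^sub>2) product_eigenvalue product_eigenfunction"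
  unfolding dirichlet_eigensequence_def
proof (intro conjI allI)
  fix n
  obtain j k where jk: "prod_decode n = (j, k)" by fastforce
  show "0 < product_eigenvalue n"
    using A.eigenvalue_pos B.eigenvalue_pos by (simp add: product_eigenvalue_def jk add_pos_pos)
  show "dirichlet_eigenpair (\<Omega>\<^sub>1 \<times> \<Omega>\<^sub>2) (product_eigenvalue n) (product_eigenfunction n)"
    unfolding dirichlet_eigenpair_def
  proof (intro conjI ballI)
    show "product_eigenfunction n \<in> H01 (\<Omega>\<^sub>1 \<times> \<Omega>\<^sub>2)"
      by (simp add: product_eigenfunction_def jk Q.H01_tensor A.e_H01 B.e_H01)
    have "L2_ip (vol (\<Omega>\<^sub>1 \<times> \<Omega>\<^sub>2)) (product_eigenfunction n) (product_eigenfunction n) \<noteq> 0"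
      using product_eigenfunction_orthonormal by (simp add: Q.P.L2.orthonormal_def)
    then show "\<not> (AE z in vol (\<Omega>\<^sub>1 \<times> \<Omega>\<^sub>2). product_eigenfunction n z = 0)"
      by (simp add: L2_ip_self_eq_0_iff[OF product_eigenfunction_L2])
    fix h :: "'a \<times> 'b \<Rightarrow> real" assume h: "h \<in> H01 (\<Omega>\<^sub>1 \<times> \<Omega>\<^sub>2)"
    show "grad_ip (\<Omega>\<^sub>1 \<times> \<Omega>\<^sub>2) (product_eigenfunction n) h
        = product_eigenvalue n * L2_ip (vol (\<Omega>\<^sub>1 \<times> \<Omega>\<^sub>2)) (product_eigenfunction n) h"
      unfolding product_eigenfunction_def product_eigenvalue_def jk prod.case
      by (rule Q.tensor_equation[OF A.e_H01 A.e_equation B.e_H01 B.e_equation h])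
  qed
qed (rule product_eigenvalue_at_top product_eigenfunction_basis)+

sublocale P: dirichlet_system "\<Omega>\<^sub>1 \<times> \<Omega>\<^sub>2" product_eigenvalue product_eigenfunction
  by unfold_locales (rule product_eigensequence)

lemma product_eigenvalues:
  "{t. dirichlet_eigenvalue (\<Omega>\<^sub>1 \<times> \<Omega>\<^sub>2) t} = {\<mu>\<^sub>1 j + \<mu>\<^sub>2 k | j k. True}"
proof (intro set_eqI iffI)
  fix t assume "t \<in> {t. dirichlet_eigenvalue (\<Omega>\<^sub>1 \<times> \<Omega>\<^sub>2) t}"
  then obtain n where "t = product_eigenvalue n" by (auto simp: P.dirichlet_eigenvalue_iff)
  then have "t = \<mu>\<^sub>1 (fst (prod_decode n)) + \<mu>\<^sub>2 (snd (prod_decode n))"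
    by (simp add: product_eigenvalue_def case_prod_beta)
  then show "t \<in> {\<mu>\<^sub>1 j + \<mu>\<^sub>2 k | j k. True}" by blast
next
  fix t assume "t \<in> {\<mu>\<^sub>1 j + \<mu>\<^sub>2 k | j k. True}"
  then obtain j k where "t = product_eigenvalue (prod_encode (j, k))"
    by (auto simp: product_eigenvalue_def)
  then show "t \<in> {t. dirichlet_eigenvalue (\<Omega>\<^sub>1 \<times> \<Omega>\<^sub>2) t}" by (simp add: P.dirichlet_eigenvalue_iff)
qed

section \<open>The Hilbert tensor product\<close>

abbreviation tensor_basis :: "nat \<times> nat \<Rightarrow> 'a \<times> 'b \<Rightarrow> real" where
  "tensor_basis \<equiv> \<lambda>(j, k). tensor (A.p j) (B.p k)"

abbreviation comb :: "(nat \<times> nat \<Rightarrow> real) \<Rightarrow> 'a \<times> 'b \<Rightarrow> real" where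
  "comb \<equiv> tensor_comb A.p B.p"

abbreviation coeff :: "('a \<times> 'b \<Rightarrow> real) \<Rightarrow> nat \<times> nat \<Rightarrow> real" where
  "coeff \<equiv> tensor_coeff A.p B.p"

text \<open>
  The factor from the product of the two normalised eigenfunctions to the normalised eigenfunction of
  the product. It is the coordinate description of the isometry onto \<open>H01\<close> of the product.
\<close>

definition weight :: "nat \<times> nat \<Rightarrow> real" where
  "weight = (\<lambda>(j, k). (\<mu>\<^sub>1 j + \<mu>\<^sub>2 k) powr (- 1 / 2) / (\<mu>\<^sub>1 j powr (- 1 / 2) * \<mu>\<^sub>2 k powr (- 1 / 2)))"

lemma weight_pos: "0 < weight i"
proof (cases i)
  case (Pair j k)
  have "0 < (\<mu>\<^sub>1 j + \<mu>\<^sub>2 k) powr (- 1 / 2) / (\<mu>\<^sub>1 j powr (- 1 / 2) * \<mu>\<^sub>2 k powr (- 1 / 2))"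
    using A.eigenvalue_pos[of j] B.eigenvalue_pos[of k]
    by (intro divide_pos_pos mult_pos_pos) (simp_all add: add_pos_pos)
  then show ?thesis by (simp add: weight_def Pair)
qed

lemma tensor_basis_eq: "tensor_basis (j, k) z
    = \<mu>\<^sub>1 j powr (- 1 / 2) * \<mu>\<^sub>2 k powr (- 1 / 2) * tensor (e\<^sub>1 j) (e\<^sub>2 k) z"
  by (simp add: tensor_def H01_normalised_def case_prod_beta')

lemma weighted_tensor_basis:
  "weight (j, k) * tensor_basis (j, k) z = (\<mu>\<^sub>1 j + \<mu>\<^sub>2 k) powr (- 1 / 2) * tensor (e\<^sub>1 j) (e\<^sub>2 k) z"
  unfolding tensor_basis_eq using A.eigenvalue_pos[of j] B.eigenvalue_pos[of k]
  by (simp add: weight_def)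

lemma weighted_tensor_basis_encode: "weight i * tensor_basis i z = P.p (prod_encode i) z"
proof (cases i)
  case (Pair j k)
  show ?thesis
    unfolding Pair weighted_tensor_basis
    by (simp add: H01_normalised_def[of product_eigenvalue] product_eigenvalue_def product_eigenfunction_def)
qed

lemma comb_eq_sum:
  assumes "finite I" "\<And>i. i \<notin> I \<Longrightarrow> c i = 0"
  shows "comb c z = (\<Sum>i\<in>I. c i * tensor_basis i z)"
proof -
  have "comb c z = (\<Sum>i\<in>{i. c i \<noteq> 0}. c i * tensor_basis i z)"
    unfolding tensor_comb_def by (intro sum.cong) auto
  also have "\<dots> = (\<Sum>i\<in>I. c i * tensor_basis i z)"
    using assms by (intro sum.mono_neutral_left) auto
  finally show ?thesis .
qed

lemma comb_weighted:
  assumes "finite I" "\<And>i. i \<notin> I \<Longrightarrow> c i = 0"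
  shows "comb (\<lambda>i. weight i * c i) z = (\<Sum>i\<in>I. c i * P.p (prod_encode i) z)"
proof -
  have "comb (\<lambda>i. weight i * c i) z = (\<Sum>i\<in>I. weight i * c i * tensor_basis i z)"
    using assms by (intro comb_eq_sum) auto
  also have "\<dots> = (\<Sum>i\<in>I. c i * P.p (prod_encode i) z)"
  proof (intro sum.cong refl)
    fix i
    have "weight i * c i * tensor_basis i z = c i * (weight i * tensor_basis i z)" by (simp only: mult_ac)
    then show "weight i * c i * tensor_basis i z = c i * P.p (prod_encode i) z"
      by (simp only: weighted_tensor_basis_encode)
  qed
  finally show ?thesis .
qed

lemma comb_H01: "c \<in> fin_coeffs \<Longrightarrow> comb c \<in> H01 (\<Omega>\<^sub>1 \<times> \<Omega>\<^sub>2)"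
proof -
  assume "c \<in> fin_coeffs"
  then have "finite {i. c i \<noteq> 0}" by (simp add: fin_coeffs_def)
  then have "comb c = (\<lambda>z. \<Sum>i\<in>{i. c i \<noteq> 0}. c i * tensor_basis i z)"
    by (intro ext comb_eq_sum) auto
  moreover have "tensor_basis i \<in> H01 (\<Omega>\<^sub>1 \<times> \<Omega>\<^sub>2)" for i
    by (cases i) (simp add: Q.H01_tensor A.p_H01 B.p_H01)
  ultimately show ?thesis using Q.P.H01.sum_mem[of _ tensor_basis c] by simp
qed

lemma grad_ip_comb_weighted:
  assumes c: "finite {i. c i \<noteq> 0}" and d: "finite {i. d i \<noteq> 0}"
  shows "grad_ip (\<Omega>\<^sub>1 \<times> \<Omega>\<^sub>2) (comb (\<lambda>i. weight i * c i)) (comb (\<lambda>i. weight i * d i))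
       = (\<Sum>i | c i \<noteq> 0. c i * d i)"
proof -
  let ?I = "{i. c i \<noteq> 0}" and ?J = "{i. d i \<noteq> 0}"
  let ?p = "\<lambda>i. P.p (prod_encode i)" and ?g = "grad_ip (\<Omega>\<^sub>1 \<times> \<Omega>\<^sub>2)"
  have H: "?p i \<in> H01 (\<Omega>\<^sub>1 \<times> \<Omega>\<^sub>2)" for i by (rule P.p_H01)
  have ip: "?g (?p i) (?p j) = (if i = j then 1 else 0)" for i j
    using P.p_orthonormal by (simp add: Q.P.H01.orthonormal_def)
  have C: "comb (\<lambda>i. weight i * c i) = (\<lambda>z. \<Sum>i\<in>?I. c i * ?p i z)"
    by (intro ext comb_weighted c) auto
  have D: "comb (\<lambda>i. weight i * d i) = (\<lambda>z. \<Sum>i\<in>?J. d i * ?p i z)"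
    by (intro ext comb_weighted d) auto
  have DH: "(\<lambda>z. \<Sum>i\<in>?J. d i * ?p i z) \<in> H01 (\<Omega>\<^sub>1 \<times> \<Omega>\<^sub>2)" by (rule Q.P.H01.sum_mem[OF H])
  have coord: "?g (?p i) (\<lambda>z. \<Sum>i\<in>?J. d i * ?p i z) = d i" for i
  proof -
    have "?g (?p i) (\<lambda>z. \<Sum>i\<in>?J. d i * ?p i z) = (\<Sum>j\<in>?J. d j * ?g (?p j) (?p i))"
      by (subst Q.P.H01.sym[OF H DH], rule Q.P.H01.ip_sum[OF H H])
    also have "\<dots> = (\<Sum>j\<in>?J. if j = i then d j else 0)" by (intro sum.cong) (auto simp: ip)
    also have "\<dots> = d i" using d by (simp add: sum.delta)
    finally show ?thesis .
  qed
  show ?thesis unfolding C D Q.P.H01.ip_sum[OF H DH] coord ..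
qed

text \<open>
  Coefficients are recovered by pairing with a single weighted basis tensor, to which
  \<open>grad_ip_comb_weighted\<close> applies once the weights have been divided out of \<open>c\<close>.
\<close>

lemma comb_inj: "inj_on comb fin_coeffs"
proof (rule inj_onI)
  fix c d :: "nat \<times> nat \<Rightarrow> real"
  assume c: "c \<in> fin_coeffs" and d: "d \<in> fin_coeffs" and eq: "comb c = comb d"
  have "c i * (1 / weight i) = d i * (1 / weight i)" for i
  proof -
    \<comment> \<open>The coefficients of the single basis tensor \<open>i\<close>.\<close>
    define s where "s = (\<lambda>j. if j = i then 1 else 0 :: real)"
    have s: "finite {i. s i \<noteq> 0}" by (simp add: s_def)
    have pair: "grad_ip (\<Omega>\<^sub>1 \<times> \<Omega>\<^sub>2) (comb c) (comb (\<lambda>i. weight i * s i)) = c i * (1 / weight i)"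
      if "c \<in> fin_coeffs" for c
    proof -
      define c' where "c' = (\<lambda>i. c i / weight i)"
      have "c = (\<lambda>i. weight i * c' i)" using weight_pos by (simp add: c'_def less_imp_neq[symmetric])
      moreover have f: "finite {i. c' i \<noteq> 0}"
        using that by (rule_tac finite_subset[of _ "{i. c i \<noteq> 0}"]) (auto simp: c'_def fin_coeffs_def)
      ultimately have "grad_ip (\<Omega>\<^sub>1 \<times> \<Omega>\<^sub>2) (comb c) (comb (\<lambda>i. weight i * s i)) = (\<Sum>j | c' j \<noteq> 0. c' j * s j)"
        using grad_ip_comb_weighted[OF f s] by simp
      also have "\<dots> = (\<Sum>j | c' j \<noteq> 0. if j = i then c' j else 0)"
        by (intro sum.cong) (auto simp: s_def)
      also have "\<dots> = c' i" using f by (simp add: sum.delta)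
      finally show ?thesis by (simp add: c'_def)
    qed
    show ?thesis unfolding pair[OF c, symmetric] pair[OF d, symmetric] eq ..
  qed
  then show "c = d" using weight_pos by (auto simp: fun_eq_iff less_imp_neq[symmetric])
qed

lemma coeff_comb: "c \<in> fin_coeffs \<Longrightarrow> coeff (comb c) = c"
  unfolding tensor_coeff_def by (rule the_inv_into_f_f[OF comb_inj])

definition isometry :: "('a \<times> 'b \<Rightarrow> real) \<Rightarrow> 'a \<times> 'b \<Rightarrow> real" where
  "isometry g = comb (\<lambda>i. weight i * coeff g i)"

lemma fin_coeffs_weighted: "c \<in> fin_coeffs \<Longrightarrow> (\<lambda>i. weight i * c i) \<in> fin_coeffs"
  using finite_subset[of "{i. weight i * c i \<noteq> 0}" "{i. c i \<noteq> 0}"] by (auto simp: fin_coeffs_def)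

lemma comb_lincomb:
  assumes "c \<in> fin_coeffs" "d \<in> fin_coeffs"
  shows "(\<lambda>i. a * c i + b * d i) \<in> fin_coeffs" "comb (\<lambda>i. a * c i + b * d i) z = a * comb c z + b * comb d z"
proof -
  let ?I = "{i. c i \<noteq> 0} \<union> {i. d i \<noteq> 0}"
  have I: "finite ?I" using assms by (simp add: fin_coeffs_def)
  show "(\<lambda>i. a * c i + b * d i) \<in> fin_coeffs"
    unfolding fin_coeffs_def by (intro CollectI finite_subset[OF _ I]) auto
  have "comb (\<lambda>i. a * c i + b * d i) z = (\<Sum>i\<in>?I. (a * c i + b * d i) * tensor_basis i z)"
    using I by (intro comb_eq_sum) auto
  moreover have "comb c z = (\<Sum>i\<in>?I. c i * tensor_basis i z)" "comb d z = (\<Sum>i\<in>?I. d i * tensor_basis i z)"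
    using I by (intro comb_eq_sum; auto)+
  ultimately show "comb (\<lambda>i. a * c i + b * d i) z = a * comb c z + b * comb d z"
    by (simp add: distrib_right sum.distrib sum_distrib_left mult.assoc)
qed

lemma isometry_comb: "c \<in> fin_coeffs \<Longrightarrow> isometry (comb c) = comb (\<lambda>i. weight i * c i)"
  by (simp add: isometry_def coeff_comb)

lemma isometry_lincomb:
  assumes "g \<in> tensor_space A.p B.p" "h \<in> tensor_space A.p B.p"
  shows "isometry (\<lambda>z. a * g z + b * h z) z = a * isometry g z + b * isometry h z"
proof -
  obtain c d where c: "c \<in> fin_coeffs" "g = comb c" and d: "d \<in> fin_coeffs" "h = comb d"
    using assms by (auto simp: tensor_space_def)
  have "(\<lambda>z. a * g z + b * h z) = comb (\<lambda>i. a * c i + b * d i)"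
    unfolding c(2) d(2) by (intro ext comb_lincomb(2)[OF c(1) d(1), symmetric])
  then have "isometry (\<lambda>z. a * g z + b * h z) z = comb (\<lambda>i. weight i * (a * c i + b * d i)) z"
    by (simp add: isometry_comb comb_lincomb(1)[OF c(1) d(1)])
  also have "(\<lambda>i. weight i * (a * c i + b * d i)) = (\<lambda>i. a * (weight i * c i) + b * (weight i * d i))"
    by (simp add: algebra_simps)
  finally show ?thesis
    by (simp add: comb_lincomb(2) fin_coeffs_weighted c d isometry_comb)
qed

lemma isometry_isometric:
  assumes "g \<in> tensor_space A.p B.p" "h \<in> tensor_space A.p B.p"
  shows "grad_ip (\<Omega>\<^sub>1 \<times> \<Omega>\<^sub>2) (isometry g) (isometry h) = tensor_ip A.p B.p g h"
proof -
  obtain c d where c: "c \<in> fin_coeffs" "g = comb c" and d: "d \<in> fin_coeffs" "h = comb d"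
    using assms by (auto simp: tensor_space_def)
  then show ?thesis
    by (simp add: isometry_comb tensor_ip_def coeff_comb grad_ip_comb_weighted fin_coeffs_def)
qed

text \<open>
  The nat-indexed partial sums of \<open>dirichlet_system\<close> are finite combinations of weighted tensors, so
  density of the former gives density of the image of the isometry.
\<close>

lemma combination_in_image:
  "\<exists>d\<in>fin_coeffs. (\<lambda>z. \<Sum>n<N. c n * P.p n z) = comb (\<lambda>i. weight i * d i)"
proof -
  define d where "d i = (if prod_encode i < N then c (prod_encode i) else 0)" for i
  let ?I = "prod_decode ` {..<N}"
  have out: "d i = 0" if "i \<notin> ?I" for i
    using that by (force simp: d_def image_iff intro: prod_encode_inverse[symmetric])
  then have "{i. d i \<noteq> 0} \<subseteq> ?I" by auto
  then have "d \<in> fin_coeffs" by (auto simp: fin_coeffs_def intro: finite_subset)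
  moreover have "(\<Sum>n<N. c n * P.p n z) = comb (\<lambda>i. weight i * d i) z" for z
  proof -
    have "comb (\<lambda>i. weight i * d i) z = (\<Sum>i\<in>?I. d i * P.p (prod_encode i) z)"
      by (intro comb_weighted out) auto
    also have "\<dots> = (\<Sum>n<N. d (prod_decode n) * P.p n z)"
      by (subst sum.reindex) (auto intro: inj_on_subset[OF inj_prod_decode])
    also have "\<dots> = (\<Sum>n<N. c n * P.p n z)" by (intro sum.cong) (auto simp: d_def)
    finally show ?thesis by simp
  qed
  ultimately show ?thesis by blast
qed

lemma tensor_space_subset_H01: "tensor_space A.p B.p \<subseteq> H01 (\<Omega>\<^sub>1 \<times> \<Omega>\<^sub>2)"
  unfolding tensor_space_def by (intro image_subsetI comb_H01)

lemma H01_product_eq_closure: "H01 (\<Omega>\<^sub>1 \<times> \<Omega>\<^sub>2) = H1_closure (\<Omega>\<^sub>1 \<times> \<Omega>\<^sub>2) (tensor_space A.p B.p)"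
proof (rule P.H01_eq_H1_closure[OF tensor_space_subset_H01])
  fix N c
  obtain d where d: "d \<in> fin_coeffs" "(\<lambda>z. \<Sum>n<N. c n * P.p n z) = comb (\<lambda>i. weight i * d i)"
    using combination_in_image[of c N] by (elim bexE) (rule that)
  show "(\<lambda>z. \<Sum>n<N. c n * P.p n z) \<in> tensor_space A.p B.p"
    unfolding d(2) tensor_space_def by (intro imageI fin_coeffs_weighted d(1))
qed

lemma isometry_dense: "dense_in (grad_ip (\<Omega>\<^sub>1 \<times> \<Omega>\<^sub>2)) (isometry ` tensor_space A.p B.p) (H01 (\<Omega>\<^sub>1 \<times> \<Omega>\<^sub>2))"
  unfolding dense_in_def
proof (intro conjI ballI allI impI)
  show "isometry ` tensor_space A.p B.p \<subseteq> H01 (\<Omega>\<^sub>1 \<times> \<Omega>\<^sub>2)"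
    unfolding tensor_space_def image_image
    by (intro image_subsetI) (simp add: isometry_comb comb_H01 fin_coeffs_weighted)
  fix u and \<epsilon> :: real assume "u \<in> H01 (\<Omega>\<^sub>1 \<times> \<Omega>\<^sub>2)" "\<epsilon> > 0"
  then obtain N c where Nc: "ip_norm (grad_ip (\<Omega>\<^sub>1 \<times> \<Omega>\<^sub>2)) (\<lambda>z. u z - (\<Sum>n<N. c n * P.p n z)) < \<epsilon>"
    using P.p_basis unfolding orthonormal_basis_def dense_in_def by blast
  obtain d where d: "d \<in> fin_coeffs" "(\<lambda>z. \<Sum>n<N. c n * P.p n z) = comb (\<lambda>i. weight i * d i)"
    using combination_in_image[of c N] by (elim bexE) (rule that)
  have "(\<lambda>z. \<Sum>n<N. c n * P.p n z) \<in> isometry ` tensor_space A.p B.p"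
    unfolding d(2) isometry_comb[OF d(1), symmetric] tensor_space_def by (intro imageI d(1))
  with Nc show "\<exists>v\<in>isometry ` tensor_space A.p B.p. ip_norm (grad_ip (\<Omega>\<^sub>1 \<times> \<Omega>\<^sub>2)) (\<lambda>z. u z - v z) < \<epsilon>"
    by (rule bexI)
qed

lemma isometry_tensor:
  "isometry (tensor (A.p j) (B.p k)) z = (\<mu>\<^sub>1 j + \<mu>\<^sub>2 k) powr (- 1 / 2) * tensor (e\<^sub>1 j) (e\<^sub>2 k) z"
proof -
  define s where "s = (\<lambda>i. if i = (j, k) then 1 else 0 :: real)"
  have s: "s \<in> fin_coeffs" by (simp add: fin_coeffs_def s_def)
  have single: "comb c z = c (j, k) * tensor_basis (j, k) z" if "\<And>i. i \<noteq> (j, k) \<Longrightarrow> c i = 0" for c z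
    using comb_eq_sum[of "{(j, k)}" c z] that by simp
  have "tensor (A.p j) (B.p k) = comb s"
  proof
    fix z show "tensor (A.p j) (B.p k) z = comb s z" using single[of s z] by (simp add: s_def)
  qed
  then have "isometry (tensor (A.p j) (B.p k)) z = comb (\<lambda>i. weight i * s i) z"
    by (simp add: isometry_comb[OF s])
  also have "\<dots> = weight (j, k) * tensor_basis (j, k) z"
    using single[of "\<lambda>i. weight i * s i" z] by (simp add: s_def)
  finally show ?thesis by (simp only: weighted_tensor_basis)
qed

lemma hilbert_tensor_product_H01:
  "hilbert_tensor_product_via (vol \<Omega>\<^sub>1) (H01 \<Omega>\<^sub>1) (grad_ip \<Omega>\<^sub>1) A.p (vol \<Omega>\<^sub>2) (H01 \<Omega>\<^sub>2) (grad_ip \<Omega>\<^sub>2) B.p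
     isometry (vol (\<Omega>\<^sub>1 \<times> \<Omega>\<^sub>2)) (H01 (\<Omega>\<^sub>1 \<times> \<Omega>\<^sub>2)) (grad_ip (\<Omega>\<^sub>1 \<times> \<Omega>\<^sub>2))"
  unfolding hilbert_tensor_product_via_def completion_via_def
  by (intro conjI ballI allI A.hilbert_on_H01 B.hilbert_on_H01 P.hilbert_on_H01 A.p_basis B.p_basis
      isometry_isometric isometry_dense AE_I2 isometry_lincomb)

end

lemma B2_bounded_open: "B2 \<Omega> \<Longrightarrow> bounded_open \<Omega>"
  by (simp add: B2_def B1_def region_def bounded_open_def)

theorem corollary4p3:
  fixes \<Omega>\<^sub>1 :: "'a::euclidean_space set" and \<Omega>\<^sub>2 :: "'b::euclidean_space set"
    and \<mu>\<^sub>1 \<mu>\<^sub>2 :: "nat \<Rightarrow> real"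
    and e\<^sub>1 :: "nat \<Rightarrow> 'a \<Rightarrow> real" and e\<^sub>2 :: "nat \<Rightarrow> 'b \<Rightarrow> real"
  assumes "region \<Omega>\<^sub>1" and "B2 \<Omega>\<^sub>1" and "region \<Omega>\<^sub>2" and "B2 \<Omega>\<^sub>2"
    and "dirichlet_eigensequence \<Omega>\<^sub>1 \<mu>\<^sub>1 e\<^sub>1" and "dirichlet_eigensequence \<Omega>\<^sub>2 \<mu>\<^sub>2 e\<^sub>2"
  defines "\<Omega>\<^sub>p \<equiv> \<Omega>\<^sub>1 \<times> \<Omega>\<^sub>2"
    and "p \<equiv> H01_normalised \<mu>\<^sub>1 e\<^sub>1" and "q \<equiv> H01_normalised \<mu>\<^sub>2 e\<^sub>2"
    and "u \<equiv> (\<lambda>j k. tensor (e\<^sub>1 j) (e\<^sub>2 k))"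
  shows "{t. dirichlet_eigenvalue \<Omega>\<^sub>p t} = {\<mu>\<^sub>1 j + \<mu>\<^sub>2 k | j k. True}
    \<and> tensor_space p q \<subseteq> H1 \<Omega>\<^sub>p \<and> H01 \<Omega>\<^sub>p = H1_closure \<Omega>\<^sub>p (tensor_space p q)
    \<and> (\<exists>J. hilbert_tensor_product_via
          (vol \<Omega>\<^sub>1) (H01 \<Omega>\<^sub>1) (grad_ip \<Omega>\<^sub>1) p (vol \<Omega>\<^sub>2) (H01 \<Omega>\<^sub>2) (grad_ip \<Omega>\<^sub>2) q
          J (vol \<Omega>\<^sub>p) (H01 \<Omega>\<^sub>p) (grad_ip \<Omega>\<^sub>p)
        \<and> (\<forall>j k. AE z in vol \<Omega>\<^sub>p.
              J (tensor (p j) (q k)) z = (\<mu>\<^sub>1 j + \<mu>\<^sub>2 k) powr (- 1 / 2) * u j k z))"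
proof -
  interpret dirichlet_system_pair \<Omega>\<^sub>1 \<mu>\<^sub>1 e\<^sub>1 \<Omega>\<^sub>2 \<mu>\<^sub>2 e\<^sub>2
    using assms(1-6) by (simp add: dirichlet_system_pair_def dirichlet_system_def
        dirichlet_system_axioms_def B2_bounded_open)
  show ?thesis
    unfolding \<Omega>\<^sub>p_def p_def q_def u_def
  proof (intro conjI exI allI)
    show "tensor_space A.p B.p \<subseteq> H1 (\<Omega>\<^sub>1 \<times> \<Omega>\<^sub>2)"
      using tensor_space_subset_H01 Q.P.H01_subset_H1 by (rule order_trans)
    show "AE z in vol (\<Omega>\<^sub>1 \<times> \<Omega>\<^sub>2). isometry (tensor (A.p j) (B.p k)) z
        = (\<mu>\<^sub>1 j + \<mu>\<^sub>2 k) powr (- 1 / 2) * tensor (e\<^sub>1 j) (e\<^sub>2 k) z" for j k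
      by (intro AE_I2 isometry_tensor)
  qed (rule product_eigenvalues H01_product_eq_closure hilbert_tensor_product_H01)+
qed

end
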